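(* Let $n\ge3$. Suppose that $\mathbf a\in L^2_{loc}(\mathbb R^n)$ is a real-valued vector field, $A$ is an elliptic matrix with complex, bounded, measurable coefficients (constants $\lambda,\Lambda$), $V\in L^1_{loc}(\mathbb R^n)$ is real-valued and non-negative, and assume $$V+|\mathbf B|\in RH_{n/2},\qquad 0\le V\le c\,m(\cdot,V+|\mathbf B|)^2,\qquad |\nabla\mathbf B|\le c'\,m(\cdot,V+|\mathbf B|)^3$$ for some constants $c,c'$. Then, for all $u\in\dot{\mathcal V}_{\mathbf a,V}$, $$\int_{\mathbb R^n}m(x,V+|\mathbf B|)^2|u|^2\,dx\le C\int_{\mathbb R^n}\big(\mathrm{Re}\,A D_{\mathbf a}u\cdot\overline{D_{\mathbf a}u}+V|u|^2\big)\,dx,$$ where $C$ depends on the constants $c,c'$ and on $\lambda$ and $\|V+|\mathbf B|\|_{RH_{n/2}}$.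
   Context: Ellipticity: $\lambda|\xi|^2\le \mathrm{Re}\sum_{i,j}A_{ij}(x)\xi_j\overline{\xi_i}$ for all $\xi\in\mathbb C^n$, a.e. $x$, and $\|A\|_{L^\infty}\le\Lambda$, with $\lambda>0$, $\Lambda<\infty$. $D_{\mathbf a}=\nabla-i\mathbf a$; $\mathbf B=(b_{jk})$ with $b_{jk}=\partial_{x_k}a_j-\partial_{x_j}a_k$ (distributional derivatives, assumed to be functions), $|\mathbf B|$ its pointwise norm. $w\in L^p_{loc}(\mathbb R^n)$, $w>0$ a.e., is in $RH_p$ if $\|w\|_{RH_p}:=\sup_{B}\big(\frac1{|B|}\int_B w^p\big)^{1/p}\big/\big(\frac1{|B|}\int_B w\big)<\infty$, sup over all balls $B\subset\mathbb R^n$. For $w\in RH_p$, $p\ge n/2$, $\frac1{m(x,w)}:=\sup\{r>0:\ \frac1{r^{n-2}}\int_{B(x,r)}w\le1\}$. $\dot{\mathcal V}_{\mathbf a,V}$ is the completion of $C_c^\infty(\mathbb R^n)$ under the norm $\big(\mathrm{Re}\int A D_{\mathbf a}u\cdot\overline{D_{\mathbf a}u}+V|u|^2\big)^{1/2}$; it embeds continuously in $L^{2n/(n-2)}(\mathbb R^n)$. *)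

theory Defs
  imports "HOL-Analysis.Analysis"
begin

section \<open>Test functions and distributional derivatives\<close>

primrec cont_diff :: "nat \<Rightarrow> (real ^ 'n \<Rightarrow> 'b::real_normed_vector) \<Rightarrow> bool" where
  "cont_diff 0 f \<longleftrightarrow> continuous_on UNIV f"
| "cont_diff (Suc k) f \<longleftrightarrow>
     (\<forall>x. f differentiable (at x)) \<and> (\<forall>v. cont_diff k (\<lambda>x. frechet_derivative f (at x) v))"

definition test_fun :: "(real ^ 'n \<Rightarrow> 'b::real_normed_vector) \<Rightarrow> bool" where
  "test_fun \<phi> \<longleftrightarrow> (\<forall>k. cont_diff k \<phi>) \<and> compact (closure {x. \<phi> x \<noteq> 0})"

definition partial :: "'n \<Rightarrow> (real ^ 'n \<Rightarrow> 'b::real_normed_vector) \<Rightarrow> real ^ 'n \<Rightarrow> 'b" where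
  "partial j f x = frechet_derivative f (at x) (axis j 1)"

definition loc_integrable ::
    "(real ^ 'n \<Rightarrow> 'b::{banach, second_countable_topology}) \<Rightarrow> bool" where
  "loc_integrable f \<longleftrightarrow>
     f \<in> borel_measurable lebesgue \<and> (\<forall>K. compact K \<longrightarrow> set_integrable lebesgue K f)"

definition loc_Lp :: "real \<Rightarrow> (real ^ 'n \<Rightarrow> 'b::{banach, second_countable_topology}) \<Rightarrow> bool" where
  "loc_Lp p f \<longleftrightarrow>
     f \<in> borel_measurable lebesgue \<and>
     (\<forall>K. compact K \<longrightarrow> set_integrable lebesgue K (\<lambda>x. norm (f x) powr p))"

(* Real-valued test functions suffice, also for complex-valued f, by linearity. *)
definition has_weak_partial ::
    "'n \<Rightarrow> (real ^ 'n \<Rightarrow> 'b::{banach, second_countable_topology}) \<Rightarrow> (real ^ 'n \<Rightarrow> 'b) \<Rightarrow> bool" where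
  "has_weak_partial j f g \<longleftrightarrow>
     loc_integrable f \<and> loc_integrable g \<and>
     (\<forall>\<phi> :: real ^ 'n \<Rightarrow> real. test_fun \<phi> \<longrightarrow>
        (LINT x|lebesgue. \<phi> x *\<^sub>R g x) = - (LINT x|lebesgue. partial j \<phi> x *\<^sub>R f x))"


section \<open>Magnetic field and magnetic gradient\<close>

(* Only the combinations b_jk = d_k a_j - d_j a_k are required to be functions,
   not the individual distributional derivatives of a. *)
definition has_magnetic_field :: "(real ^ 'n \<Rightarrow> real ^ 'n) \<Rightarrow> (real ^ 'n \<Rightarrow> real ^ 'n ^ 'n) \<Rightarrow> bool" where
  "has_magnetic_field a B \<longleftrightarrow>
     (\<forall>j k. loc_integrable (\<lambda>x. B x $ j $ k) \<and>
        (\<forall>\<phi> :: real ^ 'n \<Rightarrow> real. test_fun \<phi> \<longrightarrow>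
           (LINT x|lebesgue. \<phi> x * B x $ j $ k) =
           - (LINT x|lebesgue. partial k \<phi> x * a x $ j - partial j \<phi> x * a x $ k)))"

(* DB x $ j $ k $ l is the l-th distributional partial derivative of b_jk. The norms of B x and
   DB x as nested vectors are the Euclidean (Frobenius) norms. *)
definition has_weak_gradient_field ::
    "(real ^ 'n \<Rightarrow> real ^ 'n ^ 'n) \<Rightarrow> (real ^ 'n \<Rightarrow> real ^ 'n ^ 'n ^ 'n) \<Rightarrow> bool" where
  "has_weak_gradient_field B DB \<longleftrightarrow>
     (\<forall>j k l. has_weak_partial l (\<lambda>x. B x $ j $ k) (\<lambda>x. DB x $ j $ k $ l))"

definition has_mag_grad ::
    "(real ^ 'n \<Rightarrow> real ^ 'n) \<Rightarrow> (real ^ 'n \<Rightarrow> complex) \<Rightarrow> (real ^ 'n \<Rightarrow> complex ^ 'n) \<Rightarrow> bool" where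
  "has_mag_grad a u g \<longleftrightarrow>
     (\<forall>j. loc_integrable (\<lambda>x. of_real (a x $ j) * u x) \<and>
          has_weak_partial j u (\<lambda>x. g x $ j + \<i> * of_real (a x $ j) * u x))"

(* The distributional D_a u, a locally integrable field unique up to null sets. *)
definition mag_grad ::
    "(real ^ 'n \<Rightarrow> real ^ 'n) \<Rightarrow> (real ^ 'n \<Rightarrow> complex) \<Rightarrow> real ^ 'n \<Rightarrow> complex ^ 'n" where
  "mag_grad a u = (SOME g. has_mag_grad a u g)"

definition mag_grad_classical ::
    "(real ^ 'n \<Rightarrow> real ^ 'n) \<Rightarrow> (real ^ 'n \<Rightarrow> complex) \<Rightarrow> real ^ 'n \<Rightarrow> complex ^ 'n" where
  "mag_grad_classical a \<phi> x = (\<chi> j. partial j \<phi> x - \<i> * of_real (a x $ j) * \<phi> x)"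


section \<open>Elliptic coefficients and the energy\<close>

definition sesq :: "complex ^ 'n ^ 'n \<Rightarrow> complex ^ 'n \<Rightarrow> complex ^ 'n \<Rightarrow> complex" where
  "sesq M \<xi> \<eta> = (\<Sum>i\<in>UNIV. \<Sum>j\<in>UNIV. M $ i $ j * \<xi> $ j * cnj (\<eta> $ i))"

definition elliptic :: "real \<Rightarrow> real \<Rightarrow> (real ^ 'n \<Rightarrow> complex ^ 'n ^ 'n) \<Rightarrow> bool" where
  "elliptic lam Lam A \<longleftrightarrow>
     0 < lam \<and> A \<in> borel_measurable lebesgue \<and>
     (AE x in lebesgue. \<forall>\<xi>. lam * (norm \<xi>)\<^sup>2 \<le> Re (sesq (A x) \<xi> \<xi>)) \<and>
     (AE x in lebesgue. norm (A x) \<le> Lam)"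

definition energy ::
    "(real ^ 'n \<Rightarrow> complex ^ 'n ^ 'n) \<Rightarrow> (real ^ 'n \<Rightarrow> real) \<Rightarrow>
     (real ^ 'n \<Rightarrow> complex) \<Rightarrow> (real ^ 'n \<Rightarrow> complex ^ 'n) \<Rightarrow> real" where
  "energy A V u g = (LINT x|lebesgue. Re (sesq (A x) (g x) (g x)) + V x * (cmod (u x))\<^sup>2)"

definition test_norm ::
    "(real ^ 'n \<Rightarrow> complex ^ 'n ^ 'n) \<Rightarrow> (real ^ 'n \<Rightarrow> real ^ 'n) \<Rightarrow> (real ^ 'n \<Rightarrow> real) \<Rightarrow>
     (real ^ 'n \<Rightarrow> complex) \<Rightarrow> real" where
  "test_norm A a V \<phi> = sqrt (energy A V \<phi> (mag_grad_classical a \<phi>))"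

(* The completion of the test functions under test_norm, realised through its continuous embedding
   as a space of functions in L^q, q = 2n/(n-2): the L^q-limits of sequences of test functions that
   are Cauchy in test_norm. *)
definition hom_energy_space ::
    "(real ^ 'n \<Rightarrow> complex ^ 'n ^ 'n) \<Rightarrow> (real ^ 'n \<Rightarrow> real ^ 'n) \<Rightarrow> (real ^ 'n \<Rightarrow> real) \<Rightarrow>
     (real ^ 'n \<Rightarrow> complex) set" where
  "hom_energy_space A a V =
     (let q = 2 * real CARD('n) / (real CARD('n) - 2) in
      {u. u \<in> borel_measurable lebesgue \<and>
          (\<integral>\<^sup>+x. ennreal (cmod (u x) powr q) \<partial>lebesgue) < \<infinity> \<and>
          (\<exists>\<phi> :: nat \<Rightarrow> real ^ 'n \<Rightarrow> complex.
             (\<forall>k. test_fun (\<phi> k)) \<and>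
             (\<forall>e>0. \<exists>N. \<forall>k\<ge>N. \<forall>l\<ge>N. test_norm A a V (\<lambda>x. \<phi> k x - \<phi> l x) < e) \<and>
             (\<lambda>k. \<integral>\<^sup>+x. ennreal (cmod (\<phi> k x - u x) powr q) \<partial>lebesgue) \<longlonglongrightarrow> 0)})"


section \<open>Reverse Hoelder classes and the auxiliary function m\<close>

definition avg :: "(real ^ 'n) set \<Rightarrow> (real ^ 'n \<Rightarrow> real) \<Rightarrow> real" where
  "avg S f = (LINT x:S|lebesgue. f x) / measure lebesgue S"

definition RH_norm :: "real \<Rightarrow> (real ^ 'n \<Rightarrow> real) \<Rightarrow> ennreal" where
  "RH_norm p w = (SUP x. SUP r\<in>{0<..}.
     ennreal ((avg (ball x r) (\<lambda>y. w y powr p)) powr (1 / p) / avg (ball x r) w))"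

definition RH :: "real \<Rightarrow> (real ^ 'n \<Rightarrow> real) set" where
  "RH p = {w. loc_Lp p w \<and> (AE x in lebesgue. 0 < w x) \<and> RH_norm p w < \<infinity>}"

(* Extended-valued: the supremum defining 1/m is taken in [0,\<infinity>]. For weights in RH_{n/2} it is
   positive and finite. *)
definition m_aux :: "(real ^ 'n \<Rightarrow> real) \<Rightarrow> real ^ 'n \<Rightarrow> ennreal" where
  "m_aux w x = inverse (SUP r\<in>{r. 0 < r \<and>
     1 / r ^ (CARD('n) - 2) * (LINT y:ball x r|lebesgue. w y) \<le> 1}. ennreal r)"

end

theory Submission
  imports Defs
begin

text \<open>Write w for the sum of V and the modulus of B. The critical radius \<open>\<rho>\<close> is a
  regularised version of the largest scale r at which the normalised mass \<open>r ^ (2 - n) * w(B(x, r))\<close>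
  is at most one. It is 1-Lipschitz and satisfies \<open>m \<le> 1 / \<rho>\<close>, and since reverse Hoelder weights are doubling, the mass of the
  ball of radius \<open>\<rho> / 4\<close> is at least a constant times \<open>\<rho> ^ (n - 2)\<close> (\<open>exists_critical_radius\<close>). It
  suffices to bound the integral of \<open>|u|\<^sup>2 / \<rho>\<^sup>2\<close>, and by ellipticity the energy may be replaced by
  the integral of \<open>|D u|\<^sup>2 + V |u|\<^sup>2\<close>, where D is the magnetic gradient.

  The core is a scale invariant estimate on the ball of radius 2 R = \<open>\<rho>(x0) / 2\<close> for a test function u:
  there V is bounded by a multiple of \<open>1 / R\<^sup>2\<close>, the gradient of B by a multiple of \<open>1 / R\<^sup>3\<close>, and the mass
  of w is at least a multiple of \<open>R ^ (n - 2)\<close>; the claim is that \<open>1 / R\<^sup>2 |u|\<^sup>2\<close> is controlled in the mean by the energy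
  density. By the diamagnetic inequality the modulus of u satisfies a Poincare inequality with the
  magnetic gradient. So u is controlled on the whole ball as soon as it is controlled against some weight
  h that is bounded by \<open>1 / R\<^sup>2\<close> and has substantial mass (\<open>weighted_poincare\<close>). If V carries a fixed
  fraction of the mass of w, take h = V. Otherwise some entry b of B has a large mean modulus.
  Then a mollification of b is large at some point z, and the bound on the gradient makes b almost
  constant on a ball around z whose radius is a small multiple of R. Since b is the commutator of two
  components of D, integration by parts bounds the integral of \<open>\<phi> b |u|\<^sup>2\<close> for a bump \<open>\<phi>\<close> on that ball
  by first order terms (\<open>magnetic_field_by_parts\<close>), and a multiple of \<open>\<phi>\<close> serves as the weight
  (\<open>local_energy_field\<close>).

  Integrating the local estimates over all centres x0 against \<open>\<rho>(x0) ^ (- n)\<close> gives the global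
  estimate without a covering argument, because \<open>\<rho>\<close> hardly varies on each ball
  (\<open>integrate_local_estimates\<close>). Finally, an element of the energy space is an almost everywhere
  limit of test functions whose magnetic gradients converge in mean square to its distributional
  magnetic gradient, and Fatou's lemma carries the inequality over (\<open>energy_space_inequality\<close>).\<close>

section \<open>Smooth functions and bumps\<close>

lemma cont_diff_SucI:
  assumes "\<And>x. (f has_derivative f' x) (at x)" and "\<And>v. cont_diff k (\<lambda>x. f' x v)"
  shows "cont_diff (Suc k) f"
proof -
  have "frechet_derivative f (at x) = f' x" for x
    using frechet_derivative_at[OF assms(1)] by simp
  then show ?thesis
    using assms by (auto simp: differentiable_def)
qed

lemma cont_diff_derivative:
  assumes "cont_diff (Suc k) f"
  shows "(f has_derivative frechet_derivative f (at x)) (at x)"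
    and "cont_diff k (\<lambda>x. frechet_derivative f (at x) v)"
  using assms by (auto simp: frechet_derivative_works)

lemma cont_diff_SucD: "cont_diff (Suc k) f \<Longrightarrow> cont_diff k f"
proof (induction k arbitrary: f)
  case 0
  then show ?case
    by (auto intro!: continuous_at_imp_continuous_on differentiable_imp_continuous_within)
next
  case (Suc k)
  then show ?case by (auto simp del: cont_diff.simps(1) simp: cont_diff.simps(2))
qed

lemma cont_diff_const: "cont_diff k (\<lambda>x. c)"
proof (induction k arbitrary: c)
  case (Suc k)
  show ?case by (rule cont_diff_SucI[where f' = "\<lambda>x v. 0"]) (use Suc in auto)
qed simp

lemma cont_diff_linear: "bounded_linear f \<Longrightarrow> cont_diff k f"
proof (cases k)
  case 0
  assume "bounded_linear f"
  then show ?thesis using 0 by (simp add: linear_continuous_on)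
next
  case (Suc j)
  assume "bounded_linear f"
  then show ?thesis unfolding Suc
    by (intro cont_diff_SucI[where f' = "\<lambda>x. f"] bounded_linear_imp_has_derivative cont_diff_const)
qed

lemma cont_diff_add: "cont_diff k f \<Longrightarrow> cont_diff k g \<Longrightarrow> cont_diff k (\<lambda>x. f x + g x)"
proof (induction k arbitrary: f g)
  case 0 then show ?case by (simp add: continuous_on_add)
next
  case (Suc k)
  show ?case
    by (rule cont_diff_SucI[where f' = "\<lambda>x v. frechet_derivative f (at x) v + frechet_derivative g (at x) v"])
      (use Suc cont_diff_derivative in \<open>blast intro: has_derivative_add\<close>)+
qed

lemma cont_diff_linear_comp:
  assumes "bounded_linear h" shows "cont_diff k f \<Longrightarrow> cont_diff k (\<lambda>x. h (f x))"
proof (induction k arbitrary: f)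
  case 0 then show ?case using assms by (auto intro: bounded_linear.continuous_on)
next
  case (Suc k)
  show ?case
    by (rule cont_diff_SucI[where f' = "\<lambda>x v. h (frechet_derivative f (at x) v)"])
      (use Suc cont_diff_derivative assms in \<open>blast intro: bounded_linear.has_derivative\<close>)+
qed

lemma cont_diff_bilinear:
  assumes "bounded_bilinear pr"
  shows "cont_diff k f \<Longrightarrow> cont_diff k g \<Longrightarrow> cont_diff k (\<lambda>x. pr (f x) (g x))"
proof (induction k arbitrary: f g)
  case 0 then show ?case using bounded_bilinear.continuous_on[OF assms] by auto
next
  case (Suc k)
  show ?case
  proof (rule cont_diff_SucI[where f' = "\<lambda>x v. pr (f x) (frechet_derivative g (at x) v)
        + pr (frechet_derivative f (at x) v) (g x)"])
    show "((\<lambda>x. pr (f x) (g x)) has_derivative (\<lambda>v. pr (f x) (frechet_derivative g (at x) v)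
        + pr (frechet_derivative f (at x) v) (g x))) (at x)" for x
      by (rule bounded_bilinear.FDERIV[OF assms]) (use Suc.prems cont_diff_derivative(1) in blast)+
    show "cont_diff k (\<lambda>x. pr (f x) (frechet_derivative g (at x) v)
        + pr (frechet_derivative f (at x) v) (g x))" for v
      by (intro cont_diff_add Suc.IH cont_diff_SucD[OF Suc.prems(1)] cont_diff_SucD[OF Suc.prems(2)]
          cont_diff_derivative(2) Suc.prems)
  qed
qed

lemma cont_diff_diff:
  assumes "cont_diff k f" "cont_diff k g" shows "cont_diff k (\<lambda>x. f x - g x)"
  using cont_diff_add[OF assms(1) cont_diff_linear_comp[OF _ assms(2), of uminus]]
  by (simp add: bounded_linear_minus bounded_linear_ident)

text \<open>The functions \<open>t ^ (- j) * exp (- 1 / t)\<close>, extended by zero. The derivative of each is a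
  combination of two later ones, so the whole family is needed to run an induction on the order of
  differentiability, although only the member of index 0 is used as a profile.\<close>

definition flat :: "nat \<Rightarrow> real \<Rightarrow> real" where
  "flat j t = (if 0 < t then (1 / t) ^ j * exp (- (1 / t)) else 0)"

lemma power_times_exp_minus_le:
  fixes s :: real assumes "0 \<le> s" shows "s ^ j * exp (- s) \<le> fact j"
proof -
  have "(\<Sum>n\<in>{j}. s ^ n /\<^sub>R fact n) \<le> (\<Sum>n. s ^ n /\<^sub>R fact n)"
    by (rule sum_le_suminf[OF summable_exp_generic]) (use assms in auto)
  then have "s ^ j / fact j \<le> exp s"
    by (simp add: exp_def divide_inverse mult.commute)
  then show ?thesis by (simp add: exp_minus field_simps)
qed

lemma flat_nonneg: "0 \<le> flat j t"
  by (simp add: flat_def)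

lemma flat_le: "flat j t \<le> fact j"
  using power_times_exp_minus_le[of "1/t" j] by (auto simp: flat_def)

text \<open>The double zero at the origin that makes the difference quotient there tend to zero.\<close>

lemma flat_shift: "flat j t = t\<^sup>2 * flat (j + 2) t"
  by (auto simp: flat_def power_add power_divide power2_eq_square)

lemma flat_has_derivative:
  "(flat j has_real_derivative (flat (j + 2) t - real j * flat (j + 1) t)) (at t)"
proof -
  consider "t < 0" | "t > 0" | "t = 0" by linarith
  then show ?thesis
  proof cases
    case 1
    have "((\<lambda>_. 0) has_real_derivative 0) (at t)" by simp
    then have "(flat j has_real_derivative 0) (at t)"
      by (rule has_field_derivative_transform_within_open[where S = "{..<0}"])
        (use 1 in \<open>auto simp: flat_def\<close>)
    then show ?thesis using 1 by (simp add: flat_def)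
  next
    case 2
    have "((\<lambda>t. (1 / t) ^ j * exp (- (1 / t))) has_real_derivative
        (1 / t) ^ j * (exp (- (1 / t)) * (1 / t\<^sup>2)) - real j * (1 / t) ^ (j + 1) * exp (- (1 / t))) (at t)"
    proof (cases j)
      case 0
      then show ?thesis using 2
        by (auto intro!: derivative_eq_intros simp: power2_eq_square field_simps)
    next
      case (Suc i)
      then show ?thesis using 2
        by (auto intro!: derivative_eq_intros simp: power2_eq_square field_simps) (cases i; simp)
    qed
    then have "(flat j has_real_derivative
        (1 / t) ^ j * (exp (- (1 / t)) * (1 / t\<^sup>2)) - real j * (1 / t) ^ (j + 1) * exp (- (1 / t))) (at t)"
      by (rule has_field_derivative_transform_within_open[where S = "{0<..}"])
        (use 2 in \<open>auto simp: flat_def\<close>)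
    then show ?thesis
      by (rule DERIV_cong) (use 2 in \<open>simp add: flat_def power_add power_divide power2_eq_square\<close>)
  next
    case 3
    define C :: real where "C = fact (j + 2)"
    have "(\<lambda>h. flat j h / h) \<midarrow>0\<rightarrow> 0"
    proof (rule Lim_null_comparison)
      show "\<forall>\<^sub>F h in at 0. norm (flat j h / h) \<le> C * \<bar>h\<bar>"
      proof (rule always_eventually, rule allI)
        fix h :: real
        have "\<bar>flat j h\<bar> = \<bar>h\<bar>\<^sup>2 * flat (j + 2) h"
          using flat_nonneg[of j h] flat_shift[of j h] by simp
        also have "\<dots> \<le> \<bar>h\<bar>\<^sup>2 * C"
          unfolding C_def by (intro mult_left_mono flat_le) auto
        finally show "norm (flat j h / h) \<le> C * \<bar>h\<bar>"
          by (cases "h = 0") (auto simp: field_simps power2_eq_square)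
      qed
      show "((\<lambda>h. C * \<bar>h\<bar>) \<longlongrightarrow> 0) (at (0::real))"
        by (auto intro!: tendsto_eq_intros)
    qed
    then show ?thesis using 3
      unfolding DERIV_def by (simp add: flat_def)
  qed
qed

lemma cont_diff_flat:
  fixes q :: "real ^ 'n \<Rightarrow> real"
  shows "cont_diff k q \<Longrightarrow> cont_diff k (\<lambda>x. flat j (q x))"
proof (induction k arbitrary: j)
  case 0
  have "continuous_on UNIV (flat j)"
    by (intro continuous_at_imp_continuous_on ballI DERIV_isCont[OF flat_has_derivative])
  then show ?case using 0 by (auto intro: continuous_on_compose2)
next
  case (Suc k)
  show ?case
  proof (rule cont_diff_SucI[where f' = "\<lambda>x v. (flat (j + 2) (q x) - real j * flat (j + 1) (q x))
      * frechet_derivative q (at x) v"])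
    show "((\<lambda>x. flat j (q x)) has_derivative (\<lambda>v. (flat (j + 2) (q x) - real j * flat (j + 1) (q x))
      * frechet_derivative q (at x) v)) (at x)" for x
      using has_derivative_compose[OF cont_diff_derivative(1)[OF Suc.prems]
          flat_has_derivative[unfolded has_field_derivative_def]] by simp
    have "cont_diff k (\<lambda>x. flat i (q x))" for i
      using Suc.IH cont_diff_SucD[OF Suc.prems] by blast
    then show "cont_diff k (\<lambda>x. (flat (j + 2) (q x) - real j * flat (j + 1) (q x))
      * frechet_derivative q (at x) v)" for v
      by (intro cont_diff_bilinear[OF bounded_bilinear_mult] cont_diff_diff
          cont_diff_derivative(2)[OF Suc.prems] cont_diff_const)
  qed
qed

definition bump :: "real ^ 'n \<Rightarrow> real \<Rightarrow> real ^ 'n \<Rightarrow> real" where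
  "bump z r x = flat 0 (1 - ((x - z) \<bullet> (x - z)) / r\<^sup>2)"

lemma bump_has_derivative:
  "(bump z r has_derivative
    (\<lambda>v. flat 2 (1 - ((x - z) \<bullet> (x - z)) / r\<^sup>2) * (- 2 * ((x - z) \<bullet> v) / r\<^sup>2))) (at x)"
proof -
  have "((\<lambda>x. 1 - ((x - z) \<bullet> (x - z)) / r\<^sup>2) has_derivative (\<lambda>v. - 2 * ((x - z) \<bullet> v) / r\<^sup>2)) (at x)"
    by (auto intro!: derivative_eq_intros simp: inner_commute divide_inverse)
  from has_derivative_compose[OF this flat_has_derivative[unfolded has_field_derivative_def], of 0]
  show ?thesis unfolding bump_def[abs_def] by (simp add: numeral_2_eq_2)
qed

lemma bump_nonneg: "0 \<le> bump z r x" and bump_le_1: "bump z r x \<le> 1"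
  using flat_nonneg flat_le[of 0] by (auto simp: bump_def)

lemma bump_eq_0: "0 < r \<Longrightarrow> r \<le> dist z x \<Longrightarrow> bump z r x = 0"
proof -
  assume r: "0 < r" "r \<le> dist z x"
  have "r\<^sup>2 \<le> (norm (x - z))\<^sup>2"
    using r by (intro power_mono) (auto simp: dist_norm norm_minus_commute)
  then show ?thesis using r by (auto simp: bump_def flat_def power2_norm_eq_inner)
qed

text \<open>The constant is the value of the profile \<open>exp (- 1 / t)\<close> at \<open>t = 1 - (1 / 2)\<^sup>2\<close>.\<close>

lemma bump_lower: "0 < r \<Longrightarrow> dist z x < r / 2 \<Longrightarrow> exp (- (4 / 3)) \<le> bump z r x"
proof -
  assume r: "0 < r" "dist z x < r / 2"
  have "(norm (x - z))\<^sup>2 \<le> (r / 2)\<^sup>2"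
    using r by (intro power_mono) (auto simp: dist_norm norm_minus_commute)
  then have "3 / 4 \<le> 1 - ((x - z) \<bullet> (x - z)) / r\<^sup>2"
    using r by (simp add: power2_norm_eq_inner[symmetric] field_simps)
  then show ?thesis by (auto simp: bump_def flat_def field_simps)
qed

lemma test_fun_bump:
  fixes z :: "real ^ 'n" assumes "0 < r" shows "test_fun (bump z r)"
proof -
  have "cont_diff k (\<lambda>x::real^'n. x - z)" for k
    by (intro cont_diff_diff cont_diff_const cont_diff_linear bounded_linear_ident)
  then have "cont_diff k (\<lambda>x. 1 - ((x - z) \<bullet> (x - z)) / r\<^sup>2)" for k
    unfolding divide_inverse
    by (intro cont_diff_diff cont_diff_const cont_diff_bilinear[OF bounded_bilinear_mult]
        cont_diff_bilinear[OF bounded_bilinear_inner] cont_diff_linear[OF bounded_linear_ident])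
  then have "cont_diff k (bump z r)" for k
    unfolding bump_def[abs_def] by (rule cont_diff_flat)
  moreover have "{x. bump z r x \<noteq> 0} \<subseteq> cball z r"
    using bump_eq_0[OF assms] by (force simp: not_less less_imp_le)
  then have "compact (closure {x. bump z r x \<noteq> 0})"
    by (meson bounded_cball bounded_subset compact_closure)
  ultimately show ?thesis by (simp add: test_fun_def)
qed

lemma bump_shift: "bump (z + v) r x = bump z r (x - v)"
  by (simp add: bump_def algebra_simps)

lemma bump_swap: "bump z r x = bump x r z"
  by (simp add: bump_def inner_diff inner_commute algebra_simps)

lemma norm_bump_partial_le:
  assumes "0 < r" shows "\<bar>partial j (bump z r) x\<bar> \<le> 4 / r"
proof -
  have eq: "partial j (bump z r) x
      = flat 2 (1 - ((x - z) \<bullet> (x - z)) / r\<^sup>2) * (- 2 * ((x - z) $ j) / r\<^sup>2)"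
    unfolding partial_def frechet_derivative_at[OF bump_has_derivative, symmetric]
    by (simp add: inner_axis)
  show ?thesis
  proof (cases "dist z x < r")
    case True
    have "\<bar>partial j (bump z r) x\<bar> \<le> 2 * (2 * r / r\<^sup>2)"
      unfolding eq abs_mult
    proof (intro mult_mono)
      show "\<bar>flat 2 (1 - ((x - z) \<bullet> (x - z)) / r\<^sup>2)\<bar> \<le> 2"
        using flat_nonneg[of 2] flat_le[of 2] by (simp add: numeral_2_eq_2)
      have "\<bar>(x - z) $ j\<bar> \<le> r"
        using True component_le_norm_cart[of "x - z" j] by (simp add: dist_norm norm_minus_commute)
      then show "\<bar>- 2 * ((x - z) $ j) / r\<^sup>2\<bar> \<le> 2 * r / r\<^sup>2"
        by (simp add: abs_mult divide_right_mono)
    qed auto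
    then show ?thesis using assms by (simp add: power2_eq_square field_simps)
  next
    case False
    then have "r\<^sup>2 \<le> (x - z) \<bullet> (x - z)"
      using assms unfolding power2_norm_eq_inner[symmetric]
      by (intro power_mono) (auto simp: dist_norm norm_minus_commute)
    then show ?thesis using assms by (simp add: eq flat_def)
  qed
qed

section \<open>Integration against test functions\<close>

lemma sigma_finite_lebesgue: "sigma_finite_measure (lebesgue :: 'a::euclidean_space measure)"
proof
  from lborel.sigma_finite_countable obtain A :: "'a set set" where
    "countable A" "A \<subseteq> sets lborel" "\<Union>A = UNIV" "\<forall>a\<in>A. emeasure lborel a \<noteq> \<infinity>"
    by (auto simp del: sets_lborel)
  then show "\<exists>A. countable A \<and> A \<subseteq> sets lebesgue \<and> \<Union>A = space lebesgue \<and>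
      (\<forall>a\<in>A. emeasure (lebesgue :: 'a measure) a \<noteq> \<infinity>)"
    by (intro exI[of _ A]) auto
qed

interpretation leb: sigma_finite_measure "lebesgue :: 'a::euclidean_space measure"
  by (rule sigma_finite_lebesgue)

interpretation leb_pair: pair_sigma_finite "lebesgue :: 'a::euclidean_space measure"
  "lebesgue :: 'b::euclidean_space measure" ..

text \<open>Tonelli's theorem is applied to products of completed measures, whose product sigma-algebra
  still contains the Borel sets.\<close>

lemma measurable_lebesgue_pair:
  fixes f :: "'a::euclidean_space \<times> 'b::euclidean_space \<Rightarrow> 'c"
  assumes "f \<in> borel \<rightarrow>\<^sub>M N"
  shows "f \<in> lebesgue \<Otimes>\<^sub>M lebesgue \<rightarrow>\<^sub>M N"
proof -
  have "(\<lambda>p. (fst p, snd p)) \<in> (lebesgue :: 'a measure) \<Otimes>\<^sub>M (lebesgue :: 'b measure) \<rightarrow>\<^sub>M borel \<Otimes>\<^sub>M borel"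
    by (intro measurable_Pair measurable_compose[OF measurable_fst]
        measurable_compose[OF measurable_snd] measurable_completion) auto
  then have "(\<lambda>p. p) \<in> (lebesgue :: 'a measure) \<Otimes>\<^sub>M (lebesgue :: 'b measure) \<rightarrow>\<^sub>M borel"
    by (simp add: borel_prod)
  from measurable_compose[OF this assms] show ?thesis by simp
qed

lemma continuous_imp_lebesgue_measurable:
  fixes f :: "'a::euclidean_space \<Rightarrow> 'b::euclidean_space"
  shows "continuous_on UNIV f \<Longrightarrow> f \<in> borel_measurable lebesgue"
  by (intro measurable_completion) (simp add: borel_measurable_continuous_onI)

lemma bounded_of_compact_support:
  fixes F :: "'a::euclidean_space \<Rightarrow> 'b::real_normed_vector"
  assumes "continuous_on UNIV F" and "\<And>x. x \<notin> cball z R \<Longrightarrow> F x = 0"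
  obtains M where "0 < M" "\<And>x. norm (F x) \<le> M"
proof -
  have "compact (F ` cball z R)"
    by (intro compact_continuous_image compact_cball continuous_on_subset[OF assms(1)]) auto
  then obtain M where M: "\<And>y. y \<in> F ` cball z R \<Longrightarrow> norm y \<le> M"
    using compact_imp_bounded bounded_iff by metis
  have "norm (F x) \<le> \<bar>M\<bar> + 1" for x
    using M[of "F x"] assms(2)[of x] by (cases "x \<in> cball z R") force+
  then show thesis by (intro that[of "\<bar>M\<bar> + 1"]) auto
qed

lemma loc_integrable_measurable: "loc_integrable h \<Longrightarrow> h \<in> borel_measurable lebesgue"
  by (simp add: loc_integrable_def)

lemma loc_integrable_cball:
  "loc_integrable h \<Longrightarrow> integrable lebesgue (\<lambda>x. indicator (cball z R) x *\<^sub>R h x)"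
  using compact_cball by (auto simp: loc_integrable_def set_integrable_def)

lemma loc_integrableI:
  fixes h :: "real^'n \<Rightarrow> 'b::{banach, second_countable_topology}"
  assumes "h \<in> borel_measurable lebesgue"
    and "\<And>R. integrable lebesgue (\<lambda>x. indicator (cball 0 R) x *\<^sub>R h x)"
  shows "loc_integrable h"
  unfolding loc_integrable_def
proof (intro conjI allI impI assms(1))
  fix K :: "(real^'n) set" assume "compact K"
  then obtain R where R: "K \<subseteq> cball 0 R"
    using compact_imp_bounded[OF \<open>compact K\<close>] by (auto simp: bounded_iff subset_iff)
  have K: "K \<in> sets lebesgue" using \<open>compact K\<close> by (simp add: lmeasurable_compact fmeasurableD)
  show "set_integrable lebesgue K h"
    unfolding set_integrable_def
  proof (rule Bochner_Integration.integrable_bound[OF assms(2)[of R]])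
    show "(\<lambda>x. indicat_real K x *\<^sub>R h x) \<in> borel_measurable lebesgue"
      using K assms(1) by (intro borel_measurable_scaleR borel_measurable_indicator)
    show "AE x in lebesgue. norm (indicat_real K x *\<^sub>R h x) \<le> norm (indicat_real (cball 0 R) x *\<^sub>R h x)"
      by (intro AE_I2) (use R in \<open>auto simp: indicator_def\<close>)
  qed
qed

lemma integrable_compact_support_mult:
  fixes h :: "real^'n \<Rightarrow> 'b::{banach, second_countable_topology}"
  assumes h: "loc_integrable h" and F: "continuous_on UNIV F"
    and "\<And>x. x \<notin> cball z R \<Longrightarrow> F x = 0"
  shows "integrable lebesgue (\<lambda>x. F x *\<^sub>R h x)"
proof -
  obtain M where M: "0 < M" "\<And>x. norm (F x) \<le> M"
    using bounded_of_compact_support[OF assms(2,3)] by blast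
  show ?thesis
  proof (rule Bochner_Integration.integrable_bound)
    show "integrable lebesgue (\<lambda>x. M *\<^sub>R (indicator (cball z R) x *\<^sub>R h x))"
      by (intro integrable_scaleR_right loc_integrable_cball h)
    show "(\<lambda>x. F x *\<^sub>R h x) \<in> borel_measurable lebesgue"
      by (intro borel_measurable_scaleR loc_integrable_measurable h continuous_imp_lebesgue_measurable F)
    show "AE x in lebesgue. norm (F x *\<^sub>R h x) \<le> norm (M *\<^sub>R (indicator (cball z R) x *\<^sub>R h x))"
      using M assms(3) by (intro AE_I2) (auto simp: indicator_def intro!: mult_right_mono)
  qed
qed

lemma loc_integrable_continuous:
  fixes f :: "real^'n \<Rightarrow> 'b::euclidean_space"
  assumes "continuous_on UNIV f" shows "loc_integrable f"
proof (rule loc_integrableI)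
  show "f \<in> borel_measurable lebesgue" by (rule continuous_imp_lebesgue_measurable[OF assms])
  fix R
  have "integrable lborel (\<lambda>x. indicator (cball 0 R) x *\<^sub>R f x)"
    by (rule borel_integrable_compact[OF compact_cball continuous_on_subset[OF assms]]) simp
  then show "integrable lebesgue (\<lambda>x. indicator (cball 0 R) x *\<^sub>R f x)"
    by (subst integrable_completion) auto
qed

lemma integrable_compact_support:
  fixes F :: "real^'n \<Rightarrow> real"
  assumes "continuous_on UNIV F" and "\<And>x. x \<notin> cball z R \<Longrightarrow> F x = 0"
  shows "integrable lebesgue F"
  using integrable_compact_support_mult[OF loc_integrable_continuous[of "\<lambda>_. 1::real"] assms] by simp

lemma lebesgue_integral_translation:
  fixes F :: "real^'n \<Rightarrow> real"
  assumes "continuous_on UNIV F"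
  shows "(LINT x|lebesgue. F (x - v)) = (LINT x|lebesgue. F x)"
proof -
  have [measurable]: "F \<in> borel_measurable borel" using assms by (simp add: borel_measurable_continuous_onI)
  have "(LINT x|lebesgue. F x) = (LINT x|lborel. F x)"
    by (simp add: integral_completion)
  also have "\<dots> = (LINT x|distr lborel borel ((+) (- v)). F x)"
    by (simp only: lborel_distr_plus)
  also have "\<dots> = (LINT x|lborel. F (x - v))"
    by (subst integral_distr) auto
  finally show ?thesis by (simp add: integral_completion)
qed

lemma derivative_outside_support:
  assumes "(F has_derivative F' x) (at x)" and "\<And>x. x \<notin> cball z R \<Longrightarrow> F x = 0" and "x \<notin> cball z R"
  shows "F' x v = 0"
proof -
  have "((\<lambda>_. 0) has_derivative (\<lambda>_. 0)) (at x)" by simp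
  then have "(F has_derivative (\<lambda>_. 0)) (at x)"
    by (rule has_derivative_transform_within_open[OF _ open_Compl[OF closed_cball[of z R]]])
      (use assms in auto)
  then show ?thesis using has_derivative_unique[OF assms(1)] by metis
qed

text \<open>Differentiation of the translation action: this one statement supplies both integration by
  parts and the differentiation of bump averages with respect to their centre.\<close>

lemma translation_has_derivative:
  fixes F :: "real^'n \<Rightarrow> real" and h :: "real^'n \<Rightarrow> real"
  assumes F: "\<And>x. (F has_derivative F' x) (at x)" and F'c: "continuous_on UNIV (\<lambda>x. F' x v)"
    and supp: "\<And>x. x \<notin> cball 0 R \<Longrightarrow> F x = 0" and h: "loc_integrable h"
  shows "((\<lambda>t. LINT x|lebesgue. F (x - t *\<^sub>R v) * h x) has_real_derivative
      - (LINT x|lebesgue. F' (x - s *\<^sub>R v) v * h x)) (at s)"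
proof -
  have Fc: "continuous_on UNIV F"
    by (intro continuous_at_imp_continuous_on ballI has_derivative_continuous[OF F])
  have F'supp: "F' x v = 0" if "x \<notin> cball 0 R" for x
    by (rule derivative_outside_support[of F F' x 0 R]) (use F supp that in auto)
  obtain M where M: "0 < M" "\<And>x. norm (F' x v) \<le> M"
    using bounded_of_compact_support[OF F'c F'supp] by blast
  have der: "((\<lambda>t. F (x - t *\<^sub>R v)) has_real_derivative - F' (x - t *\<^sub>R v) v) (at t)" for x t
  proof -
    interpret L: bounded_linear "F' (x - t *\<^sub>R v)" using F has_derivative_bounded_linear by blast
    have "((\<lambda>t. x - t *\<^sub>R v) has_derivative (\<lambda>k. - (k *\<^sub>R v))) (at t)"
      by (auto intro!: derivative_eq_intros)
    from has_derivative_compose[OF this F] show ?thesis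
      unfolding has_field_derivative_def
      by (rule has_derivative_eq_rhs) (simp add: fun_eq_iff L.neg L.scaleR)
  qed
  have lip: "\<bar>F (x - t *\<^sub>R v) - F (x - t' *\<^sub>R v)\<bar> \<le> M * \<bar>t - t'\<bar>" for x t t'
    using field_differentiable_bound[of UNIV "\<lambda>t. F (x - t *\<^sub>R v)" "\<lambda>t. - F' (x - t *\<^sub>R v) v" M t t']
      der M by simp
  define S where "S = R + (\<bar>s\<bar> + 1) * norm v"
  have supp': "F (x - t *\<^sub>R v) = 0" if "x \<notin> cball 0 S" "\<bar>t\<bar> \<le> \<bar>s\<bar> + 1" for x t
  proof (rule supp)
    have "norm x \<le> norm (x - t *\<^sub>R v) + norm (t *\<^sub>R v)"
      using norm_triangle_ineq[of "x - t *\<^sub>R v" "t *\<^sub>R v"] by simp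
    moreover have "norm (t *\<^sub>R v) \<le> (\<bar>s\<bar> + 1) * norm v" using that by (auto intro: mult_right_mono)
    ultimately show "x - t *\<^sub>R v \<notin> cball 0 R" using that by (auto simp: S_def)
  qed
  have shiftc: "continuous_on UNIV (\<lambda>x. F (x - t *\<^sub>R v))" for t
    by (intro continuous_on_compose2[OF Fc]) (auto intro!: continuous_intros)
  have int: "integrable lebesgue (\<lambda>x. F (x - t *\<^sub>R v) * h x)" if "\<bar>t\<bar> \<le> \<bar>s\<bar> + 1" for t
    using integrable_compact_support_mult[where F = "\<lambda>x. F (x - t *\<^sub>R v)" and z = 0 and R = S, OF h shiftc]
      supp' that by auto
  show ?thesis
    unfolding DERIV_def tendsto_at_iff_sequentially comp_def
  proof (intro allI impI)
    fix X :: "nat \<Rightarrow> real"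
    assume X0: "\<forall>i. X i \<in> UNIV - {0}" and X: "X \<longlonglongrightarrow> 0"
    obtain N where N: "\<And>n. N \<le> n \<Longrightarrow> \<bar>X n\<bar> \<le> 1"
      using X[THEN LIMSEQ_D, of 1] by (auto intro: less_imp_le)
    define Y where "Y n = X (n + N)" for n
    have Y: "Y \<longlonglongrightarrow> 0" "Y n \<noteq> 0" "\<bar>Y n\<bar> \<le> 1" for n
      using X0 N LIMSEQ_ignore_initial_segment[OF X, of N] by (auto simp: Y_def[abs_def])
    define q where "q n x = (F (x - (s + Y n) *\<^sub>R v) - F (x - s *\<^sub>R v)) / Y n * h x" for n x
    have Ys: "\<bar>s + Y n\<bar> \<le> \<bar>s\<bar> + 1" "\<bar>s\<bar> \<le> \<bar>s\<bar> + 1" for n using Y(3)[of n] by auto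
    have "(\<lambda>n. LINT x|lebesgue. q n x) \<longlonglongrightarrow> (LINT x|lebesgue. - F' (x - s *\<^sub>R v) v * h x)"
    proof (rule integral_dominated_convergence[where w = "\<lambda>x. M * (indicator (cball 0 S) x *\<^sub>R \<bar>h x\<bar>)"])
      show "(\<lambda>x. - F' (x - s *\<^sub>R v) v * h x) \<in> borel_measurable lebesgue"
        by (intro borel_measurable_times loc_integrable_measurable h continuous_imp_lebesgue_measurable
            continuous_on_minus continuous_on_compose2[OF F'c]) (auto intro!: continuous_intros)
      show "q n \<in> borel_measurable lebesgue" for n
        unfolding q_def divide_inverse
        by (intro borel_measurable_times loc_integrable_measurable h continuous_imp_lebesgue_measurable
            continuous_on_mult continuous_on_diff shiftc continuous_on_const)
      show "integrable lebesgue (\<lambda>x. M * (indicator (cball 0 S) x *\<^sub>R \<bar>h x\<bar>))"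
        using integrable_abs[OF loc_integrable_cball[OF h, of 0 S]]
        by (intro integrable_mult_right) (simp add: abs_mult)
      show "AE x in lebesgue. (\<lambda>n. q n x) \<longlonglongrightarrow> - F' (x - s *\<^sub>R v) v * h x"
      proof (intro AE_I2)
        fix x
        have "(\<lambda>n. (F (x - (s + Y n) *\<^sub>R v) - F (x - s *\<^sub>R v)) / Y n) \<longlonglongrightarrow> - F' (x - s *\<^sub>R v) v"
          using der[of x s] Y unfolding DERIV_def tendsto_at_iff_sequentially comp_def by auto
        then show "(\<lambda>n. q n x) \<longlonglongrightarrow> - F' (x - s *\<^sub>R v) v * h x"
          unfolding q_def by (intro tendsto_mult tendsto_const)
      qed
      show "AE x in lebesgue. norm (q n x) \<le> M * (indicator (cball 0 S) x *\<^sub>R \<bar>h x\<bar>)" for n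
      proof (intro AE_I2)
        fix x
        show "norm (q n x) \<le> M * (indicator (cball 0 S) x *\<^sub>R \<bar>h x\<bar>)"
        proof (cases "x \<in> cball 0 S")
          case True
          have "\<bar>(F (x - (s + Y n) *\<^sub>R v) - F (x - s *\<^sub>R v)) / Y n\<bar> \<le> M"
            using lip[of x "s + Y n" s] Y(2)[of n] by (simp add: field_simps)
          from mult_right_mono[OF this abs_ge_zero[of "h x"]] show ?thesis
            using True by (simp add: q_def abs_mult)
        next
          case False
          then show ?thesis using supp'[OF False Ys(1)] supp'[OF False Ys(2)]
            by (simp add: q_def)
        qed
      qed
    qed
    moreover have "(LINT x|lebesgue. q n x) = ((LINT x|lebesgue. F (x - (s + Y n) *\<^sub>R v) * h x)
        - (LINT x|lebesgue. F (x - s *\<^sub>R v) * h x)) / Y n" for n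
    proof -
      have "(LINT x|lebesgue. q n x)
          = (LINT x|lebesgue. (F (x - (s + Y n) *\<^sub>R v) * h x - F (x - s *\<^sub>R v) * h x) / Y n)"
        by (intro Bochner_Integration.integral_cong refl) (simp add: q_def left_diff_distrib)
      also have "\<dots> = (LINT x|lebesgue. F (x - (s + Y n) *\<^sub>R v) * h x - F (x - s *\<^sub>R v) * h x) / Y n"
        by simp
      also have "\<dots> = ((LINT x|lebesgue. F (x - (s + Y n) *\<^sub>R v) * h x)
          - (LINT x|lebesgue. F (x - s *\<^sub>R v) * h x)) / Y n"
        by (subst Bochner_Integration.integral_diff[OF int int]) (use Ys in auto)
      finally show ?thesis .
    qed
    ultimately have "(\<lambda>n. ((LINT x|lebesgue. F (x - (s + X (n + N)) *\<^sub>R v) * h x)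
        - (LINT x|lebesgue. F (x - s *\<^sub>R v) * h x)) / X (n + N))
        \<longlonglongrightarrow> - (LINT x|lebesgue. F' (x - s *\<^sub>R v) v * h x)"
      by (simp add: Y_def)
    from LIMSEQ_offset[OF this]
    show "(\<lambda>n. ((LINT x|lebesgue. F (x - (s + X n) *\<^sub>R v) * h x)
        - (LINT x|lebesgue. F (x - s *\<^sub>R v) * h x)) / X n)
        \<longlonglongrightarrow> - (LINT x|lebesgue. F' (x - s *\<^sub>R v) v * h x)" .
  qed
qed

text \<open>The integral of a translate does not depend on the translation; its derivative is the integral
  of the directional derivative.\<close>

lemma integral_derivative_eq_0:
  fixes F :: "real^'n \<Rightarrow> real"
  assumes F: "\<And>x. (F has_derivative F' x) (at x)" and F'c: "continuous_on UNIV (\<lambda>x. F' x v)"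
    and supp: "\<And>x. x \<notin> cball 0 R \<Longrightarrow> F x = 0"
  shows "(LINT x|lebesgue. F' x v) = 0"
proof -
  have Fc: "continuous_on UNIV F"
    by (intro continuous_at_imp_continuous_on ballI has_derivative_continuous[OF F])
  have "((\<lambda>t. LINT x|lebesgue. F (x - t *\<^sub>R v) * 1) has_real_derivative
      - (LINT x|lebesgue. F' (x - 0 *\<^sub>R v) v * 1)) (at 0)"
    by (rule translation_has_derivative[OF F F'c supp]) (auto intro: loc_integrable_continuous)
  then have "((\<lambda>t. LINT x|lebesgue. F x) has_real_derivative - (LINT x|lebesgue. F' x v)) (at 0)"
    using lebesgue_integral_translation[OF Fc] by simp
  then show ?thesis using DERIV_unique[OF _ DERIV_const] by fastforce
qed

lemma test_fun_derivative:
  assumes "test_fun f"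
  shows "(f has_derivative frechet_derivative f (at x)) (at x)"
    and "continuous_on UNIV (\<lambda>x. frechet_derivative f (at x) v)"
    and "continuous_on UNIV f"
    and "cont_diff k (\<lambda>x. frechet_derivative f (at x) v)"
proof -
  have *: "cont_diff k f" for k using assms by (simp add: test_fun_def)
  show "(f has_derivative frechet_derivative f (at x)) (at x)"
    by (rule cont_diff_derivative(1)[OF *])
  show "cont_diff k (\<lambda>x. frechet_derivative f (at x) v)" for k
    by (rule cont_diff_derivative(2)[OF *])
  from this[of 0] *[of 0] show "continuous_on UNIV (\<lambda>x. frechet_derivative f (at x) v)"
    "continuous_on UNIV f" by auto
qed

lemma test_fun_support:
  assumes "test_fun f" obtains R where "0 < R" "\<And>x. x \<notin> cball 0 R \<Longrightarrow> f x = 0"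
proof -
  have "bounded (closure {x. f x \<noteq> 0})" using assms by (simp add: test_fun_def compact_imp_bounded)
  then obtain R where "0 < R" "\<forall>x\<in>closure {x. f x \<noteq> 0}. norm x \<le> R"
    using bounded_pos by blast
  then show thesis using closure_subset[of "{x. f x \<noteq> 0}"] by (intro that[of R]) force+
qed

lemma derivative_eq_sum_partial:
  fixes f :: "real^'n \<Rightarrow> 'b::real_normed_vector"
  assumes "(f has_derivative f') (at x)"
  shows "f' v = (\<Sum>l\<in>UNIV. (v $ l) *\<^sub>R partial l f x)"
proof -
  interpret bounded_linear f' using assms by (rule has_derivative_bounded_linear)
  have "f' v = f' (\<Sum>l\<in>UNIV. (v $ l) *\<^sub>R axis l 1)"
    using basis_expansion[of v] by (simp add: scalar_mult_eq_scaleR)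
  then show ?thesis
    unfolding partial_def frechet_derivative_at[OF assms, symmetric] by (simp add: sum scaleR)
qed

section \<open>Mollification by bumps\<close>

lemma continuous_bump: "continuous_on UNIV (bump z r)"
  by (intro continuous_at_imp_continuous_on ballI has_derivative_continuous[OF bump_has_derivative])

text \<open>By translation invariance the mass depends on the radius and the dimension only; the type
  argument carries the dimension.\<close>

definition bump_mass :: "'n::finite itself \<Rightarrow> real \<Rightarrow> real" where
  "bump_mass _ e = (LINT x|lebesgue. bump (0 :: real^'n) e x)"

lemma integrable_bump: "0 < e \<Longrightarrow> integrable lebesgue (bump z e)"
  by (rule integrable_compact_support[OF continuous_bump, of z e]) (simp add: bump_eq_0)

lemma integral_bump: "0 < e \<Longrightarrow> (LINT x|lebesgue. bump (z :: real^'n) e x) = bump_mass TYPE('n) e"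
  using lebesgue_integral_translation[OF continuous_bump, of "0::real^'n" e z] bump_shift[of "0::real^'n" z e]
  by (simp add: bump_mass_def)

lemma bump_mass_pos:
  assumes "0 < e" shows "0 < bump_mass TYPE('n::finite) e"
proof -
  have "0 < exp (- (4 / 3)) * measure lebesgue (ball (0::real^'n) (e / 2))"
    using assms by (simp add: content_ball_pos)
  also have "\<dots> = (LINT x|lebesgue. indicator (ball (0::real^'n) (e / 2)) x * exp (- (4 / 3)))"
    by simp
  also have "\<dots> \<le> bump_mass TYPE('n) e"
  proof -
    have "integrable lebesgue (\<lambda>x. indicator (ball (0::real^'n) (e / 2)) x * exp (- (4 / 3)) :: real)"
      using lmeasurable_ball lmeasurable_iff_integrable by (intro integrable_mult_left) blast
    then show ?thesis
      unfolding bump_mass_def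
      by (intro integral_mono integrable_bump assms)
        (auto simp: indicator_def bump_nonneg bump_lower assms)
  qed
  finally show ?thesis .
qed

definition mollify :: "real \<Rightarrow> (real^'n \<Rightarrow> real) \<Rightarrow> real^'n \<Rightarrow> real" where
  "mollify e b z = (LINT x|lebesgue. bump z e x * b x) / bump_mass TYPE('n) e"

text \<open>Moving the centre of the bump differentiates the bump; the weak derivative moves onto b and leaves
  an average of the weak gradient g over a ball centred on the segment from z to z', which stays
  in the region where g is bounded.\<close>

lemma mollify_lipschitz:
  fixes b :: "real^'n \<Rightarrow> real" and g :: "real^'n \<Rightarrow> real^'n"
  assumes weak: "\<And>l. has_weak_partial l b (\<lambda>x. g x $ l)"
    and L: "AE x in lebesgue. x \<in> ball x0 \<rho> \<longrightarrow> norm (g x) \<le> L"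
    and e: "0 < e" "s + e \<le> \<rho>" and z: "z \<in> ball x0 s" "z' \<in> ball x0 s"
  shows "\<bar>mollify e b z' - mollify e b z\<bar> \<le> L * dist z z'"
proof -
  have b: "loc_integrable b" and g: "loc_integrable (\<lambda>x. g x $ l)" for l
    using weak by (auto simp: has_weak_partial_def)
  define v where "v = z' - z"
  define F where "F t = (LINT x|lebesgue. bump z e (x - t *\<^sub>R v) * b x)" for t
  define F' where "F' t = (LINT x|lebesgue. bump (z + t *\<^sub>R v) e x * (v \<bullet> g x))" for t
  define R where "R = norm z + e"
  have "x \<notin> cball z e" if "x \<notin> cball 0 R" for x
    using that norm_triangle_ineq[of z "x - z"] by (auto simp: R_def dist_norm norm_minus_commute)
  then have supp: "bump z e x = 0" if "x \<notin> cball 0 R" for x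
    using that bump_eq_0[OF e(1), of z x] by force
  have int: "integrable lebesgue (\<lambda>x. bump y e x * g x $ l)" for y l
  proof -
    have "bump y e x = 0" if "x \<notin> cball y e" for x
      using that by (intro bump_eq_0[OF e(1)]) auto
    from integrable_compact_support_mult[OF g continuous_bump this] show ?thesis by simp
  qed
  have int': "integrable lebesgue (\<lambda>x. partial l (bump y e) x * b x)" for y l
  proof -
    have "continuous_on UNIV (partial l (bump y e))"
      unfolding partial_def by (rule test_fun_derivative[OF test_fun_bump[OF e(1)]])
    moreover have "partial l (bump y e) x = 0" if "x \<notin> cball y e" for x
      unfolding partial_def
      by (rule derivative_outside_support[where z = y and R = e,
            OF test_fun_derivative(1)[OF test_fun_bump[OF e(1)]]])
        (use that in \<open>auto simp: bump_eq_0[OF e(1)]\<close>)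
    ultimately show ?thesis using integrable_compact_support_mult[OF b] by fastforce
  qed
  have der: "(F has_real_derivative F' s) (at s)" for s
  proof -
    let ?D = "\<lambda>x. flat 2 (1 - ((x - z) \<bullet> (x - z)) / e\<^sup>2)"
    have "(F has_real_derivative
      - (LINT x|lebesgue. frechet_derivative (bump z e) (at (x - s *\<^sub>R v)) v * b x)) (at s)"
      unfolding F_def
      by (rule translation_has_derivative[OF _ _ supp b])
        (auto intro: test_fun_derivative test_fun_bump e)
    moreover have "frechet_derivative (bump z e) (at (x - s *\<^sub>R v)) v
        = (\<Sum>l\<in>UNIV. v $ l * partial l (bump (z + s *\<^sub>R v) e) x)" for x
    proof -
      have "frechet_derivative (bump (z + s *\<^sub>R v) e) (at x) = frechet_derivative (bump z e) (at (x - s *\<^sub>R v))"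
        unfolding frechet_derivative_at[OF bump_has_derivative, symmetric] by (simp add: algebra_simps)
      then show ?thesis
        using derivative_eq_sum_partial[OF test_fun_derivative(1)[OF test_fun_bump[OF e(1)]], of "z + s *\<^sub>R v" x v]
        by simp
    qed
    moreover have "- (LINT x|lebesgue. (\<Sum>l\<in>UNIV. v $ l * partial l (bump (z + s *\<^sub>R v) e) x) * b x) = F' s"
    proof -
      have "- (LINT x|lebesgue. (\<Sum>l\<in>UNIV. v $ l * partial l (bump (z + s *\<^sub>R v) e) x) * b x)
         = (\<Sum>l\<in>UNIV. v $ l * - (LINT x|lebesgue. partial l (bump (z + s *\<^sub>R v) e) x * b x))"
        by (simp add: sum_distrib_right mult.assoc int' sum_negf)
      also have "\<dots> = (\<Sum>l\<in>UNIV. v $ l * (LINT x|lebesgue. bump (z + s *\<^sub>R v) e x * g x $ l))"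
      proof -
        have "(LINT x|lebesgue. bump (z + s *\<^sub>R v) e x * g x $ l)
            = - (LINT x|lebesgue. partial l (bump (z + s *\<^sub>R v) e) x * b x)" for l
          using weak[of l] test_fun_bump[OF e(1)] by (auto simp: has_weak_partial_def)
        then show ?thesis by simp
      qed
      also have "\<dots> = F' s"
        by (simp add: F'_def inner_vec_def sum_distrib_left int mult.left_commute)
      finally show ?thesis .
    qed
    ultimately show ?thesis by simp
  qed
  have bound: "\<bar>F' t\<bar> \<le> L * norm v * bump_mass TYPE('n) e" if t: "t \<in> {0..1}" for t
  proof -
    let ?y = "z + t *\<^sub>R v"
    have "?y = (1 - t) *\<^sub>R z + t *\<^sub>R z'" by (simp add: v_def algebra_simps)
    then have y: "?y \<in> ball x0 s"
      using convexD_alt[OF convex_ball z, of t] t by simp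
    have "\<bar>F' t\<bar> \<le> (LINT x|lebesgue. bump ?y e x * (L * norm v))"
    proof -
      have "AE x in lebesgue. \<bar>bump ?y e x * (v \<bullet> g x)\<bar> \<le> bump ?y e x * (L * norm v)"
        using L
      proof eventually_elim
        case (elim x)
        show ?case
        proof (cases "dist ?y x < e")
          case True
          then have "x \<in> ball x0 \<rho>" using y e dist_triangle[of x0 x ?y] by auto
          then have "norm (g x) \<le> L" using elim by blast
          then have "\<bar>v \<bullet> g x\<bar> \<le> L * norm v"
            using Cauchy_Schwarz_ineq2[of v "g x"] mult_left_mono[of "norm (g x)" L "norm v"]
            by (simp add: mult.commute)
          from mult_left_mono[OF this bump_nonneg[of ?y e x]] show ?thesis
            by (simp add: abs_mult bump_nonneg)
        qed (simp add: bump_eq_0[OF e(1)])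
      qed
      then show ?thesis
        unfolding F'_def
        by (intro integral_abs_bound[THEN order_trans] integral_mono_AE integrable_abs integrable_mult_left integrable_bump e)
          (auto simp: inner_vec_def sum_distrib_left mult.left_commute intro!: int)
    qed
    also have "\<dots> = L * norm v * bump_mass TYPE('n) e" by (simp add: integral_bump[OF e(1)])
    finally show ?thesis .
  qed
  have "\<bar>F 1 - F 0\<bar> \<le> L * norm v * bump_mass TYPE('n) e * norm (1 - 0 :: real)"
    using field_differentiable_bound[of "{0..1::real}" F F' "L * norm v * bump_mass TYPE('n) e" 1 0]
      DERIV_subset[OF der] bound by simp
  moreover have "F 1 = (LINT x|lebesgue. bump z' e x * b x)"
    unfolding F_def using bump_shift[of z v e] by (simp add: v_def)
  then have "mollify e b z' - mollify e b z = (F 1 - F 0) / bump_mass TYPE('n) e"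
    by (simp add: mollify_def F_def diff_divide_distrib)
  ultimately have "\<bar>mollify e b z' - mollify e b z\<bar> \<le> L * norm v"
    using bump_mass_pos[OF e(1), where 'n = 'n] by (simp add: pos_divide_le_eq)
  then show ?thesis by (simp add: v_def dist_norm norm_minus_commute)
qed

lemma integrable_pair_mult:
  fixes f :: "'a::euclidean_space \<Rightarrow> real" and g :: "'b::euclidean_space \<Rightarrow> real"
  assumes "integrable lebesgue f" "integrable lebesgue g"
  shows "integrable (lebesgue \<Otimes>\<^sub>M lebesgue) (\<lambda>(x, y). f x * g y)"
proof (rule leb_pair.Fubini_integrable)
  have [measurable]: "f \<in> borel_measurable lebesgue" "g \<in> borel_measurable lebesgue"
    using assms by auto
  show "(\<lambda>(x, y). f x * g y) \<in> borel_measurable (lebesgue \<Otimes>\<^sub>M lebesgue)" by measurable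
  show "integrable lebesgue (\<lambda>x. LINT y|lebesgue. norm (case (x, y) of (x, y) \<Rightarrow> f x * g y))"
    using assms by (simp add: abs_mult)
  show "AE x in lebesgue. integrable lebesgue (\<lambda>y. case (x, y) of (x, y) \<Rightarrow> f x * g y)"
    using assms by simp
qed

lemma integrable_mollify_pair:
  fixes b \<psi> :: "real^'n \<Rightarrow> real"
  assumes b: "loc_integrable b" and \<psi>: "continuous_on UNIV \<psi>" and supp: "\<And>x. x \<notin> cball 0 S \<Longrightarrow> \<psi> x = 0"
    and e0: "0 < e"
  shows "integrable (lebesgue \<Otimes>\<^sub>M lebesgue) (\<lambda>(z, x). \<psi> z * (bump z e x * b x))"
proof -
  define T where "T = S + e"
  have bint: "integrable lebesgue (\<lambda>x. indicator (cball 0 T) x * \<bar>b x\<bar>)"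
    using integrable_abs[OF loc_integrable_cball[OF b, of 0 T]] by (simp add: abs_mult)
  define P where "P = (\<lambda>(z, x). \<psi> z * (bump z e x * b x))"
  have intP: "integrable (lebesgue \<Otimes>\<^sub>M lebesgue) P"
  proof (rule Bochner_Integration.integrable_bound)
    show "integrable (lebesgue \<Otimes>\<^sub>M lebesgue) (\<lambda>(z, x). \<bar>\<psi> z\<bar> * (indicator (cball 0 T) x * \<bar>b x\<bar>))"
      by (intro integrable_pair_mult bint integrable_abs integrable_compact_support[OF \<psi> supp])
    have [measurable]: "b \<in> borel_measurable lebesgue" "\<psi> \<in> borel_measurable lebesgue"
      using loc_integrable_measurable[OF b] continuous_imp_lebesgue_measurable[OF \<psi>] by auto
    have "continuous_on UNIV (\<lambda>p :: (real^'n) \<times> (real^'n).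
        1 - ((snd p - fst p) \<bullet> (snd p - fst p)) / e\<^sup>2)"
      using e0 by (intro continuous_intros) auto
    moreover have "continuous_on UNIV (flat 0)"
      by (intro continuous_at_imp_continuous_on ballI DERIV_isCont[OF flat_has_derivative])
    ultimately have "continuous_on UNIV (\<lambda>p :: (real^'n) \<times> (real^'n). bump (fst p) e (snd p))"
      unfolding bump_def by (auto intro: continuous_on_compose2)
    then have "(\<lambda>p :: (real^'n) \<times> (real^'n). bump (fst p) e (snd p)) \<in> borel_measurable (lebesgue \<Otimes>\<^sub>M lebesgue)"
      by (intro measurable_lebesgue_pair) (simp add: borel_measurable_continuous_onI)
    then show "P \<in> borel_measurable (lebesgue \<Otimes>\<^sub>M lebesgue)"
      unfolding P_def split_def by measurable
    show "AE p in lebesgue \<Otimes>\<^sub>M lebesgue. norm (P p)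
        \<le> norm (case p of (z, x) \<Rightarrow> \<bar>\<psi> z\<bar> * (indicator (cball 0 T) x * \<bar>b x\<bar>))"
    proof (intro AE_I2)
      fix p :: "(real^'n) \<times> (real^'n)"
      obtain z x where p: "p = (z, x)" by (cases p)
      show "norm (P p) \<le> norm (case p of (z, x) \<Rightarrow> \<bar>\<psi> z\<bar> * (indicator (cball 0 T) x * \<bar>b x\<bar>))"
      proof (cases "z \<in> cball 0 S \<and> dist z x < e")
        case True
        then have "x \<in> cball 0 T"
          using dist_triangle[of 0 x z] by (auto simp: T_def)
        then show ?thesis
          by (simp add: p P_def abs_mult bump_nonneg mult_left_mono mult_left_le_one_le bump_le_1)
      next
        case False
        then have "\<psi> z = 0 \<or> bump z e x = 0" using supp[of z] bump_eq_0[OF e0, of z x] by force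
        then show ?thesis by (auto simp: p P_def)
      qed
    qed
  qed
  then show ?thesis by (simp add: P_def)
qed

lemma integrable_mollify:
  fixes b \<psi> :: "real^'n \<Rightarrow> real"
  assumes "loc_integrable b" "continuous_on UNIV \<psi>" "\<And>x. x \<notin> cball 0 S \<Longrightarrow> \<psi> x = 0" "0 < e"
  shows "integrable lebesgue (\<lambda>z. \<psi> z * mollify e b z)"
  using leb_pair.integrable_fst'[OF integrable_mollify_pair[OF assms]]
  by (simp add: mollify_def)

text \<open>By Fubini and the symmetry of the bump in its centre and its argument, the mollification may be
  shifted from b to the continuous function \<open>\<psi>\<close>, where it converges uniformly.\<close>

lemma mollify_tendsto:
  fixes b \<psi> :: "real^'n \<Rightarrow> real"
  assumes b: "loc_integrable b" and \<psi>: "continuous_on UNIV \<psi>" and supp: "\<And>x. x \<notin> cball 0 S \<Longrightarrow> \<psi> x = 0"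
    and \<delta>: "0 < \<delta>"
  shows "\<exists>e0>0. \<forall>e. 0 < e \<and> e < e0 \<longrightarrow>
    \<bar>(LINT z|lebesgue. \<psi> z * mollify e b z) - (LINT x|lebesgue. \<psi> x * b x)\<bar> < \<delta>"
proof -
  define T where "T = S + 1"
  define N where "N = (LINT x|lebesgue. indicator (cball 0 T) x * \<bar>b x\<bar>)"
  have bint: "integrable lebesgue (\<lambda>x. indicator (cball 0 T) x * \<bar>b x\<bar>)"
    using integrable_abs[OF loc_integrable_cball[OF b, of 0 T]] by (simp add: abs_mult)
  have N0: "0 \<le> N" unfolding N_def by (intro integral_nonneg_AE) auto
  define \<omega> where "\<omega> = \<delta> / (2 * (N + 1))"
  have \<omega>: "0 < \<omega>" "\<omega> * N < \<delta>"
    using \<delta> N0 by (auto simp: \<omega>_def field_simps intro!: add_nonneg_pos)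
  have "uniformly_continuous_on (cball 0 (T + 1)) \<psi>"
    by (intro compact_uniformly_continuous continuous_on_subset[OF \<psi>]) auto
  then obtain d where d: "0 < d" "\<And>x y. x \<in> cball 0 (T + 1) \<Longrightarrow> y \<in> cball 0 (T + 1) \<Longrightarrow> dist y x < d
      \<Longrightarrow> dist (\<psi> y) (\<psi> x) < \<omega>"
    using \<omega>(1) unfolding uniformly_continuous_on_def by metis
  show ?thesis
  proof (intro exI[of _ "min d 1"] conjI allI impI)
    show "0 < min d 1" using d by simp
    fix e assume e: "0 < e \<and> e < min d 1"
    then have e0: "0 < e" and e1: "e < 1" and ed: "e < d" by auto
    note mass = bump_mass_pos[OF e0, where 'n = 'n]
    define P where "P = (\<lambda>(z, x). \<psi> z * (bump z e x * b x))"
    have intP: "integrable (lebesgue \<Otimes>\<^sub>M lebesgue) P"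
      unfolding P_def by (rule integrable_mollify_pair[OF b \<psi> supp e0])
    have inner: "(LINT z|lebesgue. \<psi> z * (bump z e x * b x)) = b x * (LINT z|lebesgue. \<psi> z * bump x e z)" for x
    proof -
      have "\<psi> z * (bump z e x * b x) = b x * (\<psi> z * bump x e z)" for z
        using bump_swap[of z e x] by simp
      then show ?thesis by (simp only: integral_mult_right_zero)
    qed
    have "(LINT z|lebesgue. LINT x|lebesgue. \<psi> z * (bump z e x * b x))
        = (LINT x|lebesgue. LINT z|lebesgue. \<psi> z * (bump z e x * b x))"
      using leb_pair.Fubini_integral[where f = "\<lambda>z x. \<psi> z * (bump z e x * b x)"] intP by (simp add: P_def)
    also have "\<dots> = (LINT x|lebesgue. b x * (LINT z|lebesgue. \<psi> z * bump x e z))"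
      by (simp add: inner)
    finally have swap: "(LINT z|lebesgue. \<psi> z * mollify e b z)
        = (LINT x|lebesgue. b x * ((LINT z|lebesgue. \<psi> z * bump x e z) / bump_mass TYPE('n) e))"
      by (simp add: mollify_def)
    define q where "q x = (LINT z|lebesgue. \<psi> z * bump x e z) / bump_mass TYPE('n) e - \<psi> x" for x
    have \<psi>bint: "integrable lebesgue (\<lambda>z. \<psi> z * bump x e z)" for x
      by (rule integrable_compact_support[of _ 0 S])
        (auto intro!: continuous_intros \<psi> continuous_bump simp: supp)
    have q_eq: "q x = (LINT z|lebesgue. (\<psi> z - \<psi> x) * bump x e z) / bump_mass TYPE('n) e" for x
    proof -
      have "(LINT z|lebesgue. (\<psi> z - \<psi> x) * bump x e z)
          = (LINT z|lebesgue. \<psi> z * bump x e z) - \<psi> x * bump_mass TYPE('n) e"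
        by (simp add: left_diff_distrib \<psi>bint integrable_bump[OF e0] integral_bump[OF e0])
      then show ?thesis using mass by (simp add: q_def diff_divide_distrib)
    qed
    have q_le: "\<bar>b x * q x\<bar> \<le> \<omega> * (indicator (cball 0 T) x * \<bar>b x\<bar>)" for x
    proof (cases "x \<in> cball 0 T")
      case True
      have "\<bar>LINT z|lebesgue. (\<psi> z - \<psi> x) * bump x e z\<bar> \<le> (LINT z|lebesgue. \<omega> * bump x e z)"
      proof (intro integral_abs_bound[THEN order_trans] integral_mono integrable_abs integrable_mult_right integrable_bump e0)
        show "integrable lebesgue (\<lambda>z. (\<psi> z - \<psi> x) * bump x e z)"
          by (simp add: left_diff_distrib \<psi>bint integrable_bump[OF e0])
        fix z
        show "\<bar>(\<psi> z - \<psi> x) * bump x e z\<bar> \<le> \<omega> * bump x e z"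
        proof (cases "dist x z < e")
          case zx: True
          then have "z \<in> cball 0 (T + 1)" "x \<in> cball 0 (T + 1)" "dist z x < d"
            using True e1 ed dist_triangle[of 0 z x] by (auto simp: dist_commute)
          then have "\<bar>\<psi> z - \<psi> x\<bar> \<le> \<omega>" using d(2)[of x z] by (simp add: dist_norm)
          then show ?thesis by (simp add: abs_mult bump_nonneg mult_right_mono)
        qed (simp add: bump_eq_0[OF e0])
      qed
      then have "\<bar>q x\<bar> \<le> \<omega>"
        using mass by (simp add: q_eq integral_bump[OF e0] pos_divide_le_eq)
      from mult_right_mono[OF this abs_ge_zero[of "b x"]] show ?thesis
        using True by (simp add: abs_mult mult.commute)
    next
      case False
      have z: "\<psi> z * bump x e z = 0" for z
      proof (cases "z \<in> cball 0 S")
        case True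
        then have "e \<le> dist x z" using False e1 dist_triangle[of 0 x z] by (auto simp: T_def dist_commute)
        then show ?thesis by (simp add: bump_eq_0[OF e0])
      qed (simp add: supp)
      then have "q x = 0" using False supp[of x] by (auto simp: q_def T_def z)
      then show ?thesis using \<omega> by simp
    qed
    have intb: "integrable lebesgue (\<lambda>x. \<psi> x * b x)"
      using integrable_compact_support_mult[of b \<psi> 0 S] b \<psi> supp by simp
    have intq: "integrable lebesgue (\<lambda>x. b x * q x)"
    proof (rule Bochner_Integration.integrable_bound[OF integrable_mult_right[OF bint, of \<omega>]])
      have 1: "integrable lebesgue (\<lambda>x. LINT z|lebesgue. \<psi> z * (bump z e x * b x))"
      proof -
        have "integrable (lebesgue \<Otimes>\<^sub>M lebesgue) (\<lambda>(x, z). P (z, x))"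
          by (rule leb_pair.integrable_product_swap[OF intP])
        from leb_pair.integrable_fst'[OF this] show ?thesis by (simp add: P_def)
      qed
      have "(\<lambda>x. b x * q x) = (\<lambda>x. (LINT z|lebesgue. \<psi> z * (bump z e x * b x)) / bump_mass TYPE('n) e - \<psi> x * b x)"
      proof
        fix x
        show "b x * q x = (LINT z|lebesgue. \<psi> z * (bump z e x * b x)) / bump_mass TYPE('n) e - \<psi> x * b x"
          unfolding inner
          by (simp add: q_def right_diff_distrib mult.commute)
      qed
      then show "(\<lambda>x. b x * q x) \<in> borel_measurable lebesgue"
        using 1 intb by simp
      show "AE x in lebesgue. norm (b x * q x) \<le> norm (\<omega> * (indicator (cball 0 T) x * \<bar>b x\<bar>))"
      proof (intro AE_I2)
        fix x
        have "0 \<le> \<omega> * (indicator (cball 0 T) x * \<bar>b x\<bar>)" using \<omega> by simp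
        then show "norm (b x * q x) \<le> norm (\<omega> * (indicator (cball 0 T) x * \<bar>b x\<bar>))"
          using q_le[of x] by simp
      qed
    qed
    have "(LINT z|lebesgue. \<psi> z * mollify e b z) - (LINT x|lebesgue. \<psi> x * b x) = (LINT x|lebesgue. b x * q x)"
    proof -
      have "(LINT x|lebesgue. b x * ((LINT z|lebesgue. \<psi> z * bump x e z) / bump_mass TYPE('n) e))
         = (LINT x|lebesgue. b x * q x + \<psi> x * b x)"
        by (simp add: q_def right_diff_distrib mult.commute)
      then show ?thesis unfolding swap using intq intb by simp
    qed
    also have "\<bar>\<dots>\<bar> \<le> (LINT x|lebesgue. \<omega> * (indicator (cball 0 T) x * \<bar>b x\<bar>))"
      by (intro integral_abs_bound[THEN order_trans] integral_mono integrable_abs intq integrable_mult_right bint q_le)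
    also have "\<dots> = \<omega> * N" by (simp add: N_def)
    finally show "\<bar>(LINT z|lebesgue. \<psi> z * mollify e b z) - (LINT x|lebesgue. \<psi> x * b x)\<bar> < \<delta>"
      using \<omega> by simp
  qed
qed

text \<open>Continuous functions converging almost everywhere to the sign of b, truncated to the range
  between -1 and 1 and cut off at the boundary of the ball, converge under a common integrable bound.\<close>

lemma exists_continuous_sgn_approx:
  fixes b :: "real^'n \<Rightarrow> real"
  assumes b: "loc_integrable b" and \<delta>: "0 < \<delta>"
  obtains \<psi> where "continuous_on UNIV \<psi>" "\<And>x. \<bar>\<psi> x\<bar> \<le> 1" "\<And>x. x \<notin> ball x0 R \<Longrightarrow> \<psi> x = 0"
    "(LINT x|lebesgue. indicator (ball x0 R) x * \<bar>b x\<bar>) - \<delta> < (LINT x|lebesgue. \<psi> x * b x)"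
proof -
  have bm [measurable]: "b \<in> borel_measurable lebesgue" by (rule loc_integrable_measurable[OF b])
  have "(\<lambda>x. sgn (b x)) \<in> borel_measurable lebesgue" by measurable
  then have "(\<lambda>x. sgn (b x)) measurable_on UNIV"
    by (intro lebesgue_measurable_imp_measurable_on) auto
  then obtain N g where N: "negligible N" and g: "\<And>n. continuous_on UNIV (g n)"
    and lim: "\<And>x. x \<notin> N \<Longrightarrow> (\<lambda>n. g n x) \<longlonglongrightarrow> sgn (b x)"
    unfolding measurable_on_def by auto
  define cut where "cut n x = min 1 (real n * max 0 (R - dist x0 x))" for n x
  define \<psi> where "\<psi> n x = cut n x * max (- 1) (min 1 (g n x))" for n x
  have \<psi>c: "continuous_on UNIV (\<psi> n)" for n
    unfolding \<psi>_def cut_def by (intro continuous_intros g)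
  have cut01: "0 \<le> cut n x" "cut n x \<le> 1" for n x by (auto simp: cut_def)
  have \<psi>1: "\<bar>\<psi> n x\<bar> \<le> 1" for n x
    using cut01[of n x] by (auto simp: \<psi>_def abs_mult intro!: mult_le_one)
  have \<psi>0: "\<psi> n x = 0" if "x \<notin> ball x0 R" for n x
    using that by (simp add: \<psi>_def cut_def)
  have int: "integrable lebesgue (\<lambda>x. indicator (cball x0 R) x * \<bar>b x\<bar>)"
    using integrable_abs[OF loc_integrable_cball[OF b, of x0 R]] by (simp add: abs_mult)
  have "(\<lambda>n. LINT x|lebesgue. \<psi> n x * b x) \<longlonglongrightarrow> (LINT x|lebesgue. indicator (ball x0 R) x * \<bar>b x\<bar>)"
  proof (rule integral_dominated_convergence[OF _ _ int])
    show "(\<lambda>x. indicat_real (ball x0 R) x * \<bar>b x\<bar>) \<in> borel_measurable lebesgue"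
      by (intro borel_measurable_times borel_measurable_abs bm borel_measurable_indicator) auto
    show "(\<lambda>x. \<psi> n x * b x) \<in> borel_measurable lebesgue" for n
      by (intro borel_measurable_times bm continuous_imp_lebesgue_measurable \<psi>c)
    show "AE x in lebesgue. norm (\<psi> n x * b x) \<le> indicator (cball x0 R) x * \<bar>b x\<bar>" for n
    proof (intro AE_I2)
      fix x
      show "norm (\<psi> n x * b x) \<le> indicator (cball x0 R) x * \<bar>b x\<bar>"
        using \<psi>1[of n x] \<psi>0[of x n]
        by (cases "x \<in> ball x0 R") (auto simp: abs_mult mult_left_le_one_le)
    qed
    have "AE x in lebesgue. x \<notin> N"
      using N by (intro AE_not_in) (simp add: negligible_iff_null_sets)
    then show "AE x in lebesgue. (\<lambda>n. \<psi> n x * b x) \<longlonglongrightarrow> indicator (ball x0 R) x * \<bar>b x\<bar>"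
    proof eventually_elim
      case (elim x)
      show ?case
      proof (cases "x \<in> ball x0 R")
        case True
        then have pos: "0 < R - dist x0 x" by simp
        obtain n0 where n0: "1 / (R - dist x0 x) \<le> real n0" using real_arch_simple by blast
        have "\<forall>\<^sub>F n in sequentially. 1 = cut n x"
        proof (rule eventually_sequentiallyI[of n0])
          fix n assume "n0 \<le> n"
          then have "1 / (R - dist x0 x) \<le> real n" using n0 by linarith
          then have "1 \<le> real n * (R - dist x0 x)" using pos by (simp add: field_simps)
          then show "1 = cut n x" using pos by (simp add: cut_def)
        qed
        then have "(\<lambda>n. cut n x) \<longlonglongrightarrow> 1" by (rule Lim_transform_eventually[OF tendsto_const])
        moreover have "(\<lambda>n. max (- 1) (min 1 (g n x))) \<longlonglongrightarrow> max (- 1) (min 1 (sgn (b x)))"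
          by (intro tendsto_max tendsto_min tendsto_const lim elim)
        ultimately have "(\<lambda>n. \<psi> n x * b x) \<longlonglongrightarrow> 1 * max (- 1) (min 1 (sgn (b x))) * b x"
          unfolding \<psi>_def by (intro tendsto_mult tendsto_const)
        moreover have "1 * max (- 1) (min 1 (sgn (b x))) * b x = \<bar>b x\<bar>"
          by (auto simp: sgn_if)
        ultimately show ?thesis using True by simp
      qed (simp add: \<psi>0)
    qed
  qed
  from LIMSEQ_D[OF this \<delta>] obtain n where
    "norm ((LINT x|lebesgue. \<psi> n x * b x) - (LINT x|lebesgue. indicator (ball x0 R) x * \<bar>b x\<bar>)) < \<delta>"
    by blast
  then show thesis
    by (intro that[of "\<psi> n"] \<psi>c \<psi>1 \<psi>0) auto
qed

text \<open>If all fine mollifications were small on the ball, then so would be their pairing with a continuous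
  approximation of the sign of b, which is close to the integral of the modulus of b.\<close>

lemma exists_mollify_large:
  fixes b :: "real^'n \<Rightarrow> real"
  assumes b: "loc_integrable b" and \<rho>: "0 < \<rho>" and \<beta>: "0 < \<beta>"
    and large: "\<beta> < (LINT x|lebesgue. indicator (ball x0 R) x * \<bar>b x\<bar>)"
  obtains e z where "0 < e" "e < \<rho>" "z \<in> ball x0 R"
    "\<beta> \<le> \<bar>mollify e b z\<bar> * measure lebesgue (ball x0 R)"
proof -
  define I where "I = (LINT x|lebesgue. indicator (ball x0 R) x * \<bar>b x\<bar>)"
  define \<delta> where "\<delta> = (I - \<beta>) / 2"
  have \<delta>: "0 < \<delta>" using large by (simp add: \<delta>_def I_def)
  obtain \<psi> where \<psi>: "continuous_on UNIV \<psi>" "\<And>x. \<bar>\<psi> x\<bar> \<le> 1" "\<And>x. x \<notin> ball x0 R \<Longrightarrow> \<psi> x = 0"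
    "I - \<delta> < (LINT x|lebesgue. \<psi> x * b x)"
    using exists_continuous_sgn_approx[OF b \<delta>, of x0 R] unfolding I_def by blast
  have supp: "\<psi> x = 0" if "x \<notin> cball 0 (norm x0 + R)" for x
    using that \<psi>(3)[of x] norm_triangle_ineq[of x0 "x - x0"] by (force simp: dist_norm norm_minus_commute)
  obtain e0 where e0: "0 < e0" "\<And>e. 0 < e \<and> e < e0 \<Longrightarrow>
    \<bar>(LINT z|lebesgue. \<psi> z * mollify e b z) - (LINT x|lebesgue. \<psi> x * b x)\<bar> < \<delta>"
    using mollify_tendsto[OF b \<psi>(1) supp \<delta>] by blast
  define e where "e = min e0 \<rho> / 2"
  have e: "0 < e" "e < e0" "e < \<rho>" using e0 \<rho> by (auto simp: e_def)
  have gt: "\<beta> < (LINT z|lebesgue. \<psi> z * mollify e b z)"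
  proof -
    have "\<bar>(LINT z|lebesgue. \<psi> z * mollify e b z) - (LINT x|lebesgue. \<psi> x * b x)\<bar> < \<delta>"
      using e0(2)[of e] e by simp
    moreover have "2 * \<delta> = I - \<beta>" by (simp add: \<delta>_def)
    ultimately show ?thesis using \<psi>(4) by linarith
  qed
  have "\<exists>z\<in>ball x0 R. \<beta> \<le> \<bar>mollify e b z\<bar> * measure lebesgue (ball x0 R)"
  proof (rule ccontr)
    assume neg: "\<not> ?thesis"
    define m where "m = measure lebesgue (ball x0 R)"
    have "ball x0 R \<noteq> {}"
    proof
      assume empty: "ball x0 R = {}"
      have "I = 0" unfolding I_def empty by simp
      then show False using large \<beta> by (simp add: I_def)
    qed
    then have "0 < R" by (simp add: not_le)
    then have m: "0 < m" unfolding m_def by (simp add: content_ball_pos)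
    have "(LINT z|lebesgue. \<psi> z * mollify e b z) \<le> (LINT z|lebesgue. indicator (ball x0 R) z * (\<beta> / m))"
    proof (intro integral_mono integrable_mollify[OF b \<psi>(1) supp e(1)])
      show "integrable lebesgue (\<lambda>z. indicator (ball x0 R) z * (\<beta> / m) :: real)"
        using lmeasurable_ball lmeasurable_iff_integrable by (intro integrable_mult_left) blast
      fix z
      show "\<psi> z * mollify e b z \<le> indicator (ball x0 R) z * (\<beta> / m)"
      proof (cases "z \<in> ball x0 R")
        case True
        then have "\<bar>mollify e b z\<bar> * m < \<beta>" using neg unfolding m_def by (meson not_le)
        then have "\<bar>mollify e b z\<bar> \<le> \<beta> / m" using m by (simp add: field_simps)
        moreover have "\<bar>\<psi> z * mollify e b z\<bar> \<le> \<bar>mollify e b z\<bar>"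
          using \<psi>(2)[of z] by (simp add: abs_mult mult_left_le_one_le)
        ultimately have "\<bar>\<psi> z * mollify e b z\<bar> \<le> \<beta> / m" by linarith
        then show ?thesis using True by (simp add: abs_le_iff)
      qed (simp add: \<psi>(3))
    qed
    also have "\<dots> = \<beta>" using m by (simp add: m_def)
    finally show False using gt by simp
  qed
  then show thesis using that e by blast
qed

text \<open>Vanishing pairings with bumps make every mollification zero, which the preceding
  lemma excludes on each ball where b has positive mass.\<close>

lemma AE_eq_0_if_test_integrals_eq_0:
  fixes b :: "real^'n \<Rightarrow> real"
  assumes b: "loc_integrable b"
    and zero: "\<And>\<phi> :: real^'n \<Rightarrow> real. test_fun \<phi> \<Longrightarrow> (LINT x|lebesgue. \<phi> x * b x) = 0"
  shows "AE x in lebesgue. b x = 0"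
proof -
  have "AE x in lebesgue. indicator (ball 0 (real k)) x * \<bar>b x\<bar> = 0" for k
  proof -
    have "mollify e b z = 0" if "0 < e" for e z
      using zero[OF test_fun_bump[OF that]] by (simp add: mollify_def)
    then have "\<not> 0 < (LINT x|lebesgue. indicator (ball 0 (real k)) x * \<bar>b x\<bar>)"
      using exists_mollify_large[OF b, of 1 "(LINT x|lebesgue. indicator (ball 0 (real k)) x * \<bar>b x\<bar>) / 2" 0 "real k"]
      by force
    moreover have "0 \<le> (LINT x|lebesgue. indicator (ball 0 (real k)) x * \<bar>b x\<bar>)"
      by (intro integral_nonneg_AE) auto
    ultimately have eq: "(LINT x|lebesgue. indicator (ball 0 (real k)) x * \<bar>b x\<bar>) = 0" by linarith
    have "integrable lebesgue (\<lambda>x. indicator (ball 0 (real k)) x * \<bar>b x\<bar>)"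
    proof (rule Bochner_Integration.integrable_bound[OF loc_integrable_cball[OF b, of 0 "real k"]])
      show "(\<lambda>x. indicat_real (ball 0 (real k)) x * \<bar>b x\<bar>) \<in> borel_measurable lebesgue"
        by (intro borel_measurable_times borel_measurable_abs loc_integrable_measurable b borel_measurable_indicator) auto
    qed (auto simp: indicator_def)
    then show ?thesis using eq by (subst (asm) integral_nonneg_eq_0_iff_AE) auto
  qed
  then have "AE x in lebesgue. \<forall>k. indicator (ball 0 (real k)) x * \<bar>b x\<bar> = 0"
    unfolding AE_all_countable by blast
  then show ?thesis
  proof eventually_elim
    case (elim x)
    obtain k where "norm x < real k" using reals_Archimedean2 by blast
    then show ?case using elim[rule_format, of k] by simp
  qed
qed

text \<open>Both means are compared with the value at y of a much finer mollification, which is L-Lipschitz;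
  each comparison costs at most L t. As the scale of that mollification tends to zero, only the
  means of b itself remain, so that b never has to be evaluated at a point.\<close>

lemma weak_lipschitz_average:
  fixes b :: "real^'n \<Rightarrow> real" and g :: "real^'n \<Rightarrow> real^'n"
  assumes weak: "\<And>l. has_weak_partial l b (\<lambda>x. g x $ l)"
    and L: "AE x in lebesgue. x \<in> ball x0 \<rho> \<longrightarrow> norm (g x) \<le> L" and L0: "0 \<le> L"
    and e: "0 < e" "e \<le> t" and y: "cball y t \<subseteq> ball x0 s" and s: "s < \<rho>"
    and \<psi>: "continuous_on UNIV \<psi>" "\<And>x. 0 \<le> \<psi> x" "\<And>x. x \<notin> cball y t \<Longrightarrow> \<psi> x = 0"
  shows "\<bar>(LINT x|lebesgue. \<psi> x * b x) - mollify e b y * (LINT x|lebesgue. \<psi> x)\<bar> \<le> 2 * L * t * (LINT x|lebesgue. \<psi> x)"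
proof -
  from weak have b: "loc_integrable b" by (auto simp: has_weak_partial_def)
  define R where "R = norm y + t"
  have R: "cball y t \<subseteq> cball 0 R"
  proof
    fix x assume "x \<in> cball y t"
    then show "x \<in> cball 0 R"
      using norm_triangle_ineq[of y "x - y"] by (simp add: R_def dist_norm norm_minus_commute)
  qed
  have t0: "0 < t" using e by simp
  have step: "\<bar>(LINT z|lebesgue. \<eta> z * mollify e' b z) - mollify e' b y * (LINT z|lebesgue. \<eta> z)\<bar>
      \<le> L * t * (LINT z|lebesgue. \<eta> z)"
    if \<eta>: "continuous_on UNIV \<eta>" "\<And>x. 0 \<le> \<eta> x" "\<And>x. x \<notin> cball y t \<Longrightarrow> \<eta> x = 0"
      and e': "0 < e'" "e' < \<rho> - s" for \<eta> :: "real^'n \<Rightarrow> real" and e'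
  proof -
    have i1: "integrable lebesgue (\<lambda>z. \<eta> z * mollify e' b z)"
      using R \<eta> by (intro integrable_mollify[of b \<eta> R] b e') blast+
    have i2: "integrable lebesgue \<eta>" by (rule integrable_compact_support[OF \<eta>(1,3)])
    have "(LINT z|lebesgue. \<eta> z * mollify e' b z) - mollify e' b y * (LINT z|lebesgue. \<eta> z)
       = (LINT z|lebesgue. \<eta> z * mollify e' b z - mollify e' b y * \<eta> z)"
      by (simp add: i1 i2)
    also have "\<bar>\<dots>\<bar> \<le> (LINT z|lebesgue. L * t * \<eta> z)"
    proof (intro integral_abs_bound[THEN order_trans] integral_mono integrable_abs
        integrable_mult_right i2 Bochner_Integration.integrable_diff i1)
      fix z
      show "\<bar>\<eta> z * mollify e' b z - mollify e' b y * \<eta> z\<bar> \<le> L * t * \<eta> z"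
      proof (cases "z \<in> cball y t")
        case True
        have "y \<in> cball y t" using t0 by simp
        then have "y \<in> ball x0 s" "z \<in> ball x0 s" using y True by blast+
        then have "\<bar>mollify e' b z - mollify e' b y\<bar> \<le> L * dist y z"
          using e' by (intro mollify_lipschitz[OF weak L, where s = s]) auto
        also have "\<dots> \<le> L * t" using True L0 by (auto intro: mult_left_mono)
        finally have "\<bar>mollify e' b z - mollify e' b y\<bar> * \<eta> z \<le> L * t * \<eta> z"
          by (intro mult_right_mono \<eta>)
        moreover have "\<eta> z * mollify e' b z - mollify e' b y * \<eta> z = (mollify e' b z - mollify e' b y) * \<eta> z"
          by (simp add: left_diff_distrib)
        ultimately show ?thesis using \<eta>(2)[of z] by (simp add: abs_mult)
      qed (simp add: \<eta>)
    qed
    also have "\<dots> = L * t * (LINT z|lebesgue. \<eta> z)" by simp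
    finally show ?thesis .
  qed
  define X where "X = (LINT x|lebesgue. \<psi> x * b x)"
  define Y where "Y = (LINT x|lebesgue. bump y e x * b x)"
  define J where "J = (LINT x|lebesgue. \<psi> x)"
  define M where "M = bump_mass TYPE('n) e"
  have M: "0 < M" unfolding M_def using e by (intro bump_mass_pos)
  have J: "0 \<le> J" unfolding J_def by (intro integral_nonneg_AE AE_I2 \<psi>)
  have MJ: "M = (LINT x|lebesgue. bump y e x)" using e by (simp add: M_def integral_bump)
  have bump_supp: "bump y e x = 0" if "x \<notin> cball y t" for x
    using that e by (intro bump_eq_0) auto
  have approx: "\<bar>M * X - J * Y\<bar> \<le> 2 * L * t * J * M + \<delta> * (M + J)" if \<delta>: "0 < \<delta>" for \<delta>
  proof -
    obtain e1 where e1: "0 < e1" "\<And>e. 0 < e \<and> e < e1 \<Longrightarrow>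
        \<bar>(LINT z|lebesgue. \<psi> z * mollify e b z) - X\<bar> < \<delta>"
      using mollify_tendsto[of b \<psi> R \<delta>] b \<psi> R \<delta> unfolding X_def by blast
    obtain e2 where e2: "0 < e2" "\<And>e'. 0 < e' \<and> e' < e2 \<Longrightarrow>
        \<bar>(LINT z|lebesgue. bump y e z * mollify e' b z) - Y\<bar> < \<delta>"
      using mollify_tendsto[of b "bump y e" R \<delta>] b continuous_bump bump_supp R \<delta> unfolding Y_def by blast
    define e' where "e' = min (min e1 e2) (\<rho> - s) / 2"
    have e': "0 < e'" "e' < e1" "e' < e2" "e' < \<rho> - s" using e1 e2 s by (auto simp: e'_def)
    define X' where "X' = (LINT z|lebesgue. \<psi> z * mollify e' b z)"
    define Y' where "Y' = (LINT z|lebesgue. bump y e z * mollify e' b z)"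
    define m where "m = mollify e' b y"
    have 1: "\<bar>X' - X\<bar> \<le> \<delta>" "\<bar>Y' - Y\<bar> \<le> \<delta>"
      using e1(2)[of e'] e2(2)[of e'] e' unfolding X'_def Y'_def by auto
    have 2: "\<bar>X' - m * J\<bar> \<le> L * t * J"
      unfolding X'_def m_def J_def by (rule step) (use \<psi> e' in auto)
    have 3: "\<bar>Y' - m * M\<bar> \<le> L * t * M"
      unfolding Y'_def m_def MJ by (rule step) (use continuous_bump bump_nonneg bump_supp e' in auto)
    have "M * X - J * Y = M * (X - X') + M * (X' - m * J) - J * (Y' - m * M) + J * (Y' - Y)"
      by (simp add: algebra_simps)
    also have "\<bar>\<dots>\<bar> \<le> M * \<bar>X - X'\<bar> + M * \<bar>X' - m * J\<bar> + J * \<bar>Y' - m * M\<bar> + J * \<bar>Y' - Y\<bar>"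
    proof -
      have "\<bar>M * u\<bar> = M * \<bar>u\<bar>" "\<bar>J * u\<bar> = J * \<bar>u\<bar>" for u using M J by (simp_all add: abs_mult)
      note eqs = this
      have "\<bar>p + q - r + s\<bar> \<le> \<bar>p\<bar> + \<bar>q\<bar> + \<bar>r\<bar> + \<bar>s\<bar>" for p q r s :: real by linarith
      from this[of "M * (X - X')" "M * (X' - m * J)" "J * (Y' - m * M)" "J * (Y' - Y)"]
      show ?thesis unfolding eqs .
    qed
    also have "\<dots> \<le> M * \<delta> + M * (L * t * J) + J * (L * t * M) + J * \<delta>"
      using 1 2 3 M J by (intro add_mono mult_left_mono) (auto simp: abs_minus_commute)
    finally show ?thesis by (simp add: algebra_simps)
  qed
  have key: "\<bar>M * X - J * Y\<bar> \<le> 2 * L * t * J * M"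
  proof (rule field_le_epsilon)
    fix \<epsilon> :: real assume "0 < \<epsilon>"
    have MJ0: "0 < M + J" using M J by simp
    then have "0 < \<epsilon> / (M + J)" using \<open>0 < \<epsilon>\<close> by simp
    note approx[OF this]
    also have "\<epsilon> / (M + J) * (M + J) = \<epsilon>"
      using MJ0 nonzero_divide_eq_eq[of "M + J" \<epsilon> "\<epsilon> / (M + J)"] by simp
    finally show "\<bar>M * X - J * Y\<bar> \<le> 2 * L * t * J * M + \<epsilon>" .
  qed
  have "M * (X - mollify e b y * J) = M * X - J * Y"
    using M by (simp add: mollify_def Y_def M_def field_simps)
  then have "M * \<bar>X - mollify e b y * J\<bar> = \<bar>M * X - J * Y\<bar>"
    using M by (metis abs_mult abs_of_pos)
  then have "M * \<bar>X - mollify e b y * J\<bar> \<le> M * (2 * L * t * J)"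
    using key by (simp add: algebra_simps)
  then show ?thesis using M unfolding X_def J_def by (simp add: mult_le_cancel_left_pos)
qed

section \<open>The Poincare inequality on balls\<close>

lemma nn_integral_affine:
  fixes H :: "'a::euclidean_space \<Rightarrow> ennreal"
  assumes [measurable]: "H \<in> borel_measurable borel" and c: "0 < c"
  shows "(\<integral>\<^sup>+x. H x \<partial>lborel) = ennreal (c ^ DIM('a)) * (\<integral>\<^sup>+x. H (t + c *\<^sub>R x) \<partial>lborel)"
  using c by (subst lborel_affine[of c t]) (simp_all add: nn_integral_density nn_integral_distr nn_integral_cmult)

text \<open>The fundamental theorem of calculus along the segment; the Cauchy-Schwarz inequality for the
  parameter t appears as the nonnegativity of the variance of the directional derivative.\<close>

lemma square_increment_le:
  fixes f :: "real^'n \<Rightarrow> real"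
  assumes f: "\<And>x. (f has_derivative (\<lambda>v. g x \<bullet> v)) (at x)" and g: "continuous_on UNIV g"
  shows "ennreal ((f x - f y)\<^sup>2) \<le>
    ennreal ((norm (x - y))\<^sup>2) * (\<integral>\<^sup>+t. ennreal ((norm (g (y + t *\<^sub>R (x - y))))\<^sup>2) * indicator {0..1} t \<partial>lborel)"
proof -
  define h' where "h' t = g (y + t *\<^sub>R (x - y)) \<bullet> (x - y)" for t
  define c where "c = f x - f y"
  have gc: "continuous_on UNIV (\<lambda>t. g (y + t *\<^sub>R (x - y)))"
    by (intro continuous_on_compose2[OF g]) (auto intro!: continuous_intros)
  have [measurable]: "(\<lambda>t. g (y + t *\<^sub>R (x - y))) \<in> borel_measurable borel"
    by (rule borel_measurable_continuous_onI[OF gc])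
  have hc: "continuous_on A h'" for A
    unfolding h'_def by (intro continuous_on_subset[OF continuous_on_inner[OF gc continuous_on_const]]) auto
  have der: "((\<lambda>t. f (y + t *\<^sub>R (x - y))) has_vector_derivative h' t) (at t within A)" for t A
  proof -
    have "((\<lambda>t. y + t *\<^sub>R (x - y)) has_derivative (\<lambda>k. k *\<^sub>R (x - y))) (at t)"
      by (auto intro!: derivative_eq_intros)
    from has_derivative_compose[OF this f] show ?thesis
      unfolding has_vector_derivative_def h'_def
      by (auto intro: has_derivative_at_withinI simp: mult.commute)
  qed
  have int: "integrable lborel (\<lambda>t. indicator {0..1} t *\<^sub>R h' t)"
    and int2: "integrable lborel (\<lambda>t. indicator {0..1::real} t *\<^sub>R (h' t)\<^sup>2)"
    and int1: "integrable lborel (\<lambda>t. indicator {0..1::real} t *\<^sub>R (1::real))"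
    by (intro borel_integrable_compact continuous_intros hc compact_Icc)+
  have "(\<integral>t. indicator {0..1} t *\<^sub>R h' t \<partial>lborel) = c"
    using integral_FTC_atLeastAtMost[OF _ der hc, of 0 1] by (simp add: c_def)
  moreover have "(\<integral>t. indicator {0..1} t *\<^sub>R (h' t - c)\<^sup>2 \<partial>lborel)
     = (\<integral>t. indicator {0..1} t *\<^sub>R (h' t)\<^sup>2 - 2 * c * (indicator {0..1} t *\<^sub>R h' t)
        + c\<^sup>2 * (indicator {0..1::real} t *\<^sub>R (1::real)) \<partial>lborel)"
    by (intro Bochner_Integration.integral_cong) (auto simp: power2_diff indicator_def)
  ultimately have eqI: "(\<integral>t. indicator {0..1} t *\<^sub>R (h' t - c)\<^sup>2 \<partial>lborel)
      = (\<integral>t. indicator {0..1} t *\<^sub>R (h' t)\<^sup>2 \<partial>lborel) - 2 * c * c + c\<^sup>2"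
    using int int2 int1 by simp
  have "0 \<le> (\<integral>t. indicator {0..1} t *\<^sub>R (h' t - c)\<^sup>2 \<partial>lborel)"
    by (intro integral_nonneg_AE) auto
  then have "0 \<le> (\<integral>t. indicator {0..1} t *\<^sub>R (h' t)\<^sup>2 \<partial>lborel) - 2 * c * c + c\<^sup>2"
    unfolding eqI .
  moreover have "2 * c * c = 2 * c\<^sup>2" by (simp add: power2_eq_square)
  ultimately have "c\<^sup>2 \<le> (\<integral>t. indicator {0..1} t *\<^sub>R (h' t)\<^sup>2 \<partial>lborel)"
    by linarith
  then have "ennreal (c\<^sup>2) \<le> ennreal (\<integral>t. indicator {0..1} t *\<^sub>R (h' t)\<^sup>2 \<partial>lborel)"
    by (rule ennreal_leI)
  also have "\<dots> = (\<integral>\<^sup>+t. ennreal (indicator {0..1} t *\<^sub>R (h' t)\<^sup>2) \<partial>lborel)"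
    by (rule nn_integral_eq_integral[symmetric, OF int2]) auto
  also have "\<dots> \<le> (\<integral>\<^sup>+t. ennreal ((norm (x - y))\<^sup>2) *
      (ennreal ((norm (g (y + t *\<^sub>R (x - y))))\<^sup>2) * indicator {0..1} t) \<partial>lborel)"
  proof (intro nn_integral_mono)
    fix t
    have "(h' t)\<^sup>2 \<le> (norm (x - y))\<^sup>2 * (norm (g (y + t *\<^sub>R (x - y))))\<^sup>2"
      unfolding h'_def power_mult_distrib[symmetric]
      using Cauchy_Schwarz_ineq2[of "g (y + t *\<^sub>R (x - y))" "x - y"]
      by (subst power2_abs[symmetric], intro power_mono) (auto simp: mult.commute)
    then show "ennreal (indicator {0..1} t *\<^sub>R (h' t)\<^sup>2) \<le> ennreal ((norm (x - y))\<^sup>2) *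
      (ennreal ((norm (g (y + t *\<^sub>R (x - y))))\<^sup>2) * indicator {0..1} t)"
      by (auto simp: indicator_def ennreal_mult[symmetric] intro!: ennreal_leI)
  qed
  also have "\<dots> = ennreal ((norm (x - y))\<^sup>2) *
      (\<integral>\<^sup>+t. ennreal ((norm (g (y + t *\<^sub>R (x - y))))\<^sup>2) * indicator {0..1} t \<partial>lborel)"
    by (rule nn_integral_cmult) measurable
  finally show ?thesis by (simp add: c_def)
qed

text \<open>Splitting the segment at its midpoint keeps the coefficient of the variable that is integrated
  first at least one half, so that the change of variables costs at most \<open>2 ^ n\<close>.\<close>

lemma poincare_ball:
  fixes f :: "real^'n \<Rightarrow> real"
  assumes f: "\<And>x. (f has_derivative (\<lambda>v. g x \<bullet> v)) (at x)" and g: "continuous_on UNIV g"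
    and \<rho>: "0 < \<rho>" and D: "D = ball x0 \<rho>"
  shows "(\<integral>\<^sup>+x. \<integral>\<^sup>+y. ennreal ((f x - f y)\<^sup>2) * indicator D x * indicator D y \<partial>lborel \<partial>lborel)
    \<le> ennreal (4 * \<rho>\<^sup>2 * 2 ^ CARD('n)) * emeasure lborel D *
        (\<integral>\<^sup>+z. ennreal ((norm (g z))\<^sup>2) * indicator D z \<partial>lborel)"
proof -
  have fc: "continuous_on UNIV f"
    by (intro continuous_at_imp_continuous_on ballI has_derivative_continuous[OF f])
  have [measurable]: "f \<in> borel_measurable borel" "g \<in> borel_measurable borel" "D \<in> sets borel"
    using fc g by (auto simp: D borel_measurable_continuous_onI)
  define m where "m x y = (1/2) *\<^sub>R (x + y)" for x y :: "real^'n"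
  have [measurable]: "(\<lambda>p. m (fst p) (snd p)) \<in> borel_measurable borel"
    unfolding m_def by (intro borel_measurable_continuous_onI continuous_intros)
  define G where "G z = ennreal ((norm (g z))\<^sup>2) * indicator D z" for z
  have G[measurable]: "G \<in> borel_measurable borel" unfolding G_def by measurable
  define \<Gamma> where "\<Gamma> = (\<integral>\<^sup>+z. G z \<partial>lborel)"
  define Q where "Q x y = ennreal ((f x - f (m x y))\<^sup>2) * indicator D x * indicator D y" for x y
  have Q[measurable]: "(\<lambda>(x, y). Q x y) \<in> borel_measurable (borel \<Otimes>\<^sub>M borel)"
  proof -
    have "(\<lambda>p. f (m (fst p) (snd p))) \<in> borel_measurable borel"
      by (rule measurable_compose[of _ _ borel]) measurable
    then have [measurable]: "(\<lambda>p. f (m (fst p) (snd p))) \<in> borel_measurable (borel \<Otimes>\<^sub>M borel)"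
      by (simp add: borel_prod)
    show ?thesis unfolding Q_def split_def by measurable
  qed
  have Q_le: "(\<integral>\<^sup>+x. \<integral>\<^sup>+y. Q x y \<partial>lborel \<partial>lborel) \<le> ennreal (\<rho>\<^sup>2 * 2 ^ CARD('n)) * emeasure lborel D * \<Gamma>"
  proof -
    define w where "w t x y = ((1 - t) / 2) *\<^sub>R y + ((1 + t) / 2) *\<^sub>R x" for t :: real and x y :: "real^'n"
    define P where "P t x y = G (w t x y) * indicator {0..1} t * indicator D x * indicator D y" for t x y
    have le: "Q x y \<le> ennreal (\<rho>\<^sup>2) * (\<integral>\<^sup>+t. P t x y \<partial>lborel)" for x y
    proof (cases "x \<in> D \<and> y \<in> D")
      case True
      then have xy: "x \<in> ball x0 \<rho>" "y \<in> ball x0 \<rho>" by (auto simp: D)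
      have eq: "m x y + t *\<^sub>R (x - m x y) = w t x y" for t
      proof -
        have "(m x y + t *\<^sub>R (x - m x y)) $ i = w t x y $ i" for i
          unfolding m_def w_def by (simp add: field_simps)
        then show ?thesis by (simp add: vec_eq_iff)
      qed
      have wD: "w t x y \<in> D" if "t \<in> {0..1}" for t
      proof -
        have "w t x y = (1 - (1 + t) / 2) *\<^sub>R y + ((1 + t) / 2) *\<^sub>R x"
          by (simp add: w_def field_simps)
        then show ?thesis
          using convexD_alt[OF convex_ball xy(2,1), of "(1 + t) / 2"] that by (simp add: D)
      qed
      have "norm (x - m x y) \<le> \<rho>"
      proof -
        have "x - m x y = (1/2) *\<^sub>R (x - y)" by (simp add: m_def algebra_simps flip: scaleR_add_left)
        then have "norm (x - m x y) = norm (x - y) / 2" by simp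
        moreover have "norm (x - y) < 2 * \<rho>"
          using xy dist_triangle[of x y x0] by (simp add: dist_norm norm_minus_commute)
        ultimately show ?thesis by simp
      qed
      then have "ennreal ((norm (x - m x y))\<^sup>2) \<le> ennreal (\<rho>\<^sup>2)"
        by (intro ennreal_leI power_mono) auto
      moreover have "(\<integral>\<^sup>+t. ennreal ((norm (g (m x y + t *\<^sub>R (x - m x y))))\<^sup>2) * indicator {0..1} t \<partial>lborel)
          = (\<integral>\<^sup>+t. P t x y \<partial>lborel)"
        using True wD by (intro nn_integral_cong) (auto simp: eq P_def G_def indicator_def)
      ultimately have "ennreal ((norm (x - m x y))\<^sup>2)
          * (\<integral>\<^sup>+t. ennreal ((norm (g (m x y + t *\<^sub>R (x - m x y))))\<^sup>2) * indicator {0..1} t \<partial>lborel)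
          \<le> ennreal (\<rho>\<^sup>2) * (\<integral>\<^sup>+t. P t x y \<partial>lborel)"
        by (simp add: mult_right_mono)
      from order_trans[OF square_increment_le[OF f g] this] show ?thesis
        using True by (simp add: Q_def)
    qed (auto simp: Q_def)
    have slice: "(\<integral>\<^sup>+x. P t x y \<partial>lborel) \<le> 2 ^ CARD('n) * \<Gamma> * indicator D y * indicator {0..1} t" for t y
    proof (cases "t \<in> {0..1}")
      case True
      define c where "c = (1 + t) / 2"
      have c: "0 < c" "1 / 2 \<le> c" using True by (auto simp: c_def)
      have "\<Gamma> = ennreal (c ^ CARD('n)) * (\<integral>\<^sup>+x. G (w t x y) \<partial>lborel)"
        unfolding \<Gamma>_def w_def c_def[symmetric] by (subst nn_integral_affine[OF G c(1)]) simp
      moreover have ge1: "1 \<le> 2 ^ CARD('n) * ennreal (c ^ CARD('n))"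
      proof -
        have "1 \<le> (2 * c) ^ CARD('n)" using c by (intro one_le_power) simp
        then have "ennreal 1 \<le> ennreal (2 ^ CARD('n) * c ^ CARD('n))"
          by (intro ennreal_leI) (simp add: power_mult_distrib)
        then show ?thesis using c by (simp add: ennreal_mult ennreal_power[symmetric] del: ennreal_power)
      qed
      ultimately have "1 * (\<integral>\<^sup>+x. G (w t x y) \<partial>lborel) \<le> 2 ^ CARD('n) * \<Gamma>"
        using mult_right_mono[OF ge1 zero_le[of "\<integral>\<^sup>+x. G (w t x y) \<partial>lborel"]] by (simp add: mult.assoc)
      moreover have "(\<integral>\<^sup>+x. P t x y \<partial>lborel) \<le> (\<integral>\<^sup>+x. G (w t x y) * indicator D y \<partial>lborel)"
        by (intro nn_integral_mono) (auto simp: P_def indicator_def)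
      moreover have "\<dots> \<le> (\<integral>\<^sup>+x. G (w t x y) \<partial>lborel) * indicator D y"
        by (auto simp: indicator_def)
      moreover have "(\<integral>\<^sup>+x. P t x y \<partial>lborel) = 0" if "y \<notin> D" using that by (simp add: P_def)
      ultimately show ?thesis using True by (cases "y \<in> D") (auto intro: order_trans)
    qed (simp add: P_def)
    have "(\<integral>\<^sup>+x. \<integral>\<^sup>+y. \<integral>\<^sup>+t. P t x y \<partial>lborel \<partial>lborel \<partial>lborel)
        = (\<integral>\<^sup>+y. \<integral>\<^sup>+x. \<integral>\<^sup>+t. P t x y \<partial>lborel \<partial>lborel \<partial>lborel)"
      by (rule lborel_pair.Fubini') (unfold P_def w_def, measurable)
    also have "\<dots> = (\<integral>\<^sup>+y. \<integral>\<^sup>+t. \<integral>\<^sup>+x. P t x y \<partial>lborel \<partial>lborel \<partial>lborel)"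
    proof (intro nn_integral_cong)
      fix y :: "real^'n"
      show "(\<integral>\<^sup>+x. \<integral>\<^sup>+t. P t x y \<partial>lborel \<partial>lborel) = (\<integral>\<^sup>+t. \<integral>\<^sup>+x. P t x y \<partial>lborel \<partial>lborel)"
        by (rule lborel_pair.Fubini') (unfold P_def w_def, measurable)
    qed
    also have "\<dots> \<le> (\<integral>\<^sup>+y. \<integral>\<^sup>+t. 2 ^ CARD('n) * \<Gamma> * indicator D y * indicator {0..1::real} t \<partial>lborel \<partial>lborel)"
      by (intro nn_integral_mono slice)
    also have "\<dots> = 2 ^ CARD('n) * \<Gamma> * emeasure lborel D"
      by (simp add: nn_integral_cmult)
    finally have P_le: "(\<integral>\<^sup>+x. \<integral>\<^sup>+y. \<integral>\<^sup>+t. P t x y \<partial>lborel \<partial>lborel \<partial>lborel)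
        \<le> 2 ^ CARD('n) * \<Gamma> * emeasure lborel D" .
    have "(\<integral>\<^sup>+x. \<integral>\<^sup>+y. Q x y \<partial>lborel \<partial>lborel)
        \<le> (\<integral>\<^sup>+x. \<integral>\<^sup>+y. ennreal (\<rho>\<^sup>2) * (\<integral>\<^sup>+t. P t x y \<partial>lborel) \<partial>lborel \<partial>lborel)"
      by (intro nn_integral_mono le)
    also have "\<dots> = ennreal (\<rho>\<^sup>2) * (\<integral>\<^sup>+x. \<integral>\<^sup>+y. \<integral>\<^sup>+t. P t x y \<partial>lborel \<partial>lborel \<partial>lborel)"
      unfolding P_def w_def by (simp add: nn_integral_cmult)
    also have "\<dots> \<le> ennreal (\<rho>\<^sup>2) * (2 ^ CARD('n) * \<Gamma> * emeasure lborel D)"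
      by (rule mult_left_mono[OF P_le]) simp
    also have "\<dots> = ennreal (\<rho>\<^sup>2 * 2 ^ CARD('n)) * emeasure lborel D * \<Gamma>"
    proof -
      have "ennreal (2 ^ CARD('n)) = 2 ^ CARD('n)"
        by (simp add: ennreal_power[symmetric] del: ennreal_power)
      then show ?thesis by (simp add: ennreal_mult ac_simps)
    qed
    finally show ?thesis .
  qed
  have "(\<integral>\<^sup>+x. \<integral>\<^sup>+y. ennreal ((f x - f y)\<^sup>2) * indicator D x * indicator D y \<partial>lborel \<partial>lborel)
     \<le> (\<integral>\<^sup>+x. \<integral>\<^sup>+y. 2 * Q x y + 2 * Q y x \<partial>lborel \<partial>lborel)"
  proof (intro nn_integral_mono)
    fix x y
    have "(f x - f y)\<^sup>2 \<le> 2 * (f x - f (m x y))\<^sup>2 + 2 * (f y - f (m y x))\<^sup>2"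
    proof -
      have "m y x = m x y" by (simp add: m_def add.commute)
      moreover have "(p - q)\<^sup>2 \<le> 2 * (p - r)\<^sup>2 + 2 * (q - r)\<^sup>2" for p q r :: real
        using zero_le_power2[of "p - r + (q - r)"] by (simp add: power2_eq_square algebra_simps)
      ultimately show ?thesis by metis
    qed
    then have "ennreal ((f x - f y)\<^sup>2) \<le> ennreal (2 * (f x - f (m x y))\<^sup>2 + 2 * (f y - f (m y x))\<^sup>2)"
      by (rule ennreal_leI)
    also have "\<dots> = 2 * ennreal ((f x - f (m x y))\<^sup>2) + 2 * ennreal ((f y - f (m y x))\<^sup>2)"
      by (simp add: ennreal_mult)
    finally have "ennreal ((f x - f y)\<^sup>2) \<le> 2 * ennreal ((f x - f (m x y))\<^sup>2) + 2 * ennreal ((f y - f (m y x))\<^sup>2)" .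
    then show "ennreal ((f x - f y)\<^sup>2) * indicator D x * indicator D y \<le> 2 * Q x y + 2 * Q y x"
      by (auto simp: Q_def indicator_def)
  qed
  also have "\<dots> = 2 * (\<integral>\<^sup>+x. \<integral>\<^sup>+y. Q x y \<partial>lborel \<partial>lborel) + 2 * (\<integral>\<^sup>+x. \<integral>\<^sup>+y. Q y x \<partial>lborel \<partial>lborel)"
  proof -
    have [measurable]: "(\<lambda>(x, y). Q y x) \<in> borel_measurable (borel \<Otimes>\<^sub>M borel)"
      using measurable_compose[OF measurable_pair_swap' Q] by (simp add: split_def)
    show ?thesis by (simp add: nn_integral_add nn_integral_cmult)
  qed
  also have "(\<integral>\<^sup>+x. \<integral>\<^sup>+y. Q y x \<partial>lborel \<partial>lborel) = (\<integral>\<^sup>+x. \<integral>\<^sup>+y. Q x y \<partial>lborel \<partial>lborel)"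
    by (rule lborel_pair.Fubini'[symmetric]) simp
  also have "2 * (\<integral>\<^sup>+x. \<integral>\<^sup>+y. Q x y \<partial>lborel \<partial>lborel) + 2 * (\<integral>\<^sup>+x. \<integral>\<^sup>+y. Q x y \<partial>lborel \<partial>lborel)
      = 4 * (\<integral>\<^sup>+x. \<integral>\<^sup>+y. Q x y \<partial>lborel \<partial>lborel)"
    by (subst distrib_right[symmetric]) simp
  also have "\<dots> \<le> 4 * (ennreal (\<rho>\<^sup>2 * 2 ^ CARD('n)) * emeasure lborel D * \<Gamma>)"
    by (intro mult_left_mono Q_le) simp
  also have "\<dots> = ennreal (4 * \<rho>\<^sup>2 * 2 ^ CARD('n)) * emeasure lborel D * \<Gamma>"
  proof -
    have "ennreal (4 * \<rho>\<^sup>2 * 2 ^ CARD('n)) = 4 * ennreal (\<rho>\<^sup>2 * 2 ^ CARD('n))"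
      by (subst mult.assoc, subst ennreal_mult) auto
    then show ?thesis by (simp only: mult.assoc)
  qed
  finally show ?thesis unfolding \<Gamma>_def G_def .
qed

section \<open>Reverse Hoelder weights and the critical radius\<close>

definition wint :: "(real^'n \<Rightarrow> real) \<Rightarrow> (real^'n) set \<Rightarrow> real" where
  "wint w S = (LINT x:S|lebesgue. w x)"

lemma loc_Lp_imp_loc_integrable:
  fixes w :: "real^'n \<Rightarrow> real"
  assumes "loc_Lp p w" "1 \<le> p"
  shows "loc_integrable w"
proof (rule loc_integrableI)
  show m: "w \<in> borel_measurable lebesgue" using assms by (simp add: loc_Lp_def)
  fix R
  have 1: "integrable lebesgue (\<lambda>x :: real^'n. indicator (cball 0 R) x *\<^sub>R (1::real))"
    by (rule loc_integrable_cball[OF loc_integrable_continuous]) simp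
  have 2: "integrable lebesgue (\<lambda>x. indicator (cball 0 R) x *\<^sub>R (norm (w x) powr p))"
    using assms compact_cball unfolding loc_Lp_def set_integrable_def by blast
  show "integrable lebesgue (\<lambda>x. indicator (cball 0 R) x *\<^sub>R w x)"
  proof (rule Bochner_Integration.integrable_bound[OF Bochner_Integration.integrable_add[OF 1 2]])
    show "(\<lambda>x. indicat_real (cball 0 R) x *\<^sub>R w x) \<in> borel_measurable lebesgue"
      by (intro borel_measurable_scaleR m borel_measurable_indicator) auto
    have "\<bar>t\<bar> \<le> 1 + \<bar>t\<bar> powr p" for t :: real
    proof (cases "\<bar>t\<bar> \<le> 1")
      case False
      then have "\<bar>t\<bar> powr 1 \<le> \<bar>t\<bar> powr p" using assms by (intro powr_mono) auto
      then show ?thesis using False by simp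
    qed (use powr_ge_zero[of "\<bar>t\<bar>" p] in linarith)
    then show "AE x in lebesgue. norm (indicat_real (cball 0 R) x *\<^sub>R w x)
        \<le> norm (indicat_real (cball 0 R) x *\<^sub>R 1 + indicat_real (cball 0 R) x *\<^sub>R (norm (w x) powr p))"
      by (intro AE_I2) (auto simp: indicator_def)
  qed
qed

lemma loc_integrable_subset_ball:
  fixes w :: "real^'n \<Rightarrow> 'b::{banach, second_countable_topology}"
  assumes "loc_integrable w" "E \<in> sets lebesgue" "E \<subseteq> ball x R"
  shows "set_integrable lebesgue E w"
proof (rule set_integrable_subset)
  show "set_integrable lebesgue (cball x R) w" using assms(1) by (simp add: loc_integrable_def)
qed (use assms ball_subset_cball[of x R] in auto)

text \<open>Integrated over a set, this splits the mass of a function at the height t: the part below is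
  controlled by the measure of the set, the part above by the integral of the p-th power. With
  t adapted to the situation it does the work of the Hoelder inequality.\<close>

lemma young_truncation:
  fixes v t p :: real
  assumes "0 \<le> v" "0 < t" "1 \<le> p"
  shows "v \<le> t + t powr (1 - p) * v powr p"
proof (cases "v \<le> t")
  case False
  then have v: "0 < v" "t \<le> v" using assms by auto
  have "v = v powr (1 - p) * v powr p" using v by (simp flip: powr_add)
  also have "\<dots> \<le> t powr (1 - p) * v powr p"
    using v assms by (intro mult_right_mono powr_mono2') auto
  finally show ?thesis using assms by linarith
qed (use assms in \<open>auto intro: add_increasing2\<close>)

text \<open>The reverse Hoelder condition with the denominator multiplied out, which keeps it meaningful
  whatever the average is, and with a constant that is at least 1.\<close>

locale rh_weight =
  fixes w :: "real^'n \<Rightarrow> real" and p K :: real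
  assumes p1: "1 < p" and K1: "1 \<le> K" and Lp: "loc_Lp p w" and pos: "AE x in lebesgue. 0 < w x"
    and RH: "\<And>x r. 0 < r \<Longrightarrow> (avg (ball x r) (\<lambda>y. w y powr p)) powr (1 / p) \<le> K * avg (ball x r) w"
begin

lemma loc: "loc_integrable w"
  using loc_Lp_imp_loc_integrable[OF Lp] p1 by simp

lemma locp: "loc_integrable (\<lambda>x. w x powr p)"
proof -
  have m: "w \<in> borel_measurable lebesgue" using Lp by (simp add: loc_Lp_def)
  show ?thesis
  proof (rule loc_integrableI)
    show "(\<lambda>x. w x powr p) \<in> borel_measurable lebesgue" using m by measurable
    fix R
    have 2: "integrable lebesgue (\<lambda>x. indicator (cball 0 R) x *\<^sub>R (norm (w x) powr p))"
      using Lp compact_cball unfolding loc_Lp_def set_integrable_def by blast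
    show "integrable lebesgue (\<lambda>x. indicator (cball 0 R) x *\<^sub>R (w x powr p))"
    proof (rule integrable_cong_AE_imp[OF 2])
      show "(\<lambda>x. indicat_real (cball 0 R) x *\<^sub>R (w x powr p)) \<in> borel_measurable lebesgue"
        using m by (intro borel_measurable_scaleR borel_measurable_indicator) (measurable, auto)
      show "AE x in lebesgue. indicat_real (cball 0 R) x *\<^sub>R (norm (w x) powr p) = indicat_real (cball 0 R) x *\<^sub>R w x powr p"
        using pos by eventually_elim simp
    qed
  qed
qed

lemma wint_le:
  assumes E: "E \<in> sets lebesgue" "E \<subseteq> ball x R" and t: "0 < t"
  shows "wint w E \<le> t * measure lebesgue E + t powr (1 - p) * wint (\<lambda>x. w x powr p) E"
proof -
  have int1: "set_integrable lebesgue E w" by (rule loc_integrable_subset_ball[OF loc E])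
  have int2: "set_integrable lebesgue E (\<lambda>x. w x powr p)" by (rule loc_integrable_subset_ball[OF locp E])
  have "loc_integrable (\<lambda>x :: real^'n. 1 :: real)" by (simp add: loc_integrable_continuous)
  from loc_integrable_subset_ball[OF this E]
  have int3: "integrable lebesgue (indicator E :: real^'n \<Rightarrow> real)" by (simp add: set_integrable_def)
  have "wint w E \<le> (LINT x|lebesgue. t * indicator E x + t powr (1 - p) * (indicator E x *\<^sub>R (w x powr p)))"
    unfolding wint_def set_lebesgue_integral_def
  proof (rule integral_mono_AE)
    show "AE x in lebesgue. indicat_real E x *\<^sub>R w x
        \<le> t * indicat_real E x + t powr (1 - p) * (indicat_real E x *\<^sub>R w x powr p)"
      using pos
    proof eventually_elim
      case (elim x)
      then show ?case using young_truncation[of "w x" t p] t p1 by (simp add: indicator_def)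
    qed
  qed (use int1 int2 int3 in \<open>auto simp: set_integrable_def\<close>)
  also have "\<dots> = t * measure lebesgue E + t powr (1 - p) * wint (\<lambda>x. w x powr p) E"
    using int2 int3 E by (simp add: wint_def set_integrable_def set_lebesgue_integral_def)
  finally show ?thesis .
qed

lemma wint_ball_pos: "0 < r \<Longrightarrow> 0 < wint w (ball x r)"
proof -
  assume r: "0 < r"
  have int: "integrable lebesgue (\<lambda>y. indicator (ball x r) y *\<^sub>R w y)"
    using loc_integrable_subset_ball[OF loc, of "ball x r" x r] by (simp add: set_integrable_def)
  have nn: "AE y in lebesgue. 0 \<le> indicator (ball x r) y *\<^sub>R w y"
    using pos by eventually_elim (simp add: indicator_def)
  have "wint w (ball x r) \<noteq> 0"
  proof
    assume "wint w (ball x r) = 0"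
    then have "AE y in lebesgue. indicator (ball x r) y *\<^sub>R w y = 0"
      using integral_nonneg_eq_0_iff_AE[OF int nn] by (simp add: wint_def set_lebesgue_integral_def)
    then have "AE y in lebesgue. y \<notin> ball x r"
      using pos by eventually_elim (auto simp: indicator_def split: if_splits)
    then have "ball x r \<in> null_sets lebesgue"
      by (subst (asm) AE_iff_null_sets[symmetric]) auto
    then have "measure lebesgue (ball x r) = 0" by (simp add: measure_eq_0_null_sets)
    then show False using content_ball_pos[OF r, of x] by simp
  qed
  moreover have "0 \<le> wint w (ball x r)"
    unfolding wint_def set_lebesgue_integral_def using nn by (rule integral_nonneg_AE)
  ultimately show ?thesis by simp
qed

lemma wint_mono:
  assumes "S \<in> sets lebesgue" "T \<in> sets lebesgue" "S \<subseteq> T" "T \<subseteq> ball x r"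
  shows "wint w S \<le> wint w T"
  unfolding wint_def set_lebesgue_integral_def
proof (rule integral_mono_AE)
  show "integrable lebesgue (\<lambda>x. indicat_real S x *\<^sub>R w x)" "integrable lebesgue (\<lambda>x. indicat_real T x *\<^sub>R w x)"
    using loc_integrable_subset_ball[OF loc] assms unfolding set_integrable_def by blast+
  show "AE x in lebesgue. indicat_real S x *\<^sub>R w x \<le> indicat_real T x *\<^sub>R w x"
    using pos by eventually_elim (use assms(3) in \<open>auto simp: indicator_def\<close>)
qed

text \<open>A thin shell has small measure, and the reverse Hoelder inequality prevents a set of small measure
  from carrying more than half of the mass of the ball: cutting at the height s times the average,
  the two conditions on s and \<open>\<delta>\<close> allot one quarter to each part.\<close>

lemma wint_shell_le:
  assumes s: "1 \<le> s" "s powr (1 - p) * K powr p \<le> 1 / 4"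
    and \<delta>: "0 < \<delta>" "\<delta> < 1" "s * real CARD('n) * \<delta> \<le> 1 / 4" and R: "0 < R"
  shows "wint w (ball x R) \<le> 2 * wint w (ball x ((1 - \<delta>) * R))"
proof -
  define B where "B = ball x R"
  define B' where "B' = ball x ((1 - \<delta>) * R)"
  define E where "E = B - B'"
  define A where "A = avg B w"
  have "(1 - \<delta>) * R \<le> 1 * R" using \<delta> R by (intro mult_right_mono) auto
  then have sub: "B' \<subseteq> B" by (auto simp: B_def B'_def)
  have B0: "0 < measure lebesgue B" using content_ball_pos[OF R, of x] by (simp add: B_def)
  have AB: "A * measure lebesgue B = wint w B" using B0 by (simp add: A_def avg_def wint_def)
  have A0: "0 < A" unfolding A_def avg_def using wint_ball_pos[OF R, of x] B0 by (simp add: wint_def B_def)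
  have E: "E \<in> sets lebesgue" "E \<subseteq> ball x R" by (auto simp: E_def B_def B'_def)
  have mE: "measure lebesgue E \<le> real CARD('n) * \<delta> * measure lebesgue B"
  proof -
    have "measure lebesgue E = measure lebesgue B - measure lebesgue B'"
      unfolding E_def by (rule measurable_measure_Diff) (use sub in \<open>auto simp: B_def B'_def\<close>)
    also have "measure lebesgue B' = (1 - \<delta>) ^ CARD('n) * measure lebesgue B"
      using \<delta> R by (simp add: B_def B'_def content_ball power_mult_distrib)
    also have "measure lebesgue B - (1 - \<delta>) ^ CARD('n) * measure lebesgue B
        = (1 - (1 - \<delta>) ^ CARD('n)) * measure lebesgue B" by (simp add: algebra_simps)
    also have "\<dots> \<le> real CARD('n) * \<delta> * measure lebesgue B"
      using Bernoulli_inequality[of "- \<delta>" "CARD('n)"] \<delta> by (intro mult_right_mono) auto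
    finally show ?thesis .
  qed
  have RHB: "wint (\<lambda>y. w y powr p) B \<le> K powr p * A powr p * measure lebesgue B"
  proof -
    have nn: "0 \<le> avg B (\<lambda>y. w y powr p)"
      unfolding avg_def set_lebesgue_integral_def by (intro divide_nonneg_nonneg integral_nonneg_AE) auto
    have "avg B (\<lambda>y. w y powr p) = (avg B (\<lambda>y. w y powr p) powr (1 / p)) powr p"
      using nn p1 by (simp add: powr_powr)
    also have "\<dots> \<le> (K * A) powr p"
      using RH[OF R, of x] p1 by (intro powr_mono2) (auto simp: B_def A_def)
    also have "\<dots> = K powr p * A powr p" using K1 A0 by (simp add: powr_mult)
    finally have "avg B (\<lambda>y. w y powr p) * measure lebesgue B \<le> K powr p * A powr p * measure lebesgue B"
      using B0 by (intro mult_right_mono) auto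
    then show ?thesis using B0 by (simp add: avg_def wint_def)
  qed
  have "wint w E \<le> s * A * measure lebesgue E + (s * A) powr (1 - p) * wint (\<lambda>y. w y powr p) E"
    using s A0 by (intro wint_le[OF E]) auto
  also have "\<dots> \<le> s * A * (real CARD('n) * \<delta> * measure lebesgue B)
      + (s * A) powr (1 - p) * (K powr p * A powr p * measure lebesgue B)"
  proof (intro add_mono mult_left_mono mE)
    have "wint (\<lambda>y. w y powr p) E \<le> wint (\<lambda>y. w y powr p) B"
      unfolding wint_def set_lebesgue_integral_def
      by (intro integral_mono)
        (use loc_integrable_subset_ball[OF locp E] loc_integrable_subset_ball[OF locp, of B x R] in
          \<open>auto simp: set_integrable_def B_def E_def indicator_def\<close>)
    then show "wint (\<lambda>y. w y powr p) E \<le> K powr p * A powr p * measure lebesgue B" using RHB by simp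
  qed (use s A0 in auto)
  also have "\<dots> = (s * real CARD('n) * \<delta> + s powr (1 - p) * K powr p) * wint w B"
  proof -
    have "A powr p * A powr (1 - p) = A" using A0 by (simp flip: powr_add)
    then have "(s * A) powr (1 - p) * (K powr p * A powr p * measure lebesgue B)
      = s powr (1 - p) * K powr p * (A * measure lebesgue B)"
      using s A0 by (simp add: powr_mult mult.assoc mult.left_commute)
    then show ?thesis unfolding AB[symmetric] by (simp add: algebra_simps)
  qed
  also have "\<dots> \<le> (1 / 2) * wint w B"
    using s \<delta> wint_ball_pos[OF R, of x] by (intro mult_right_mono) (auto simp: B_def)
  finally have "wint w E \<le> wint w B / 2" by simp
  moreover have "wint w B = wint w E + wint w B'"
  proof -
    have eq: "indicator B y *\<^sub>R w y = indicator E y *\<^sub>R w y + indicator B' y *\<^sub>R w y" for y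
      using sub by (auto simp: E_def indicator_def)
    have "set_integrable lebesgue E w" "set_integrable lebesgue B' w"
      using loc_integrable_subset_ball[OF loc E] loc_integrable_subset_ball[OF loc, of B' x R] sub
      by (auto simp: B_def B'_def)
    then show ?thesis unfolding wint_def set_lebesgue_integral_def eq
      by (simp add: set_integrable_def)
  qed
  ultimately show ?thesis by (simp add: B_def B'_def)
qed

text \<open>For the exponent p = n/2 the normalised mass \<open>r ^ (2 - n) * w(B(y, r))\<close> is controlled through
  the integral of \<open>w powr p\<close> over the same ball, which is small with r uniformly in y by absolute
  continuity. This is what keeps the critical radius away from zero.\<close>

lemma uniformly_small_near:
  assumes n: "2 * p = real CARD('n)" "2 \<le> CARD('n)"
  shows "\<exists>r>0. \<forall>y\<in>ball x 1. wint w (ball y r) \<le> r ^ (CARD('n) - 2)"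
proof -
  define \<omega> where "\<omega> = unit_ball_vol (real CARD('n))"
  have \<omega>: "0 < \<omega>" by (simp add: \<omega>_def unit_ball_vol_pos)
  define \<eta> where "\<eta> = 1 / (2 * \<omega>)"
  have \<eta>: "0 < \<eta>" using \<omega> by (simp add: \<eta>_def)
  define \<epsilon> where "\<epsilon> = \<eta> powr (p - 1) / 2"
  have \<epsilon>: "0 < \<epsilon>" using \<eta> by (simp add: \<epsilon>_def)
  define F where "F y = indicator (ball x 2) y *\<^sub>R (w y powr p)" for y
  have Fint: "integrable lebesgue F"
    using loc_integrable_subset_ball[OF locp, of "ball x 2" x 2] by (simp add: F_def[abs_def] set_integrable_def)
  have F0: "0 \<le> F y" for y by (simp add: F_def)
  have [measurable]: "F \<in> borel_measurable lebesgue" using Fint by auto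
  have trunc: "integrable lebesgue (\<lambda>y. if F y > real k then F y else 0)" for k :: nat
    by (rule Bochner_Integration.integrable_bound[OF Fint]) (auto simp: F0)
  have "(\<lambda>k. LINT y|lebesgue. (if F y > real k then F y else 0)) \<longlonglongrightarrow> integral\<^sup>L lebesgue (\<lambda>y :: real^'n. 0 :: real)"
  proof (rule integral_dominated_convergence[OF _ _ Fint])
    show "AE y in lebesgue. (\<lambda>k. if real k < F y then F y else 0) \<longlonglongrightarrow> 0"
    proof (intro AE_I2)
      fix y
      obtain k0 where "F y < real k0" using reals_Archimedean2 by blast
      then have "\<forall>\<^sub>F k in sequentially. 0 = (if real k < F y then F y else 0)"
        by (intro eventually_sequentiallyI[of k0]) auto
      then show "(\<lambda>k. if real k < F y then F y else 0) \<longlonglongrightarrow> 0"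
        by (rule Lim_transform_eventually[OF tendsto_const])
    qed
  qed (auto simp: F0)
  then have "(\<lambda>k. LINT y|lebesgue. (if F y > real k then F y else 0)) \<longlonglongrightarrow> 0" by simp
  from LIMSEQ_D[OF this, of "\<epsilon> / 2"] \<epsilon> obtain k :: nat where
    "norm ((LINT y|lebesgue. (if F y > real k then F y else 0)) - 0) < \<epsilon> / 2" by auto
  then have k: "(LINT y|lebesgue. (if F y > real k then F y else 0)) < \<epsilon> / 2" by auto
  define c where "c = (real k + 1) * \<omega>"
  have c: "0 < c" using \<omega> by (simp add: c_def)
  define r where "r = min 1 (\<epsilon> / (2 * c))"
  have r: "0 < r" "r \<le> 1" using \<epsilon> c by (auto simp: r_def)
  show ?thesis
  proof (intro exI[of _ r] conjI ballI r)
    fix y assume y: "y \<in> ball x 1"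
    have sub: "ball y r \<subseteq> ball x 2"
    proof
      fix z assume "z \<in> ball y r"
      then show "z \<in> ball x 2" using y r dist_triangle[of x z y] by auto
    qed
    have vol: "measure lebesgue (ball y r) = \<omega> * r ^ CARD('n)"
      using r by (simp add: content_ball \<omega>_def)
    have indint: "integrable lebesgue (\<lambda>z. indicator (ball y r) z :: real)"
      using lmeasurable_ball lmeasurable_iff_integrable by blast
    have "wint (\<lambda>z. w z powr p) (ball y r)
        \<le> (LINT z|lebesgue. (if F z > real k then F z else 0) + real k * indicator (ball y r) z)"
      unfolding wint_def set_lebesgue_integral_def
    proof (rule integral_mono)
      show "integrable lebesgue (\<lambda>z. indicat_real (ball y r) z *\<^sub>R w z powr p)"
        using loc_integrable_subset_ball[OF locp, of "ball y r" y r] by (simp add: set_integrable_def)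
      show "integrable lebesgue (\<lambda>z. (if F z > real k then F z else 0) + real k * indicator (ball y r) z)"
        by (intro Bochner_Integration.integrable_add trunc integrable_mult_right indint)
      fix z
      show "indicat_real (ball y r) z *\<^sub>R w z powr p
          \<le> (if F z > real k then F z else 0) + real k * indicator (ball y r) z"
      proof (cases "z \<in> ball y r")
        case True
        then have "F z = w z powr p" using sub by (auto simp: F_def)
        then show ?thesis using True by simp
      qed (use F0[of z] in simp)
    qed
    also have "\<dots> = (LINT z|lebesgue. (if F z > real k then F z else 0)) + real k * (\<omega> * r ^ CARD('n))"
      using trunc[of k] indint vol by simp
    also have "\<dots> \<le> \<epsilon> / 2 + \<epsilon> / 2"
    proof (intro add_mono)
      have "r ^ CARD('n) \<le> r" using r n power_decreasing[of 1 "CARD('n)" r] by simp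
      then have "real k * (\<omega> * r ^ CARD('n)) \<le> (real k + 1) * (\<omega> * r)"
        using \<omega> r by (intro mult_mono) auto
      also have "\<dots> = c * r" by (simp add: c_def)
      also have "\<dots> \<le> c * (\<epsilon> / (2 * c))"
        using c by (intro mult_left_mono) (auto simp: r_def)
      also have "\<dots> = \<epsilon> / 2" using c by simp
      finally show "real k * (\<omega> * r ^ CARD('n)) \<le> \<epsilon> / 2" .
    qed (use k in simp)
    finally have small: "wint (\<lambda>z. w z powr p) (ball y r) \<le> \<epsilon>" by simp
    define t where "t = \<eta> / r\<^sup>2"
    have t: "0 < t" using \<eta> r by (simp add: t_def)
    have rr: "r ^ CARD('n) = r ^ (CARD('n) - 2) * r\<^sup>2"
      using n(2) by (metis le_add_diff_inverse2 power_add)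
    have "t powr (1 - p) = \<eta> powr (1 - p) * r ^ (CARD('n) - 2)"
    proof -
      have "(1 / r\<^sup>2) powr (1 - p) = (r powr (- 2)) powr (1 - p)"
        using r by (simp add: powr_minus powr_numeral divide_inverse)
      also have "\<dots> = r powr (real (CARD('n) - 2))"
        using n by (simp add: powr_powr of_nat_diff algebra_simps)
      also have "\<dots> = r ^ (CARD('n) - 2)" using r by (simp add: powr_realpow)
      finally show ?thesis
        using \<eta> r powr_mult[of \<eta> "1 / r\<^sup>2" "1 - p"] by (simp add: t_def)
    qed
    then have "wint w (ball y r) \<le> t * (\<omega> * r ^ CARD('n)) + \<eta> powr (1 - p) * r ^ (CARD('n) - 2) * wint (\<lambda>z. w z powr p) (ball y r)"
      using wint_le[of "ball y r" y r t] t vol by simp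
    also have "\<dots> \<le> t * (\<omega> * r ^ CARD('n)) + \<eta> powr (1 - p) * r ^ (CARD('n) - 2) * \<epsilon>"
      using small r by (intro add_left_mono mult_left_mono) auto
    also have "\<dots> = r ^ (CARD('n) - 2) * (\<eta> * \<omega> + \<eta> powr (1 - p) * \<eta> powr (p - 1) / 2)"
      using r unfolding rr t_def \<epsilon>_def by (simp add: algebra_simps)
    also have "\<dots> = r ^ (CARD('n) - 2)"
    proof -
      have "\<eta> powr (1 - p) * \<eta> powr (p - 1) = 1" using \<eta> by (simp flip: powr_add)
      moreover have "\<eta> * \<omega> = 1 / 2" using \<omega> by (simp add: \<eta>_def)
      ultimately show ?thesis by simp
    qed
    finally show "wint w (ball y r) \<le> r ^ (CARD('n) - 2)" .
  qed
qed

end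

text \<open>Each application of the shell estimate shrinks the radius by the factor \<open>1 - \<delta>\<close> at the cost of
  a factor 2. The number of steps that reach R/16 depends on the dimension, on p and on K only.\<close>

lemma rh_weight_doubling:
  assumes "1 < p" "1 \<le> K"
  shows "\<exists>C>0. \<forall>(w :: real^'n \<Rightarrow> real) x R. rh_weight w p K \<and> 0 < R \<longrightarrow>
    wint w (ball x R) \<le> C * wint w (ball x (R / 16))"
proof -
  define s where "s = (4 * K powr p) powr (1 / (p - 1))"
  have K: "1 \<le> K powr p" using assms by (intro ge_one_powr_ge_zero) auto
  have s1: "1 \<le> s" unfolding s_def using K assms by (intro ge_one_powr_ge_zero) auto
  have s_powr: "s powr (1 - p) = (4 * K powr p) powr (- 1)"
  proof -
    have "1 / (p - 1) * (1 - p) = - 1" using assms by (simp add: field_simps)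
    then show ?thesis unfolding s_def by (simp only: powr_powr)
  qed
  have s2: "s powr (1 - p) * K powr p \<le> 1 / 4"
    unfolding s_powr using K by (simp add: powr_minus_divide)
  define \<delta> where "\<delta> = 1 / (4 * s * real CARD('n) + 4)"
  have sn: "0 \<le> s * real CARD('n)" using s1 by simp
  have \<delta>: "0 < \<delta>" "\<delta> < 1" "s * real CARD('n) * \<delta> \<le> 1 / 4"
    using sn by (auto simp: \<delta>_def field_simps)
  obtain k where k: "(1 - \<delta>) ^ k < 1 / 16"
    using real_arch_pow_inv[of "1 / 16" "1 - \<delta>"] \<delta> by auto
  show ?thesis
  proof (intro exI[of _ "2 ^ k"] conjI allI impI)
    fix w :: "real^'n \<Rightarrow> real" and x :: "real^'n" and R :: real
    assume wR: "rh_weight w p K \<and> 0 < R"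
    then interpret rh_weight w p K by simp
    have R: "0 < R" using wR by simp
    have "wint w (ball x R) \<le> 2 ^ i * wint w (ball x ((1 - \<delta>) ^ i * R))" for i
    proof (induction i)
      case (Suc i)
      have "wint w (ball x ((1 - \<delta>) ^ i * R)) \<le> 2 * wint w (ball x ((1 - \<delta>) * ((1 - \<delta>) ^ i * R)))"
        by (rule wint_shell_le[OF s1 s2 \<delta>]) (use \<delta> R in simp)
      then have "2 ^ i * wint w (ball x ((1 - \<delta>) ^ i * R)) \<le> 2 ^ i * (2 * wint w (ball x ((1 - \<delta>) * ((1 - \<delta>) ^ i * R))))"
        by (intro mult_left_mono) auto
      from order_trans[OF Suc.IH this] show ?case by (simp add: ac_simps)
    qed simp
    from this[of k] have "wint w (ball x R) \<le> 2 ^ k * wint w (ball x ((1 - \<delta>) ^ k * R))" .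
    also have "\<dots> \<le> 2 ^ k * wint w (ball x (R / 16))"
    proof (intro mult_left_mono wint_mono[where x = x and r = "R / 16"])
      have "(1 - \<delta>) ^ k * R \<le> 1 / 16 * R" using k R by (intro mult_right_mono) auto
      then show "ball x ((1 - \<delta>) ^ k * R) \<subseteq> ball x (R / 16)" by auto
    qed auto
    finally show "wint w (ball x R) \<le> 2 ^ k * wint w (ball x (R / 16))" .
  qed simp
qed

text \<open>The critical radius is the inf-convolution of the function 1/m with the distance. It is
  therefore 1-Lipschitz and bounded by 1/m for free, and the lower mass bound comes straight from
  the supremum that defines 1/m, combined with doubling.\<close>

definition crit_radii :: "(real^'n \<Rightarrow> real) \<Rightarrow> real^'n \<Rightarrow> real set" where
  "crit_radii w x = {t + dist x y | t y. 0 < t \<and> (\<forall>r\<ge>t. r ^ (CARD('n) - 2) < wint w (ball y r))}"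

definition crit_radius :: "(real^'n \<Rightarrow> real) \<Rightarrow> real^'n \<Rightarrow> real" where
  "crit_radius w x = Inf (crit_radii w x)"

lemma crit_radii_pos: "s \<in> crit_radii w x \<Longrightarrow> 0 < s"
  by (auto simp: crit_radii_def intro: add_pos_nonneg)

lemma crit_radii_bdd: "bdd_below (crit_radii w x)"
  using crit_radii_pos by (intro bdd_belowI[of _ 0]) (auto intro: less_imp_le)

lemma crit_radii_shift:
  fixes w :: "real^'n \<Rightarrow> real"
  assumes "s \<in> crit_radii w y" obtains s' where "s' \<in> crit_radii w x" "s' \<le> s + dist x y"
proof -
  from assms obtain t z where tz: "s = t + dist y z" "0 < t" "\<forall>r\<ge>t. r ^ (CARD('n) - 2) < wint w (ball z r)"
    by (auto simp: crit_radii_def)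
  then have "t + dist x z \<in> crit_radii w x" by (auto simp: crit_radii_def)
  moreover have "t + dist x z \<le> s + dist x y" using tz dist_triangle[of x z y] by simp
  ultimately show thesis by (rule that)
qed

lemma crit_radius_lipschitz:
  assumes "crit_radii w y \<noteq> {}"
  shows "crit_radius w x \<le> crit_radius w y + dist x y"
proof -
  have "crit_radius w x - dist x y \<le> s" if s: "s \<in> crit_radii w y" for s
  proof -
    obtain s' where s': "s' \<in> crit_radii w x" "s' \<le> s + dist x y" using crit_radii_shift[OF s] by blast
    have "crit_radius w x \<le> s'"
      unfolding crit_radius_def by (rule cInf_lower[OF s'(1) crit_radii_bdd])
    then show ?thesis using s' by simp
  qed
  then have "crit_radius w x - dist x y \<le> crit_radius w y"
    unfolding crit_radius_def[of w y] by (intro cInf_greatest assms)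
  then show ?thesis by simp
qed

text \<open>Without any critical scale at x the radii admitted in the supremum that defines 1/m are unbounded.\<close>

lemma m_aux_eq_0:
  fixes w :: "real^'n \<Rightarrow> real"
  assumes "crit_radii w x = {}" shows "m_aux w x = 0"
proof -
  define A where "A = {r. 0 < r \<and> 1 / r ^ (CARD('n) - 2) * (LINT y:ball x r|lebesgue. w y) \<le> 1}"
  have "\<exists>r\<in>A. t \<le> r" if "0 < t" for t
  proof -
    have "t + dist x x \<notin> crit_radii w x" using assms by simp
    moreover have "t + dist x x \<in> crit_radii w x" if "\<forall>r\<ge>t. r ^ (CARD('n) - 2) < wint w (ball x r)"
      using that \<open>0 < t\<close> unfolding crit_radii_def by blast
    ultimately obtain r where "t \<le> r" "\<not> r ^ (CARD('n) - 2) < wint w (ball x r)"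
      by blast
    then show ?thesis using that by (intro bexI[of _ r]) (auto simp: A_def wint_def field_simps)
  qed
  note ex = this
  have "(SUP r\<in>A. ennreal r) = \<infinity>"
  proof (rule ccontr)
    assume "(SUP r\<in>A. ennreal r) \<noteq> \<infinity>"
    then obtain b where b: "(SUP r\<in>A. ennreal r) = ennreal b" "0 \<le> b" by (cases "SUP r\<in>A. ennreal r") auto
    obtain r where r: "r \<in> A" "b + 1 \<le> r" using ex[of "b + 1"] b by auto
    have "ennreal r \<le> ennreal b" using r unfolding b(1)[symmetric] by (intro SUP_upper)
    then show False using r b by (simp add: ennreal_le_iff)
  qed
  then show ?thesis by (simp add: m_aux_def A_def)
qed

lemma m_aux_le:
  fixes w :: "real^'n \<Rightarrow> real"
  assumes \<rho>: "0 < crit_radius w x" shows "m_aux w x \<le> ennreal (1 / crit_radius w x)"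
proof -
  define A where "A = {r. 0 < r \<and> 1 / r ^ (CARD('n) - 2) * (LINT y:ball x r|lebesgue. w y) \<le> 1}"
  have ex: "\<exists>r\<in>A. t \<le> r" if "0 < t" "t < crit_radius w x" for t
  proof -
    have "t + dist x x \<notin> crit_radii w x"
      using that(2) cInf_lower[OF _ crit_radii_bdd, of t w x] unfolding crit_radius_def by auto
    moreover have "t + dist x x \<in> crit_radii w x" if "\<forall>r\<ge>t. r ^ (CARD('n) - 2) < wint w (ball x r)"
      using that \<open>0 < t\<close> unfolding crit_radii_def by blast
    ultimately obtain r where "t \<le> r" "\<not> r ^ (CARD('n) - 2) < wint w (ball x r)"
      by blast
    then show ?thesis using that by (intro bexI[of _ r]) (auto simp: A_def wint_def field_simps)
  qed
  have m: "m_aux w x = inverse (SUP r\<in>A. ennreal r)" by (simp add: m_aux_def A_def)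
  show ?thesis
  proof (cases "SUP r\<in>A. ennreal r")
    case (real b)
    have "crit_radius w x \<le> b"
    proof (rule ccontr)
      assume "\<not> ?thesis"
      then obtain r where r: "r \<in> A" "(b + crit_radius w x) / 2 \<le> r"
        using ex[of "(b + crit_radius w x) / 2"] real \<rho> by auto
      have "ennreal r \<le> ennreal b" using r unfolding real(2)[symmetric] by (intro SUP_upper)
      then have "r \<le> b" using real by simp
      then show False using r \<open>\<not> crit_radius w x \<le> b\<close> by simp
    qed
    then show ?thesis
      using \<rho> unfolding m real(2) by (subst inverse_ennreal) (auto simp: field_simps intro!: ennreal_leI)
  next
    case top
    then show ?thesis unfolding m top by simp
  qed
qed

context rh_weight
begin

lemma crit_radius_pos:
  assumes n: "2 * p = real CARD('n)" "2 \<le> CARD('n)" and ne: "crit_radii w x \<noteq> {}"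
  shows "0 < crit_radius w x"
proof -
  obtain r where r: "0 < r" "\<And>y. y \<in> ball x 1 \<Longrightarrow> wint w (ball y r) \<le> r ^ (CARD('n) - 2)"
    using uniformly_small_near[OF n, of x] by blast
  have "min 1 r \<le> s" if "s \<in> crit_radii w x" for s
  proof -
    from that obtain t y where ty: "s = t + dist x y" "0 < t" "\<forall>r\<ge>t. r ^ (CARD('n) - 2) < wint w (ball y r)"
      by (auto simp: crit_radii_def)
    show ?thesis
    proof (cases "y \<in> ball x 1")
      case True
      then have "\<not> t \<le> r" using r(2)[OF True] ty(3) by (meson not_le)
      moreover have "min 1 r \<le> r" "0 \<le> dist x y" by auto
      ultimately show ?thesis using ty(1) by linarith
    qed (use ty in simp)
  qed
  then have "min 1 r \<le> crit_radius w x"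
    unfolding crit_radius_def by (intro cInf_greatest ne)
  then show ?thesis using r by simp
qed

text \<open>A nearly optimal pair of a scale and a centre y lies within twice the critical radius of x, so a
  ball of that size around y is heavy and is contained in a slightly larger one around x.\<close>

lemma crit_radius_mass:
  assumes \<rho>: "0 < crit_radius w x" and ne: "crit_radii w x \<noteq> {}"
  shows "crit_radius w x ^ (CARD('n) - 2) \<le> wint w (ball x (4 * crit_radius w x))"
proof -
  define \<rho> where "\<rho> = crit_radius w x"
  have "Inf (crit_radii w x) < 2 * \<rho>" using assms by (simp add: \<rho>_def crit_radius_def)
  then obtain s where "s \<in> crit_radii w x" "s < 2 * \<rho>" by (rule cInf_lessD[OF ne, THEN bexE])
  then obtain t y where ty: "t + dist x y < 2 * \<rho>" "0 < t" "\<forall>r\<ge>t. r ^ (CARD('n) - 2) < wint w (ball y r)"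
    by (auto simp: crit_radii_def)
  then have "t \<le> 2 * \<rho>" using zero_le_dist[of x y] by linarith
  have "\<rho> ^ (CARD('n) - 2) \<le> (2 * \<rho>) ^ (CARD('n) - 2)"
    using assms by (intro power_mono) (auto simp: \<rho>_def)
  also have "\<dots> < wint w (ball y (2 * \<rho>))" using ty(3) \<open>t \<le> 2 * \<rho>\<close> by blast
  also have "\<dots> \<le> wint w (ball x (4 * \<rho>))"
  proof (rule wint_mono[where x = x and r = "4 * \<rho>"])
    show "ball y (2 * \<rho>) \<subseteq> ball x (4 * \<rho>)"
    proof
      fix z assume "z \<in> ball y (2 * \<rho>)"
      then show "z \<in> ball x (4 * \<rho>)" using ty dist_triangle[of x z y] by auto
    qed
  qed auto
  finally show ?thesis by (simp add: \<rho>_def)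
qed

end

lemma RH_imp_rh_weight:
  fixes w :: "real^'n \<Rightarrow> real"
  assumes w: "w \<in> RH p" and K: "RH_norm p w = ennreal K" and p: "1 < p"
  shows "rh_weight w p (max 1 K)"
proof
  have Lp: "loc_Lp p w" and pos: "AE x in lebesgue. 0 < w x" using w by (auto simp: RH_def)
  show "1 < p" "1 \<le> max 1 K" "loc_Lp p w" "AE x in lebesgue. 0 < w x" using p Lp pos by auto
  fix x and r :: real assume r: "0 < r"
  have 0: "0 \<le> avg (ball x r) w"
    unfolding avg_def set_lebesgue_integral_def
    by (intro divide_nonneg_nonneg integral_nonneg_AE) (use pos in \<open>auto elim!: eventually_mono simp: indicator_def\<close>)
  define X where "X = (avg (ball x r) (\<lambda>y. w y powr p)) powr (1 / p)"
  have "ennreal (X / avg (ball x r) w) \<le> RH_norm p w"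
    unfolding RH_norm_def X_def using r by (intro SUP_upper2[of x] SUP_upper2[of r]) auto
  also have "\<dots> \<le> ennreal (max 1 K)" unfolding K by (intro ennreal_leI) simp
  finally have le: "X / avg (ball x r) w \<le> max 1 K" by (subst (asm) ennreal_le_iff) auto
  show "X \<le> max 1 K * avg (ball x r) w"
  proof (cases "avg (ball x r) w = 0")
    \<comment> \<open>A vanishing average makes the quotient 0 by convention and the bound on it void; it contradicts
      the positivity of w.\<close>
    case True
    have lw: "loc_integrable w" using loc_Lp_imp_loc_integrable[OF Lp] p by simp
    have int: "integrable lebesgue (\<lambda>y. indicator (ball x r) y *\<^sub>R w y)"
      using loc_integrable_subset_ball[OF lw, of "ball x r" x r] by (simp add: set_integrable_def)
    have nn: "AE y in lebesgue. 0 \<le> indicator (ball x r) y *\<^sub>R w y"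
      using pos by eventually_elim (simp add: indicator_def)
    have B0: "0 < measure lebesgue (ball x r)" using content_ball_pos[OF r, of x] by simp
    then have "(LINT y|lebesgue. indicator (ball x r) y *\<^sub>R w y) = 0"
      using True by (simp add: avg_def set_lebesgue_integral_def)
    then have "AE y in lebesgue. indicator (ball x r) y *\<^sub>R w y = 0"
      using integral_nonneg_eq_0_iff_AE[OF int nn] by simp
    then have "AE y in lebesgue. y \<notin> ball x r"
      using pos by eventually_elim (auto simp: indicator_def split: if_splits)
    then have "ball x r \<in> null_sets lebesgue"
      by (subst (asm) AE_iff_null_sets[symmetric]) auto
    then show ?thesis using B0 by (simp add: measure_eq_0_null_sets)
  next
    case False
    then show ?thesis using le 0 by (simp add: pos_divide_le_eq)
  qed
qed

text \<open>If one point has no critical scale, then no point has, because critical scales move between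
  points at the cost of the distance; then m vanishes identically. Otherwise the critical radius
  is positive everywhere and doubling brings the mass bound from the radius 4 \<open>\<rho>\<close> down to \<open>\<rho> / 4\<close>.\<close>

proposition exists_critical_radius:
  assumes n: "3 \<le> CARD('n::finite)"
  shows "\<exists>\<kappa>>0. \<forall>w :: real^'n \<Rightarrow> real.
    w \<in> RH (real CARD('n) / 2) \<and> RH_norm (real CARD('n) / 2) w = ennreal K \<longrightarrow>
    (\<forall>x. m_aux w x = 0) \<or>
    (\<exists>\<rho>. (\<forall>x. 0 < \<rho> x) \<and> (\<forall>x y. \<rho> x \<le> \<rho> y + dist x y) \<and> (\<forall>x. m_aux w x \<le> ennreal (1 / \<rho> x)) \<and>
      (\<forall>x. \<kappa> * \<rho> x ^ (CARD('n) - 2) \<le> (LINT y:ball x (\<rho> x / 4)|lebesgue. w y)))"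
proof -
  define p where "p = real CARD('n) / 2"
  have p: "1 < p" "2 * p = real CARD('n)" using n by (auto simp: p_def)
  obtain C where C: "0 < C" "\<And>(w :: real^'n \<Rightarrow> real) x R. rh_weight w p (max 1 K) \<Longrightarrow> 0 < R \<Longrightarrow>
    wint w (ball x R) \<le> C * wint w (ball x (R / 16))"
    using rh_weight_doubling[of p "max 1 K", where 'n = 'n] p by auto
  show ?thesis
  proof (intro exI[of _ "1 / C"] conjI allI impI)
    show "0 < 1 / C" using C by simp
    fix w :: "real^'n \<Rightarrow> real"
    assume "w \<in> RH (real CARD('n) / 2) \<and> RH_norm (real CARD('n) / 2) w = ennreal K"
    then have rw: "rh_weight w p (max 1 K)" using RH_imp_rh_weight[of w p K] p by (simp add: p_def)
    then interpret rh_weight w p "max 1 K" .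
    show "(\<forall>x. m_aux w x = 0) \<or>
      (\<exists>\<rho>. (\<forall>x. 0 < \<rho> x) \<and> (\<forall>x y. \<rho> x \<le> \<rho> y + dist x y) \<and> (\<forall>x. m_aux w x \<le> ennreal (1 / \<rho> x)) \<and>
      (\<forall>x. 1 / C * \<rho> x ^ (CARD('n) - 2) \<le> (LINT y:ball x (\<rho> x / 4)|lebesgue. w y)))"
    proof (cases "\<exists>x. crit_radii w x = {}")
      case True
      then have "crit_radii w x = {}" for x
        using crit_radii_shift by (metis all_not_in_conv)
      then show ?thesis using m_aux_eq_0 by blast
    next
      case False
      then have ne: "crit_radii w x \<noteq> {}" for x by blast
      have pos: "0 < crit_radius w x" for x
        using n by (intro crit_radius_pos[OF p(2) _ ne]) simp
      show ?thesis
      proof (intro disjI2 exI[of _ "crit_radius w"] conjI allI)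
        fix x y
        show "0 < crit_radius w x" by (rule pos)
        show "crit_radius w x \<le> crit_radius w y + dist x y" by (rule crit_radius_lipschitz[OF ne])
        show "m_aux w x \<le> ennreal (1 / crit_radius w x)" by (rule m_aux_le[OF pos])
        have "crit_radius w x ^ (CARD('n) - 2) \<le> C * wint w (ball x (crit_radius w x / 4))"
          using order_trans[OF crit_radius_mass[OF pos ne] C(2)[OF rw, of "4 * crit_radius w x"]] pos[of x] by simp
        then show "1 / C * crit_radius w x ^ (CARD('n) - 2) \<le> (LINT y:ball x (crit_radius w x / 4)|lebesgue. w y)"
          using C(1) by (simp add: wint_def field_simps)
      qed
    qed
  qed
qed

section \<open>Diamagnetism and the commutator identity\<close>

text \<open>Schwarz's theorem: the mean value theorem, applied twice to the second difference of f over a small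
  parallelogram, expresses it through either of the mixed derivatives.\<close>

lemma mixed_partials_commute:
  fixes f :: "'a::real_normed_vector \<Rightarrow> real"
  assumes f: "\<And>x. (f has_derivative f' x) (at x)"
    and fv: "\<And>x. ((\<lambda>x. f' x v) has_derivative fv x) (at x)" and fw: "\<And>x. ((\<lambda>x. f' x w) has_derivative fw x) (at x)"
    and cv: "continuous_on UNIV (\<lambda>x. fv x w)" and cw: "continuous_on UNIV (\<lambda>x. fw x v)"
  shows "fv x w = fw x v"
proof -
  have line: "((\<lambda>s. g (y + s *\<^sub>R d)) has_real_derivative g' (y + s *\<^sub>R d) d) (at s)"
    if "\<And>x. (g has_derivative g' x) (at x)" for g :: "'a \<Rightarrow> real" and g' y d s
  proof -
    have "((\<lambda>s. y + s *\<^sub>R d) has_derivative (\<lambda>k. k *\<^sub>R d)) (at s)" by (auto intro!: derivative_eq_intros)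
    from has_derivative_compose[OF this that]
    have "((\<lambda>s. g (y + s *\<^sub>R d)) has_derivative (\<lambda>k. g' (y + s *\<^sub>R d) (k *\<^sub>R d))) (at s)" .
    moreover have "g' (y + s *\<^sub>R d) (k *\<^sub>R d) = g' (y + s *\<^sub>R d) d * k" for k
      using linear_simps(5)[OF has_derivative_bounded_linear[OF that]] by simp
    ultimately show ?thesis by (simp add: has_field_derivative_def)
  qed
  have second: "\<exists>s t. 0 < s \<and> s < h \<and> 0 < t \<and> t < h \<and>
      f (x + h *\<^sub>R a + h *\<^sub>R b) - f (x + h *\<^sub>R a) - f (x + h *\<^sub>R b) + f x = h * h * fa (x + s *\<^sub>R a + t *\<^sub>R b) b"
    if h: "0 < h" and fa: "\<And>x. ((\<lambda>x. f' x a) has_derivative fa x) (at x)" for h a b fa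
  proof -
    define k where "k s = f ((x + h *\<^sub>R b) + s *\<^sub>R a) - f (x + s *\<^sub>R a)" for s
    have dk: "(k has_real_derivative f' ((x + h *\<^sub>R b) + s *\<^sub>R a) a - f' (x + s *\<^sub>R a) a) (at s)" for s
      unfolding k_def by (intro DERIV_diff line f)
    obtain s where s: "0 < s" "s < h" "k h - k 0 = (h - 0) * (f' ((x + h *\<^sub>R b) + s *\<^sub>R a) a - f' (x + s *\<^sub>R a) a)"
      using MVT2[OF h dk] by blast
    define l where "l t = f' ((x + s *\<^sub>R a) + t *\<^sub>R b) a" for t
    have dl: "(l has_real_derivative fa ((x + s *\<^sub>R a) + t *\<^sub>R b) b) (at t)" for t
      unfolding l_def by (rule line[OF fa])
    obtain t where t: "0 < t" "t < h" "l h - l 0 = (h - 0) * fa ((x + s *\<^sub>R a) + t *\<^sub>R b) b"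
      using MVT2[OF h dl] by blast
    have "l h - l 0 = f' ((x + h *\<^sub>R b) + s *\<^sub>R a) a - f' (x + s *\<^sub>R a) a"
      by (simp add: l_def add_ac)
    then have k_eq: "k h - k 0 = h * h * fa (x + s *\<^sub>R a + t *\<^sub>R b) b" using s(3) t(3) by simp
    have "f (x + h *\<^sub>R a + h *\<^sub>R b) - f (x + h *\<^sub>R a) - f (x + h *\<^sub>R b) + f x = k h - k 0"
      by (simp add: k_def add_ac)
    then show ?thesis unfolding k_eq using s(1,2) t(1,2) by blast
  qed
  show ?thesis
  proof (rule ccontr)
    assume ne: "fv x w \<noteq> fw x v"
    define e where "e = \<bar>fv x w - fw x v\<bar> / 2"
    have e: "0 < e" using ne by (simp add: e_def)
    obtain d1 where d1: "0 < d1" "\<And>y. dist y x < d1 \<Longrightarrow> dist (fv y w) (fv x w) < e"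
      using cv e by (metis UNIV_I continuous_on_iff)
    obtain d2 where d2: "0 < d2" "\<And>y. dist y x < d2 \<Longrightarrow> dist (fw y v) (fw x v) < e"
      using cw e by (metis UNIV_I continuous_on_iff)
    define h where "h = min d1 d2 / (norm v + norm w + 1)"
    have nn: "0 < norm v + norm w + 1" by (simp add: add_nonneg_pos)
    have h: "0 < h" using d1 d2 nn by (simp add: h_def)
    have near: "dist (x + s *\<^sub>R a + t *\<^sub>R b) x < min d1 d2"
      if "0 < s" "s < h" "0 < t" "t < h" "norm a + norm b = norm v + norm w" for s t a b
    proof -
      have "dist (x + s *\<^sub>R a + t *\<^sub>R b) x \<le> s * norm a + t * norm b"
        using norm_triangle_ineq[of "s *\<^sub>R a" "t *\<^sub>R b"] that by (simp add: dist_norm add.assoc)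
      also have "\<dots> \<le> h * norm a + h * norm b" using that by (intro add_mono mult_right_mono) auto
      also have "\<dots> = h * (norm v + norm w)" using that by (simp flip: distrib_left)
      also have "\<dots> < h * (norm v + norm w + 1)" using h by simp
      also have "\<dots> = min d1 d2" using nn by (simp add: h_def)
      finally show ?thesis .
    qed
    obtain s t where st: "0 < s" "s < h" "0 < t" "t < h"
      "f (x + h *\<^sub>R v + h *\<^sub>R w) - f (x + h *\<^sub>R v) - f (x + h *\<^sub>R w) + f x = h * h * fv (x + s *\<^sub>R v + t *\<^sub>R w) w"
      using second[OF h fv, of w] by blast
    obtain s' t' where st': "0 < s'" "s' < h" "0 < t'" "t' < h"
      "f (x + h *\<^sub>R w + h *\<^sub>R v) - f (x + h *\<^sub>R w) - f (x + h *\<^sub>R v) + f x = h * h * fw (x + s' *\<^sub>R w + t' *\<^sub>R v) v"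
      using second[OF h fw, of v] by blast
    have "h * h * fv (x + s *\<^sub>R v + t *\<^sub>R w) w = h * h * fw (x + s' *\<^sub>R w + t' *\<^sub>R v) v"
    proof -
      have "x + h *\<^sub>R w + h *\<^sub>R v = x + h *\<^sub>R v + h *\<^sub>R w" by (simp add: add_ac)
      then show ?thesis using st(5) st'(5) by (simp only: diff_right_commute)
    qed
    then have "fv (x + s *\<^sub>R v + t *\<^sub>R w) w = fw (x + s' *\<^sub>R w + t' *\<^sub>R v) v" using h by simp
    moreover have "dist (fv (x + s *\<^sub>R v + t *\<^sub>R w) w) (fv x w) < e"
      using near[of s t v w] st by (intro d1(2)) simp
    moreover have "dist (fw (x + s' *\<^sub>R w + t' *\<^sub>R v) v) (fw x v) < e"
      using near[of s' t' w v] st' by (intro d2(2)) simp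
    moreover have "\<bar>r - s\<bar> \<le> \<bar>t - r\<bar> + \<bar>t - s\<bar>" for r s t :: real by linarith
    note this[of "fv x w" "fw x v" "fv (x + s *\<^sub>R v + t *\<^sub>R w) w"]
    ultimately show False unfolding e_def dist_real_def by simp
  qed
qed

lemma test_fun_linear:
  fixes u :: "real^'n \<Rightarrow> 'b::real_normed_vector"
  assumes h: "bounded_linear h" and u: "test_fun u"
  shows "test_fun (\<lambda>x. h (u x))"
proof -
  obtain R where R: "\<And>x. x \<notin> cball 0 R \<Longrightarrow> u x = 0" using test_fun_support[OF u] by blast
  have "h 0 = 0" using h by (simp add: linear_simps(3))
  then have "{x. h (u x) \<noteq> 0} \<subseteq> cball 0 R" using R by force
  then have "compact (closure {x. h (u x) \<noteq> 0})"
    by (meson bounded_cball bounded_subset compact_closure)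
  then show ?thesis using u cont_diff_linear_comp[OF h] unfolding test_fun_def by blast
qed

lemma test_fun_mult:
  fixes \<phi> \<psi> :: "real^'n \<Rightarrow> real"
  assumes \<phi>: "test_fun \<phi>" and \<psi>: "\<And>k. cont_diff k \<psi>"
  shows "test_fun (\<lambda>x. \<phi> x * \<psi> x)"
proof -
  obtain R where R: "\<And>x. x \<notin> cball 0 R \<Longrightarrow> \<phi> x = 0" using test_fun_support[OF \<phi>] by blast
  have "{x. \<phi> x * \<psi> x \<noteq> 0} \<subseteq> cball 0 R" using R by force
  then have "compact (closure {x. \<phi> x * \<psi> x \<noteq> 0})"
    by (meson bounded_cball bounded_subset compact_closure)
  then show ?thesis
    using \<phi> \<psi> cont_diff_bilinear[OF bounded_bilinear_mult, where f = \<phi> and g = \<psi>]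
    unfolding test_fun_def by blast
qed

lemma partial_eq:
  assumes "(f has_derivative f') (at x)" shows "partial j f x = f' (axis j 1)"
  unfolding partial_def frechet_derivative_at[OF assms, symmetric] ..

lemma continuous_partial: "test_fun f \<Longrightarrow> continuous_on UNIV (partial j f)"
  unfolding partial_def by (rule test_fun_derivative(2))

lemma partial_outside_support:
  assumes "test_fun f" "\<And>x. x \<notin> cball z R \<Longrightarrow> f x = 0" "x \<notin> cball z R"
  shows "partial l f x = 0"
  unfolding partial_def
  by (rule derivative_outside_support[where z = z and R = R])
    (rule test_fun_derivative(1)[OF assms(1)], rule assms(2), assumption, rule assms(3))

lemma partial_commute:
  fixes f :: "real^'n \<Rightarrow> real"
  assumes "\<And>k. cont_diff k f" shows "partial j (partial k f) x = partial k (partial j f) x"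
proof -
  have f: "(f has_derivative frechet_derivative f (at x)) (at x)" for x
    by (rule cont_diff_derivative(1)) (rule assms)
  have c: "cont_diff i (\<lambda>x. frechet_derivative f (at x) v)" for i v
    by (rule cont_diff_derivative(2)) (rule assms)
  note cs = cont_diff_derivative[OF c]
  have c0: "continuous_on UNIV (\<lambda>x. frechet_derivative (\<lambda>x. frechet_derivative f (at x) v) (at x) w)" for v w
  proof -
    have "cont_diff 0 (\<lambda>x. frechet_derivative (\<lambda>x. frechet_derivative f (at x) v) (at x) w)" by (rule cs(2))
    then show ?thesis by simp
  qed
  show ?thesis unfolding partial_def[abs_def]
    by (rule mixed_partials_commute[OF f cs(1) cs(1) c0 c0])
qed

lemma cmod_power2_eq_Re_Im: "(cmod z)\<^sup>2 = Re z * Re z + Im z * Im z"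
  by (subst cmod_power2) (simp add: power2_eq_square)

lemma mag_grad_classical_components:
  assumes "test_fun u"
  shows "Re (mag_grad_classical a u x $ j) = partial j (\<lambda>x. Re (u x)) x + a x $ j * Im (u x)"
    and "Im (mag_grad_classical a u x $ j) = partial j (\<lambda>x. Im (u x)) x - a x $ j * Re (u x)"
proof -
  have D: "(u has_derivative frechet_derivative u (at x)) (at x)" by (rule test_fun_derivative(1)[OF assms])
  have "partial j (\<lambda>x. Re (u x)) x = Re (partial j u x)" "partial j (\<lambda>x. Im (u x)) x = Im (partial j u x)"
    using partial_eq[OF bounded_linear.has_derivative[OF bounded_linear_Re D], of j]
      partial_eq[OF bounded_linear.has_derivative[OF bounded_linear_Im D], of j]
    by (simp_all add: partial_def[of j u])
  then show "Re (mag_grad_classical a u x $ j) = partial j (\<lambda>x. Re (u x)) x + a x $ j * Im (u x)"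
    "Im (mag_grad_classical a u x $ j) = partial j (\<lambda>x. Im (u x)) x - a x $ j * Re (u x)"
    by (simp_all add: mag_grad_classical_def)
qed

text \<open>The pointwise inequality behind diamagnetism: since a is real, the zero order part of the
  magnetic gradient is orthogonal to u and does not contribute to the gradient of the modulus.
  The regularised modulus is differentiable at the zeros of u as well.\<close>

lemma diamagnetic:
  fixes u :: "real^'n \<Rightarrow> complex"
  assumes u: "test_fun u" and \<delta>: "0 < \<delta>"
  obtains g where "continuous_on UNIV g"
    "\<And>x. ((\<lambda>x. sqrt ((cmod (u x))\<^sup>2 + \<delta>\<^sup>2)) has_derivative (\<lambda>v. g x \<bullet> v)) (at x)"
    "\<And>x. norm (g x) \<le> norm (mag_grad_classical a u x)"
proof -
  define f where "f x = sqrt ((cmod (u x))\<^sup>2 + \<delta>\<^sup>2)" for x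
  define g where "g x = (\<chi> j. (u x \<bullet> partial j u x) / f x)" for x
  have f0: "0 < f x" for x using \<delta> by (simp add: f_def add_nonneg_pos)
  have fu: "cmod (u x) \<le> f x" for x
    unfolding f_def by (rule real_le_rsqrt) simp
  have uc: "continuous_on UNIV u" by (rule test_fun_derivative(3)[OF u])
  have fc: "continuous_on UNIV f" unfolding f_def by (intro continuous_intros uc)
  have "continuous_on UNIV g"
    unfolding g_def using f0
    by (intro continuous_on_vec_lambda continuous_on_divide continuous_on_inner uc fc continuous_partial u)
      (auto simp: less_imp_neq[symmetric])
  moreover have "(f has_derivative (\<lambda>v. g x \<bullet> v)) (at x)" for x
  proof -
    have D: "(u has_derivative frechet_derivative u (at x)) (at x)" by (rule test_fun_derivative(1)[OF u])
    have sqD: "((\<lambda>x. u x \<bullet> u x + \<delta>\<^sup>2) has_derivative (\<lambda>v. 2 * (u x \<bullet> frechet_derivative u (at x) v))) (at x)"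
      by (rule derivative_eq_intros D refl)+ (simp add: inner_commute)
    have eq: "u x \<bullet> u x + \<delta>\<^sup>2 = (cmod (u x))\<^sup>2 + \<delta>\<^sup>2" for x by (simp only: power2_norm_eq_inner)
    have pos: "0 < u x \<bullet> u x + \<delta>\<^sup>2" using \<delta> by (simp add: add_nonneg_pos)
    have "((\<lambda>x. sqrt (u x \<bullet> u x + \<delta>\<^sup>2)) has_derivative
        (\<lambda>v. 2 * (u x \<bullet> frechet_derivative u (at x) v) * (inverse (sqrt (u x \<bullet> u x + \<delta>\<^sup>2)) / 2))) (at x)"
      by (rule has_derivative_real_sqrt[OF pos sqD])
    moreover have "f = (\<lambda>x. sqrt (u x \<bullet> u x + \<delta>\<^sup>2))" by (rule ext) (simp only: eq f_def)
    ultimately have "(f has_derivative (\<lambda>v. 2 * (u x \<bullet> frechet_derivative u (at x) v) * (inverse (f x) / 2))) (at x)"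
      by simp
    moreover have "2 * (u x \<bullet> frechet_derivative u (at x) v) * (inverse (f x) / 2) = g x \<bullet> v" for v
    proof -
      have gv: "g x \<bullet> v = (u x \<bullet> frechet_derivative u (at x) v) / f x"
      proof -
        have "g x \<bullet> v = (\<Sum>l\<in>UNIV. (v $ l * (u x \<bullet> partial l u x)) / f x)"
          unfolding inner_vec_def by (rule sum.cong) (simp_all add: g_def)
        also have "\<dots> = (\<Sum>l\<in>UNIV. v $ l * (u x \<bullet> partial l u x)) / f x"
          by (rule sum_divide_distrib[symmetric])
        also have "(\<Sum>l\<in>UNIV. v $ l * (u x \<bullet> partial l u x)) = u x \<bullet> frechet_derivative u (at x) v"
          unfolding derivative_eq_sum_partial[OF D, of v] by (simp only: inner_sum_right inner_scaleR_right)
        finally show ?thesis .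
      qed
      have arith: "2 * c * (inverse d / 2) = c / d" for c d :: real by (cases "d = 0") (simp_all add: field_simps)
      show ?thesis unfolding gv by (rule arith)
    qed
    ultimately show ?thesis by simp
  qed
  moreover have "norm (g x) \<le> norm (mag_grad_classical a u x)" for x
  proof (rule norm_le_componentwise_cart)
    fix j
    have "u x \<bullet> partial j u x = u x \<bullet> (mag_grad_classical a u x $ j)"
      by (simp add: mag_grad_classical_def inner_complex_def algebra_simps)
    also have "\<bar>\<dots>\<bar> \<le> cmod (u x) * cmod (mag_grad_classical a u x $ j)" by (rule Cauchy_Schwarz_ineq2)
    also have "\<dots> \<le> f x * cmod (mag_grad_classical a u x $ j)" by (intro mult_right_mono fu) auto
    finally show "norm (g x $ j) \<le> norm (mag_grad_classical a u x $ j)"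
      using f0[of x] by (simp add: g_def pos_divide_le_eq mult.commute)
  qed
  ultimately show thesis using that unfolding f_def by blast
qed

lemma loc_L2_component:
  assumes "loc_Lp 2 (a :: real^'n \<Rightarrow> real^'m)"
  shows "loc_integrable (\<lambda>x. a x $ j)"
    and "loc_integrable (\<lambda>x. (norm (a x))\<^sup>2)"
proof -
  have m[measurable]: "a \<in> borel_measurable lebesgue" using assms by (simp add: loc_Lp_def)
  show 2: "loc_integrable (\<lambda>x. (norm (a x))\<^sup>2)"
    using assms unfolding loc_Lp_def loc_integrable_def by (simp add: powr_numeral)
  have mj: "(\<lambda>x. a x $ j) \<in> borel_measurable lebesgue"
    by (rule borel_measurable_continuous_on[OF linear_continuous_on[OF bounded_linear_vec_nth] m])
  show "loc_integrable (\<lambda>x. a x $ j)"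
  proof (rule loc_integrableI[OF mj])
    fix R
    have 1: "integrable lebesgue (\<lambda>x :: real^'n. indicator (cball 0 R) x *\<^sub>R (1::real))"
      by (rule loc_integrable_cball[OF loc_integrable_continuous]) simp
    show "integrable lebesgue (\<lambda>x. indicator (cball 0 R) x *\<^sub>R a x $ j)"
    proof (rule Bochner_Integration.integrable_bound[OF Bochner_Integration.integrable_add[OF 1 loc_integrable_cball[OF 2, of 0 R]]])
      show "(\<lambda>x. indicat_real (cball 0 R) x *\<^sub>R a x $ j) \<in> borel_measurable lebesgue"
        by (intro borel_measurable_scaleR mj borel_measurable_indicator) auto
      have "\<bar>v $ j\<bar> \<le> 1 + (norm v)\<^sup>2" for v :: "real^'m"
      proof -
        have "\<bar>v $ j\<bar> \<le> norm v" by (rule component_le_norm_cart)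
        moreover have "2 * norm v \<le> (norm v)\<^sup>2 + 1"
          using zero_le_power2[of "norm v - 1"] by (simp add: power2_diff)
        ultimately show ?thesis using norm_ge_zero[of v] by linarith
      qed
      note key = this
      show "AE x in lebesgue. norm (indicat_real (cball 0 R) x *\<^sub>R a x $ j)
        \<le> norm (indicat_real (cball 0 R) x *\<^sub>R 1 + indicat_real (cball 0 R) x *\<^sub>R (norm (a x))\<^sup>2)"
      proof (intro AE_I2)
        fix x
        have "0 \<le> 1 + (norm (a x))\<^sup>2" by simp
        then show "norm (indicat_real (cball 0 R) x *\<^sub>R a x $ j)
          \<le> norm (indicat_real (cball 0 R) x *\<^sub>R 1 + indicat_real (cball 0 R) x *\<^sub>R (norm (a x))\<^sup>2)"
          using key[of "a x"] by (simp add: indicator_def)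
      qed
    qed
  qed
qed

text \<open>The magnetic field is the commutator of two components of the magnetic gradient, so that its pairing
  with a localised density of u contains, after integration by parts, first order terms only. For real
  and imaginary parts this is the algebraic identity \<open>T_eq\<close>: the two curl terms are derivatives of
  test functions and integrate to zero, and what is left is the weak definition of the field.\<close>

lemma magnetic_field_by_parts:
  fixes u :: "real^'n \<Rightarrow> complex" and a :: "real^'n \<Rightarrow> real^'n" and \<phi> :: "real^'n \<Rightarrow> real"
    and B :: "real^'n \<Rightarrow> real^'n^'n" and j k :: 'n and x :: "real^'n"
  assumes a: "loc_Lp 2 a" and B: "has_magnetic_field a B" and u: "test_fun u" and \<phi>: "test_fun \<phi>"
  defines "D \<equiv> mag_grad_classical a u"
  defines "T \<equiv> \<lambda>x. 2 * \<phi> x * (Im (D x $ j) * Re (D x $ k) - Re (D x $ j) * Im (D x $ k))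
      + partial j \<phi> x * (Im (u x) * Re (D x $ k) - Re (u x) * Im (D x $ k))
      - partial k \<phi> x * (Im (u x) * Re (D x $ j) - Re (u x) * Im (D x $ j))"
  shows "test_fun (\<lambda>x. \<phi> x * (cmod (u x))\<^sup>2)" and "integrable lebesgue T"
    and "(LINT x|lebesgue. \<phi> x * (cmod (u x))\<^sup>2 * B x $ j $ k) = (LINT x|lebesgue. T x)"
    and "\<bar>T x\<bar> \<le> 2 * \<bar>\<phi> x\<bar> * (norm (D x))\<^sup>2 + (\<bar>partial j \<phi> x\<bar> + \<bar>partial k \<phi> x\<bar>) * (cmod (u x) * norm (D x))"
proof -
  define p where "p x = Re (u x)" for x
  define q where "q x = Im (u x)" for x
  define X where "X l x = partial l p x + a x $ l * q x" for l x
  define Y where "Y l x = partial l q x - a x $ l * p x" for l x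
  have pT: "test_fun p" and qT: "test_fun q"
    unfolding p_def[abs_def] q_def[abs_def]
    by (rule test_fun_linear[OF bounded_linear_Re u], rule test_fun_linear[OF bounded_linear_Im u])
  have pS: "cont_diff i p" and qS: "cont_diff i q" for i
    using pT qT \<phi> by (auto simp: test_fun_def)
  have sq: "(cmod (u x))\<^sup>2 = p x * p x + q x * q x" for x by (simp add: p_def q_def cmod_power2_eq_Re_Im)
  have DX: "Re (D x $ l) = X l x" "Im (D x $ l) = Y l x" for x l
    using mag_grad_classical_components[OF u, of a x l] by (simp_all add: D_def X_def Y_def p_def[abs_def] q_def[abs_def])
  note mult = cont_diff_bilinear[OF bounded_bilinear_mult]
  define \<psi> where "\<psi> x = \<phi> x * (p x * p x + q x * q x)" for x
  have \<psi>T: "test_fun \<psi>"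
    unfolding \<psi>_def[abs_def] by (intro test_fun_mult \<phi> cont_diff_add mult pS qS)
  then show "test_fun (\<lambda>x. \<phi> x * (cmod (u x))\<^sup>2)" by (simp add: sq \<psi>_def[abs_def])
  have der: "(f has_derivative frechet_derivative f (at x)) (at x)" if "test_fun f" for f :: "real^'n \<Rightarrow> real" and x
    by (rule test_fun_derivative(1)[OF that])
  have pd: "partial l f x = frechet_derivative f (at x) (axis l 1)" for l and f :: "real^'n \<Rightarrow> real" and x
    by (simp add: partial_def)
  have \<psi>': "partial l \<psi> x = partial l \<phi> x * (p x * p x + q x * q x)
      + 2 * \<phi> x * (p x * partial l p x + q x * partial l q x)" for l x
  proof -
    have "(\<psi> has_derivative (\<lambda>v. \<phi> x * (2 * p x * frechet_derivative p (at x) v + 2 * q x * frechet_derivative q (at x) v)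
      + frechet_derivative \<phi> (at x) v * (p x * p x + q x * q x))) (at x)"
      unfolding \<psi>_def[abs_def]
      by (rule derivative_eq_intros der \<phi> pT qT refl)+ (simp add: algebra_simps)
    from partial_eq[OF this] show ?thesis by (simp add: pd algebra_simps)
  qed
  define F where "F l x = \<phi> x * (q x * partial l p x - p x * partial l q x)" for l x
  have partS: "cont_diff i (partial l f)" if "\<And>i. cont_diff i f" for i l and f :: "real^'n \<Rightarrow> real"
    unfolding partial_def[abs_def] by (rule cont_diff_derivative(2)) (rule that)
  have FT: "test_fun (F l)" for l
    unfolding F_def[abs_def] by (intro test_fun_mult \<phi> cont_diff_diff mult pS qS partS)
  have F': "partial i (F l) x = partial i \<phi> x * (q x * partial l p x - p x * partial l q x)
      + \<phi> x * (partial i q x * partial l p x + q x * partial i (partial l p) x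
          - partial i p x * partial l q x - p x * partial i (partial l q) x)" for i l x
  proof -
    have d2: "(partial l f has_derivative frechet_derivative (partial l f) (at x)) (at x)"
      if "\<And>i. cont_diff i f" for f :: "real^'n \<Rightarrow> real"
      by (rule cont_diff_derivative(1)) (rule partS[OF that])
    have "(F l has_derivative (\<lambda>v. \<phi> x * (q x * frechet_derivative (partial l p) (at x) v + frechet_derivative q (at x) v * partial l p x
        - (p x * frechet_derivative (partial l q) (at x) v + frechet_derivative p (at x) v * partial l q x))
      + frechet_derivative \<phi> (at x) v * (q x * partial l p x - p x * partial l q x))) (at x)"
      unfolding F_def[abs_def]
      by (rule derivative_eq_intros der \<phi> pT qT d2 pS qS refl)+
    from partial_eq[OF this] show ?thesis by (simp add: pd algebra_simps)
  qed
  have zero: "(LINT x|lebesgue. partial i (F l) x) = 0" and Fint: "integrable lebesgue (partial i (F l))" for i l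
  proof -
    obtain R where R: "\<And>x. x \<notin> cball 0 R \<Longrightarrow> F l x = 0" using test_fun_support[OF FT[of l]] by blast
    show "(LINT x|lebesgue. partial i (F l) x) = 0"
      unfolding partial_def
      by (rule integral_derivative_eq_0[OF der[OF FT] _ R]) (auto intro: test_fun_derivative(2) FT)
    have "partial i (F l) x = 0" if "x \<notin> cball 0 R" for x
      by (rule partial_outside_support[OF FT R that])
    then show "integrable lebesgue (partial i (F l))"
      by (rule integrable_compact_support[OF continuous_partial[OF FT]])
  qed
  have T_eq: "T x = - (partial k \<psi> x * a x $ j - partial j \<psi> x * a x $ k)
      + (partial j (F k) x - partial k (F j) x)" for x
    unfolding T_def DX \<psi>' F' X_def Y_def partial_commute[OF pS, of k j] partial_commute[OF qS, of k j]
    unfolding p_def[symmetric] q_def[symmetric]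
    by (simp add: algebra_simps)
  have aint: "integrable lebesgue (\<lambda>x. partial i \<psi> x * a x $ l)" for i l
  proof -
    obtain R where R: "\<And>x. x \<notin> cball 0 R \<Longrightarrow> \<psi> x = 0" using test_fun_support[OF \<psi>T] by blast
    have "partial i \<psi> x = 0" if "x \<notin> cball 0 R" for x
      by (rule partial_outside_support[OF \<psi>T R that])
    then show ?thesis
      using integrable_compact_support_mult[OF loc_L2_component(1)[OF a, of l] continuous_partial[OF \<psi>T], of 0 R i]
      by simp
  qed
  show "integrable lebesgue T"
    unfolding T_eq[abs_def]
    by (intro Bochner_Integration.integrable_add Bochner_Integration.integrable_diff integrable_minus aint Fint)
  have "(LINT x|lebesgue. \<psi> x * B x $ j $ k) = - (LINT x|lebesgue. partial k \<psi> x * a x $ j - partial j \<psi> x * a x $ k)"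
    using B \<psi>T unfolding has_magnetic_field_def by blast
  also have "\<dots> = (LINT x|lebesgue. T x)"
    unfolding T_eq[abs_def] using aint Fint zero by simp
  finally show "(LINT x|lebesgue. \<phi> x * (cmod (u x))\<^sup>2 * B x $ j $ k) = (LINT x|lebesgue. T x)"
    by (simp add: \<psi>_def sq)
  have cross: "\<bar>Im z * Re w - Re z * Im w\<bar> \<le> cmod z * cmod w" for z w :: complex
  proof -
    have "Im z * Re w - Re z * Im w = Im (z * cnj w)" by simp
    then show ?thesis using abs_Im_le_cmod[of "z * cnj w"] by (simp add: norm_mult)
  qed
  have Dl: "cmod (D x $ l) \<le> norm (D x)" for l
    by (rule Finite_Cartesian_Product.norm_nth_le)
  have "\<bar>Im (D x $ j) * Re (D x $ k) - Re (D x $ j) * Im (D x $ k)\<bar> \<le> norm (D x) * norm (D x)"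
    by (rule order_trans[OF cross mult_mono]) (auto intro: Dl)
  then have 1: "\<bar>2 * \<phi> x * (Im (D x $ j) * Re (D x $ k) - Re (D x $ j) * Im (D x $ k))\<bar> \<le> 2 * \<bar>\<phi> x\<bar> * (norm (D x))\<^sup>2"
    unfolding abs_mult power2_eq_square by (simp add: mult_left_mono)
  have 2: "\<bar>partial i \<phi> x * (Im (u x) * Re (D x $ l) - Re (u x) * Im (D x $ l))\<bar>
      \<le> \<bar>partial i \<phi> x\<bar> * (cmod (u x) * norm (D x))" for i l
    unfolding abs_mult
    by (intro mult_left_mono order_trans[OF cross mult_left_mono]) (auto intro: Dl)
  show "\<bar>T x\<bar> \<le> 2 * \<bar>\<phi> x\<bar> * (norm (D x))\<^sup>2 + (\<bar>partial j \<phi> x\<bar> + \<bar>partial k \<phi> x\<bar>) * (cmod (u x) * norm (D x))"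
    unfolding T_def distrib_right using 1 2[of j k] 2[of k j] by linarith
qed

section \<open>The local energy estimate\<close>

lemma norm_vec_power2: "(norm (v :: 'a::real_normed_vector ^ 'n))\<^sup>2 = (\<Sum>j\<in>UNIV. (norm (v $ j))\<^sup>2)"
  by (simp add: norm_vec_def L2_set_def sum_nonneg)

lemma integrable_test_square:
  assumes u: "test_fun (u :: real^'n \<Rightarrow> complex)" and h: "loc_integrable (h :: real^'n \<Rightarrow> real)"
  shows "integrable lebesgue (\<lambda>x. h x * (cmod (u x))\<^sup>2)"
proof -
  obtain R where R: "\<And>x. x \<notin> cball 0 R \<Longrightarrow> u x = 0" using test_fun_support[OF u] by blast
  have "integrable lebesgue (\<lambda>x. (cmod (u x))\<^sup>2 *\<^sub>R h x)"
    by (rule integrable_compact_support_mult[OF h, of _ 0 R])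
      (auto intro!: continuous_intros test_fun_derivative(3)[OF u] simp: R)
  then show ?thesis by (simp add: mult.commute)
qed

lemma loc_integrable_const: "loc_integrable (\<lambda>x :: real^'n. c :: real)"
  by (rule loc_integrable_continuous) simp

lemma integrable_mag_grad_classical:
  fixes u :: "real^'n \<Rightarrow> complex" and a :: "real^'n \<Rightarrow> real^'n"
  assumes u: "test_fun u" and a: "loc_Lp 2 a"
  shows "integrable lebesgue (\<lambda>x. (norm (mag_grad_classical a u x))\<^sup>2)"
proof -
  define p where "p = (\<lambda>x. Re (u x))"
  define q where "q = (\<lambda>x. Im (u x))"
  have pT: "test_fun p" and qT: "test_fun q"
    unfolding p_def q_def
    by (rule test_fun_linear[OF bounded_linear_Re u], rule test_fun_linear[OF bounded_linear_Im u])
  have eq: "(norm (mag_grad_classical a u x))\<^sup>2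
      = (\<Sum>j\<in>UNIV. (partial j p x + a x $ j * q x)\<^sup>2 + (partial j q x - a x $ j * p x)\<^sup>2)" for x
    unfolding norm_vec_power2
    by (simp add: cmod_power2 mag_grad_classical_components[OF u] p_def q_def)
  have one: "integrable lebesgue (\<lambda>x. (partial j f x + a x $ j * g x)\<^sup>2)"
    if f: "test_fun f" and g: "test_fun g" for f g :: "real^'n \<Rightarrow> real" and j
  proof -
    obtain R1 where R1: "\<And>x. x \<notin> cball 0 R1 \<Longrightarrow> f x = 0" using test_fun_support[OF f] by blast
    obtain R2 where R2: "\<And>x. x \<notin> cball 0 R2 \<Longrightarrow> g x = 0" using test_fun_support[OF g] by blast
    have 1: "integrable lebesgue (\<lambda>x. (partial j f x)\<^sup>2)"
      by (rule integrable_compact_support[of _ 0 R1])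
        (auto intro!: continuous_intros continuous_partial f partial_outside_support[OF f R1])
    have 2: "integrable lebesgue (\<lambda>x. (g x)\<^sup>2 *\<^sub>R (norm (a x))\<^sup>2)"
      by (rule integrable_compact_support_mult[OF loc_L2_component(2)[OF a], of _ 0 R2])
        (auto intro!: continuous_intros test_fun_derivative(3)[OF g] simp: R2)
    show ?thesis
    proof (rule Bochner_Integration.integrable_bound[OF integrable_mult_right[OF Bochner_Integration.integrable_add[OF 1 2], of 2]])
      show "(\<lambda>x. (partial j f x + a x $ j * g x)\<^sup>2) \<in> borel_measurable lebesgue"
        by (intro borel_measurable_power borel_measurable_add borel_measurable_times
            loc_integrable_measurable[OF loc_L2_component(1)[OF a]] continuous_imp_lebesgue_measurable
            continuous_partial f test_fun_derivative(3)[OF g])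
      show "AE x in lebesgue. norm ((partial j f x + a x $ j * g x)\<^sup>2)
          \<le> norm (2 * ((partial j f x)\<^sup>2 + (g x)\<^sup>2 *\<^sub>R (norm (a x))\<^sup>2))"
      proof (intro AE_I2)
        fix x
        have "(s + t)\<^sup>2 \<le> 2 * (s\<^sup>2 + t\<^sup>2)" for s t :: real
          using zero_le_power2[of "s - t"] by (simp add: power2_eq_square algebra_simps)
        note this[of "partial j f x" "a x $ j * g x"]
        also have "(a x $ j * g x)\<^sup>2 \<le> (g x)\<^sup>2 * (norm (a x))\<^sup>2"
          unfolding power_mult_distrib mult.commute[of "(a x $ j)\<^sup>2"]
          by (intro mult_left_mono) (auto simp: abs_le_square_iff[symmetric] component_le_norm_cart)
        finally show "norm ((partial j f x + a x $ j * g x)\<^sup>2)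
          \<le> norm (2 * ((partial j f x)\<^sup>2 + (g x)\<^sup>2 *\<^sub>R (norm (a x))\<^sup>2))"
          by simp
      qed
    qed
  qed
  have mp: "test_fun (\<lambda>x. - p x)" by (rule test_fun_linear[OF _ pT]) (simp add: bounded_linear_minus bounded_linear_ident)
  show ?thesis
    unfolding eq using one[OF pT qT] one[OF qT mp] by (intro Bochner_Integration.integrable_sum Bochner_Integration.integrable_add) auto
qed

lemma set_integrable_ball:
  "integrable lebesgue f \<Longrightarrow> integrable lebesgue (\<lambda>x. indicator (ball (x0 :: real^'n) r) x * (f x :: real))"
  using integrable_mult_indicator[of "ball x0 r" lebesgue f] by simp

lemma nn_integral_ball_eq:
  assumes "integrable lebesgue (\<lambda>x. indicator D x * f x)" "AE x in lebesgue. x \<in> D \<longrightarrow> 0 \<le> f x"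
  shows "(\<integral>\<^sup>+x. ennreal (f x) * indicator D x \<partial>lebesgue) = ennreal (LINT x:D|lebesgue. f x)"
proof -
  have "(\<integral>\<^sup>+x. ennreal (f x) * indicator D x \<partial>lebesgue) = (\<integral>\<^sup>+x. ennreal (indicator D x * f x) \<partial>lebesgue)"
    by (intro nn_integral_cong) (auto simp: indicator_def)
  also have "\<dots> = ennreal (LINT x:D|lebesgue. f x)"
    unfolding set_lebesgue_integral_def real_scaleR_def
  proof (rule nn_integral_eq_integral[OF assms(1)])
    show "AE x in lebesgue. 0 \<le> indicat_real D x * f x"
      using assms(2) by eventually_elim (auto simp: indicator_def)
  qed
  finally show ?thesis .
qed

text \<open>Multiplying \<open>f(x)\<^sup>2 \<le> 2 (f(x) - f(y))\<^sup>2 + 2 f(y)\<^sup>2\<close> by h(y) and integrating over both variables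
  reduces the claim to the Poincare inequality for f, the regularised modulus of u; the diamagnetic
  inequality replaces its gradient by the magnetic gradient, and the regularisation tends to zero.\<close>

lemma weighted_poincare:
  fixes u :: "real^'n \<Rightarrow> complex" and a :: "real^'n \<Rightarrow> real^'n" and h :: "real^'n \<Rightarrow> real"
  assumes u: "test_fun u" and a: "loc_Lp 2 a" and h: "loc_integrable h" and \<rho>: "0 < \<rho>"
    and hH: "AE x in lebesgue. x \<in> ball x0 \<rho> \<longrightarrow> 0 \<le> h x \<and> h x \<le> H" and H: "0 \<le> H"
  defines "D \<equiv> ball x0 \<rho>"
  shows "(LINT x:D|lebesgue. h x) * (LINT x:D|lebesgue. (cmod (u x))\<^sup>2)
    \<le> 2 * H * (4 * \<rho>\<^sup>2 * 2 ^ CARD('n)) * measure lebesgue D * (LINT x:D|lebesgue. (norm (mag_grad_classical a u x))\<^sup>2)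
      + 2 * measure lebesgue D * (LINT x:D|lebesgue. h x * (cmod (u x))\<^sup>2)"
proof -
  define I where "I = (LINT x:D|lebesgue. h x)"
  define U where "U = (LINT x:D|lebesgue. (cmod (u x))\<^sup>2)"
  define N where "N = (LINT x:D|lebesgue. (norm (mag_grad_classical a u x))\<^sup>2)"
  define W where "W = (LINT x:D|lebesgue. h x * (cmod (u x))\<^sup>2)"
  define m where "m = measure lebesgue D"
  define P where "P = 2 * H * (4 * \<rho>\<^sup>2 * 2 ^ CARD('n)) * m * N"
  have m: "0 < m" using content_ball_pos[OF \<rho>, of x0] by (simp add: m_def D_def)
  have em: "emeasure lborel D = ennreal m" "emeasure lebesgue D = ennreal m"
  proof -
    have "emeasure lborel (ball x0 \<rho>) \<noteq> top" using emeasure_lborel_ball_finite[of x0 \<rho>] by auto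
    from emeasure_eq_ennreal_measure[OF this] show "emeasure lborel D = ennreal m" "emeasure lebesgue D = ennreal m"
      by (simp_all add: m_def D_def)
  qed
  have [measurable]: "D \<in> sets lebesgue" "D \<in> sets borel" by (simp_all add: D_def)
  have hm[measurable]: "h \<in> borel_measurable lebesgue" by (rule loc_integrable_measurable[OF h])
  have int_h: "integrable lebesgue (\<lambda>x. indicator D x * h x)"
    using loc_integrable_subset_ball[OF h, of D x0 \<rho>] by (simp add: D_def set_integrable_def)
  have int_1: "integrable lebesgue (\<lambda>x. indicator D x * (1 :: real))"
    using loc_integrable_subset_ball[OF loc_integrable_const[of 1], of D x0 \<rho>] by (simp add: D_def set_integrable_def)
  have int_u: "integrable lebesgue (\<lambda>x. indicator D x * (cmod (u x))\<^sup>2)"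
    unfolding D_def using integrable_test_square[OF u loc_integrable_const[of 1]] by (intro set_integrable_ball) simp
  have int_hu: "integrable lebesgue (\<lambda>x. indicator D x * (h x * (cmod (u x))\<^sup>2))"
    unfolding D_def by (intro set_integrable_ball integrable_test_square u h)
  have int_N: "integrable lebesgue (\<lambda>x. indicator D x * (norm (mag_grad_classical a u x))\<^sup>2)"
    unfolding D_def by (intro set_integrable_ball integrable_mag_grad_classical u a)
  have hD: "AE x in lebesgue. x \<in> D \<longrightarrow> 0 \<le> h x \<and> h x \<le> H" using hH by (simp add: D_def)
  have hD0: "AE x in lebesgue. x \<in> D \<longrightarrow> 0 \<le> h x" using hD by eventually_elim blast
  have "AE x in lebesgue. 0 \<le> indicat_real D x *\<^sub>R h x"
    using hD0 by eventually_elim (simp add: indicator_def)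
  then have I0: "0 \<le> I" unfolding I_def set_lebesgue_integral_def by (rule integral_nonneg_AE)
  have "AE x in lebesgue. 0 \<le> indicat_real D x *\<^sub>R (h x * (cmod (u x))\<^sup>2)"
    using hD0 by eventually_elim (simp add: indicator_def)
  then have W0: "0 \<le> W" unfolding W_def set_lebesgue_integral_def by (rule integral_nonneg_AE)
  have U0: "0 \<le> U" and N0: "0 \<le> N" unfolding U_def N_def set_lebesgue_integral_def
    by (intro integral_nonneg_AE, simp)+
  have step: "I * U \<le> P + 2 * m * W + \<delta>\<^sup>2 * (2 * m * I)" if \<delta>: "0 < \<delta>" for \<delta>
  proof -
    define f where "f = (\<lambda>x. sqrt ((cmod (u x))\<^sup>2 + \<delta>\<^sup>2))"
    obtain g where g: "continuous_on UNIV g" "\<And>x. (f has_derivative (\<lambda>v. g x \<bullet> v)) (at x)"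
      "\<And>x. norm (g x) \<le> norm (mag_grad_classical a u x)"
      using diamagnetic[OF u \<delta>, of a] unfolding f_def by blast
    have f2: "(f x)\<^sup>2 = (cmod (u x))\<^sup>2 + \<delta>\<^sup>2" for x by (simp add: f_def)
    have fc: "continuous_on UNIV f"
      by (intro continuous_at_imp_continuous_on ballI has_derivative_continuous[OF g(2)])
    have fb[measurable]: "f \<in> borel_measurable borel" using fc by (simp add: borel_measurable_continuous_onI)
    have [measurable]: "f \<in> borel_measurable lebesgue" by (rule continuous_imp_lebesgue_measurable[OF fc])
    have "(\<integral>\<^sup>+x. ennreal ((f x)\<^sup>2) * indicator D x \<partial>lebesgue) = ennreal (U + \<delta>\<^sup>2 * m)"
    proof -
      have "(LINT x:D|lebesgue. (f x)\<^sup>2) = U + \<delta>\<^sup>2 * m"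
      proof -
        have "(LINT x:D|lebesgue. (f x)\<^sup>2) = (LINT x|lebesgue. indicator D x * (cmod (u x))\<^sup>2 + \<delta>\<^sup>2 * (indicator D x * 1))"
          unfolding set_lebesgue_integral_def by (intro Bochner_Integration.integral_cong) (auto simp: f2 algebra_simps)
        also have "\<dots> = U + \<delta>\<^sup>2 * m"
          using int_u int_1 by (simp add: U_def m_def set_lebesgue_integral_def)
        finally show ?thesis .
      qed
      moreover have "integrable lebesgue (\<lambda>x. indicator D x * (f x)\<^sup>2)"
      proof -
        have "integrable lebesgue (\<lambda>x. indicator D x * (cmod (u x))\<^sup>2 + \<delta>\<^sup>2 * (indicator D x * 1))"
          by (intro Bochner_Integration.integrable_add integrable_mult_right int_u int_1)
        then show ?thesis by (simp add: f2 algebra_simps)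
      qed
      ultimately show ?thesis by (subst nn_integral_ball_eq) auto
    qed
    note F = this
    have Hn: "(\<integral>\<^sup>+y. ennreal (h y) * indicator D y \<partial>lebesgue) = ennreal I"
      unfolding I_def by (rule nn_integral_ball_eq[OF int_h hD0])
    have HF: "(\<integral>\<^sup>+y. ennreal (h y * (f y)\<^sup>2) * indicator D y \<partial>lebesgue) = ennreal (W + \<delta>\<^sup>2 * I)"
    proof -
      have "(LINT x:D|lebesgue. h x * (f x)\<^sup>2)
          = (LINT x|lebesgue. indicator D x * (h x * (cmod (u x))\<^sup>2) + \<delta>\<^sup>2 * (indicator D x * h x))"
        unfolding set_lebesgue_integral_def by (intro Bochner_Integration.integral_cong) (auto simp: f2 algebra_simps)
      also have "\<dots> = W + \<delta>\<^sup>2 * I"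
        using int_hu int_h by (simp add: W_def I_def set_lebesgue_integral_def)
      finally have eq: "(LINT x:D|lebesgue. h x * (f x)\<^sup>2) = W + \<delta>\<^sup>2 * I" .
      have "integrable lebesgue (\<lambda>x. indicator D x * (h x * (cmod (u x))\<^sup>2) + \<delta>\<^sup>2 * (indicator D x * h x))"
        by (intro Bochner_Integration.integrable_add integrable_mult_right int_hu int_h)
      then have "integrable lebesgue (\<lambda>x. indicator D x * (h x * (f x)\<^sup>2))" by (simp add: f2 algebra_simps)
      moreover have "AE x in lebesgue. x \<in> D \<longrightarrow> 0 \<le> h x * (f x)\<^sup>2"
        using hD0 by eventually_elim simp
      ultimately show ?thesis
        unfolding eq[symmetric] by (rule nn_integral_ball_eq)
    qed
    define Q where "Q x y = ennreal ((f x - f y)\<^sup>2) * indicator D x * indicator D y" for x y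
    have Qb[measurable]: "(\<lambda>y. Q x y) \<in> borel_measurable borel" for x unfolding Q_def by measurable
    have Ql[measurable]: "(\<lambda>y. Q x y) \<in> borel_measurable lebesgue" for x unfolding Q_def by measurable
    have Qi[measurable]: "(\<lambda>x. \<integral>\<^sup>+y. Q x y \<partial>lborel) \<in> borel_measurable borel"
      unfolding Q_def by measurable
    have Qi'[measurable]: "(\<lambda>x. \<integral>\<^sup>+y. Q x y \<partial>lborel) \<in> borel_measurable lebesgue"
      by (rule measurable_completion) simp
    have inner: "ennreal ((f x)\<^sup>2) * indicator D x * ennreal I
        \<le> ennreal (2 * H) * (\<integral>\<^sup>+y. Q x y \<partial>lborel) + 2 * ennreal (W + \<delta>\<^sup>2 * I) * indicator D x" for x
    proof (cases "x \<in> D")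
      case True
      have "ennreal ((f x)\<^sup>2) * ennreal I = (\<integral>\<^sup>+y. ennreal ((f x)\<^sup>2) * (ennreal (h y) * indicator D y) \<partial>lebesgue)"
        unfolding Hn[symmetric] by (subst nn_integral_cmult) auto
      also have "\<dots> \<le> (\<integral>\<^sup>+y. ennreal (2 * H) * Q x y + 2 * (ennreal (h y * (f y)\<^sup>2) * indicator D y) \<partial>lebesgue)"
      proof (rule nn_integral_mono_AE, use hD in eventually_elim)
        case (elim y)
        show ?case
        proof (cases "y \<in> D")
          case yD: True
          then have hy: "0 \<le> h y" "h y \<le> H" using elim by auto
          have "(f x)\<^sup>2 \<le> 2 * (f x - f y)\<^sup>2 + 2 * (f y)\<^sup>2"
            using zero_le_power2[of "f x - 2 * f y"] by (simp add: power2_eq_square algebra_simps)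
          then have "(f x)\<^sup>2 * h y \<le> (2 * (f x - f y)\<^sup>2 + 2 * (f y)\<^sup>2) * h y"
            using hy by (intro mult_right_mono)
          also have "\<dots> \<le> 2 * H * (f x - f y)\<^sup>2 + 2 * (h y * (f y)\<^sup>2)"
            using mult_right_mono[OF hy(2), of "2 * (f x - f y)\<^sup>2"] by (simp add: algebra_simps)
          finally have "ennreal ((f x)\<^sup>2 * h y) \<le> ennreal (2 * H * (f x - f y)\<^sup>2 + 2 * (h y * (f y)\<^sup>2))"
            by (rule ennreal_leI)
          then show ?thesis
            using True yD hy H by (simp add: Q_def ennreal_mult)
        qed simp
      qed
      also have "\<dots> = ennreal (2 * H) * (\<integral>\<^sup>+y. Q x y \<partial>lebesgue) + 2 * ennreal (W + \<delta>\<^sup>2 * I)"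
        by (subst nn_integral_add) (auto simp: nn_integral_cmult HF)
      finally show ?thesis using True by (simp add: nn_integral_completion)
    qed simp
    have "ennreal ((U + \<delta>\<^sup>2 * m) * I) = (\<integral>\<^sup>+x. ennreal ((f x)\<^sup>2) * indicator D x * ennreal I \<partial>lebesgue)"
      using U0 m I0 by (subst nn_integral_multc) (auto simp: F ennreal_mult)
    also have "\<dots> \<le> (\<integral>\<^sup>+x. ennreal (2 * H) * (\<integral>\<^sup>+y. Q x y \<partial>lborel) + 2 * ennreal (W + \<delta>\<^sup>2 * I) * indicator D x \<partial>lebesgue)"
      by (intro nn_integral_mono inner)
    also have "\<dots> = ennreal (2 * H) * (\<integral>\<^sup>+x. \<integral>\<^sup>+y. Q x y \<partial>lborel \<partial>lborel) + 2 * ennreal (W + \<delta>\<^sup>2 * I) * ennreal m"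
      by (subst nn_integral_add) (auto simp: nn_integral_cmult em nn_integral_completion)
    also have "(\<integral>\<^sup>+x. \<integral>\<^sup>+y. Q x y \<partial>lborel \<partial>lborel)
        \<le> ennreal (4 * \<rho>\<^sup>2 * 2 ^ CARD('n)) * ennreal m * (\<integral>\<^sup>+z. ennreal ((norm (g z))\<^sup>2) * indicator D z \<partial>lborel)"
      unfolding Q_def em(1)[symmetric] by (rule poincare_ball[OF g(2,1) \<rho>]) (simp add: D_def)
    also have "(\<integral>\<^sup>+z. ennreal ((norm (g z))\<^sup>2) * indicator D z \<partial>lborel) \<le> ennreal N"
    proof -
      have "(\<integral>\<^sup>+z. ennreal ((norm (g z))\<^sup>2) * indicator D z \<partial>lborel)
          \<le> (\<integral>\<^sup>+z. ennreal ((norm (mag_grad_classical a u z))\<^sup>2) * indicator D z \<partial>lebesgue)"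
        unfolding nn_integral_completion
        by (intro nn_integral_mono mult_right_mono ennreal_leI power_mono g) auto
      also have "\<dots> = ennreal N" unfolding N_def by (rule nn_integral_ball_eq[OF int_N]) simp
      finally show ?thesis .
    qed
    finally have "ennreal ((U + \<delta>\<^sup>2 * m) * I) \<le> ennreal (2 * H) * (ennreal (4 * \<rho>\<^sup>2 * 2 ^ CARD('n)) * ennreal m * ennreal N)
        + 2 * ennreal (W + \<delta>\<^sup>2 * I) * ennreal m"
      by (simp add: add_right_mono mult_left_mono)
    also have "\<dots> = ennreal (P + 2 * m * (W + \<delta>\<^sup>2 * I))"
    proof -
      have "ennreal (2 * H) * (ennreal (4 * \<rho>\<^sup>2 * 2 ^ CARD('n)) * ennreal m * ennreal N) = ennreal P"
        using H m N0 unfolding P_def by (simp only: ennreal_mult[symmetric] mult.assoc zero_le_mult_iff zero_le_power zero_le_numeral zero_le_power2 less_imp_le simp_thms)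
      moreover have "2 * ennreal (W + \<delta>\<^sup>2 * I) * ennreal m = ennreal (2 * m * (W + \<delta>\<^sup>2 * I))"
        using m W0 I0 by (simp add: ennreal_mult ac_simps)
      moreover have "0 \<le> P" using H m N0 by (simp add: P_def)
      ultimately show ?thesis using m W0 I0 by simp
    qed
    finally have "(U + \<delta>\<^sup>2 * m) * I \<le> P + 2 * m * (W + \<delta>\<^sup>2 * I)"
      using H m N0 W0 I0 by (subst (asm) ennreal_le_iff) (auto simp: P_def)
    moreover have "0 \<le> \<delta>\<^sup>2 * m * I" using m I0 by simp
    ultimately show ?thesis by (simp add: algebra_simps)
  qed
  have "I * U \<le> P + 2 * m * W"
  proof (rule field_le_epsilon)
    fix \<epsilon> :: real assume \<epsilon>: "0 < \<epsilon>"
    define t where "t = \<epsilon> / (2 * m * I + 1)"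
    have t0: "0 < 2 * m * I + 1" using m I0 by (simp add: add_nonneg_pos)
    have t: "0 < t" "t * (2 * m * I) \<le> \<epsilon>" using \<epsilon> t0 by (auto simp: t_def pos_divide_le_eq)
    show "I * U \<le> P + 2 * m * W + \<epsilon>"
      using step[of "sqrt t"] t by simp
  qed
  then show ?thesis by (simp add: I_def U_def P_def W_def N_def m_def)
qed

text \<open>The form of the inequality between means by which small multiples of one term are absorbed.\<close>

lemma young_eps:
  fixes A B e :: real assumes "0 < e" shows "2 * A * B \<le> A\<^sup>2 / e + e * B\<^sup>2"
proof -
  have "0 \<le> (A - e * B)\<^sup>2 / e" using assms by simp
  also have "\<dots> = A\<^sup>2 / e + e * B\<^sup>2 - 2 * A * B"
    using assms by (simp add: power2_eq_square field_simps)
  finally show ?thesis by simp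
qed

text \<open>If the potential is large in mean, it is itself the weight in the Poincare inequality. The powers
  of R cancel: the measure of the ball contributes \<open>R ^ n\<close> and the mass of V at least \<open>R ^ (n - 2)\<close>.\<close>

lemma local_energy_potential:
  fixes u :: "real^'n \<Rightarrow> complex" and a :: "real^'n \<Rightarrow> real^'n" and V :: "real^'n \<Rightarrow> real"
  assumes u: "test_fun u" and a: "loc_Lp 2 a" and V: "loc_integrable V" and R: "0 < R" and n: "2 \<le> CARD('n)"
    and c: "0 < c1" "0 < c2"
    and VR: "AE x in lebesgue. x \<in> ball x0 (2 * R) \<longrightarrow> 0 \<le> V x \<and> V x \<le> c1 / R\<^sup>2"
    and mass: "c2 * R ^ (CARD('n) - 2) \<le> (LINT x:ball x0 (2 * R)|lebesgue. V x)"
  defines "D \<equiv> ball x0 (2 * R)" and "M \<equiv> unit_ball_vol (real CARD('n)) * 2 ^ CARD('n)"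
  shows "(LINT x:D|lebesgue. (cmod (u x))\<^sup>2) \<le> (M / c2 * (32 * c1 * 2 ^ CARD('n) + 2)) * R\<^sup>2 *
    ((LINT x:D|lebesgue. (norm (mag_grad_classical a u x))\<^sup>2) + (LINT x:D|lebesgue. V x * (cmod (u x))\<^sup>2))"
proof -
  define U where "U = (LINT x:D|lebesgue. (cmod (u x))\<^sup>2)"
  define N where "N = (LINT x:D|lebesgue. (norm (mag_grad_classical a u x))\<^sup>2)"
  define W where "W = (LINT x:D|lebesgue. V x * (cmod (u x))\<^sup>2)"
  define k where "k = R ^ (CARD('n) - 2)"
  have k: "0 < k" using R by (simp add: k_def)
  have M0: "0 < M" by (simp add: M_def unit_ball_vol_pos)
  have "R ^ CARD('n) = k * R\<^sup>2" unfolding k_def using n by (metis le_add_diff_inverse2 power_add)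
  then have m: "measure lebesgue D = M * (k * R\<^sup>2)"
    using R by (simp add: D_def M_def content_ball power_mult_distrib)
  have U0: "0 \<le> U" and N0: "0 \<le> N" unfolding U_def N_def set_lebesgue_integral_def
    by (intro integral_nonneg_AE, simp)+
  have "AE x in lebesgue. 0 \<le> indicat_real D x *\<^sub>R (V x * (cmod (u x))\<^sup>2)"
    using VR by eventually_elim (simp add: indicator_def D_def)
  then have W0: "0 \<le> W" unfolding W_def set_lebesgue_integral_def by (rule integral_nonneg_AE)
  have "c2 * k * U \<le> (LINT x:D|lebesgue. V x) * U"
    using mass U0 unfolding k_def D_def by (intro mult_right_mono) auto
  also have "\<dots> \<le> 2 * (c1 / R\<^sup>2) * (4 * (2 * R)\<^sup>2 * 2 ^ CARD('n)) * (M * (k * R\<^sup>2)) * N + 2 * (M * (k * R\<^sup>2)) * W"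
    unfolding U_def N_def W_def m[symmetric] unfolding D_def
    by (rule weighted_poincare[OF u a V _ VR]) (use R c in auto)
  also have "\<dots> = k * (M * R\<^sup>2 * (32 * c1 * 2 ^ CARD('n) * N + 2 * W))"
    using R by (simp add: field_simps power2_eq_square)
  finally have "k * (c2 * U) \<le> k * (M * R\<^sup>2 * (32 * c1 * 2 ^ CARD('n) * N + 2 * W))" by (simp add: ac_simps)
  then have "c2 * U \<le> M * R\<^sup>2 * (32 * c1 * 2 ^ CARD('n) * N + 2 * W)"
    using k by (simp add: mult_le_cancel_left_pos)
  also have "\<dots> \<le> M * R\<^sup>2 * ((32 * c1 * 2 ^ CARD('n) + 2) * (N + W))"
  proof (rule mult_left_mono)
    have "0 \<le> 32 * c1 * 2 ^ CARD('n) * W + 2 * N" using c N0 W0 by simp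
    then show "32 * c1 * 2 ^ CARD('n) * N + 2 * W \<le> (32 * c1 * 2 ^ CARD('n) + 2) * (N + W)"
      by (simp add: algebra_simps)
  qed (use M0 in simp)
  finally have "U \<le> (M * R\<^sup>2 * ((32 * c1 * 2 ^ CARD('n) + 2) * (N + W))) / c2"
    using c by (simp add: pos_le_divide_eq mult.commute)
  then show ?thesis unfolding U_def N_def W_def by (simp add: ac_simps)
qed

text \<open>If the field is large in mean, the almost constant sign of one component on a small ball turns
  integration by parts into a lower bound for a localised mass of u, which then serves as the weight
  in the Poincare inequality.\<close>

lemma local_energy_field:
  fixes u :: "real^'n \<Rightarrow> complex" and a :: "real^'n \<Rightarrow> real^'n" and B :: "real^'n \<Rightarrow> real^'n^'n"
    and DB :: "real^'n \<Rightarrow> real^'n^'n^'n" and j k :: 'n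
  assumes u: "test_fun u" and a: "loc_Lp 2 a" and B: "has_magnetic_field a B" and DB: "has_weak_gradient_field B DB"
    and R: "0 < R" and n: "2 \<le> CARD('n)" and c: "0 < c1" "0 < c2"
    and DBR: "AE x in lebesgue. x \<in> ball x0 (2 * R) \<longrightarrow> norm (DB x) \<le> c1 / R ^ 3"
    and mass: "c2 * R ^ (CARD('n) - 2) < (LINT x|lebesgue. indicator (ball x0 R) x * \<bar>B x $ j $ k\<bar>)"
  defines "D \<equiv> ball x0 (2 * R)"
  defines "\<omega> \<equiv> unit_ball_vol (real CARD('n))"
  defines "c4 \<equiv> c2 / \<omega>"
  defines "\<theta> \<equiv> min (1 / 2) (c4 / (4 * c1))"
  defines "\<kappa> \<equiv> exp (- (4 / 3)) * \<omega> * (\<theta> / 2) ^ CARD('n)"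
  defines "M \<equiv> \<omega> * 2 ^ CARD('n)"
  defines "\<epsilon> \<equiv> \<kappa> * c4 / (8 * M)"
  defines "Q \<equiv> 2 + 16 / (\<theta>\<^sup>2 * \<epsilon>)"
  shows "(LINT x:D|lebesgue. (cmod (u x))\<^sup>2)
    \<le> (2 / \<kappa> * (M * 32 * 2 ^ CARD('n) + 4 * M * Q / c4)) * R\<^sup>2 * (LINT x:D|lebesgue. (norm (mag_grad_classical a u x))\<^sup>2)"
proof -
  define b where "b = (\<lambda>x. B x $ j $ k)"
  define U where "U = (LINT x:D|lebesgue. (cmod (u x))\<^sup>2)"
  define N where "N = (LINT x:D|lebesgue. (norm (mag_grad_classical a u x))\<^sup>2)"
  define kk where "kk = R ^ (CARD('n) - 2)"
  have kk: "0 < kk" using R by (simp add: kk_def)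
  have Rn: "R ^ CARD('n) = kk * R\<^sup>2" unfolding kk_def using n by (metis le_add_diff_inverse2 power_add)
  have \<omega>: "0 < \<omega>" by (simp add: \<omega>_def unit_ball_vol_pos)
  have c4: "0 < c4" using c \<omega> by (simp add: c4_def)
  have \<theta>: "0 < \<theta>" "\<theta> \<le> 1 / 2" "\<theta> \<le> c4 / (4 * c1)" using c c4 by (auto simp: \<theta>_def)
  have \<kappa>: "0 < \<kappa>" using \<omega> \<theta> by (simp add: \<kappa>_def)
  have M: "0 < M" using \<omega> by (simp add: M_def)
  have \<epsilon>: "0 < \<epsilon>" using \<kappa> c4 M by (simp add: \<epsilon>_def)
  have U0: "0 \<le> U" unfolding U_def set_lebesgue_integral_def by (intro integral_nonneg_AE) simp
  have b: "loc_integrable b" using B by (simp add: b_def has_magnetic_field_def)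
  have weak: "has_weak_partial l b (\<lambda>x. (DB x $ j $ k) $ l)" for l
    using DB by (simp add: b_def has_weak_gradient_field_def)
  define L where "L = c1 / R ^ 3"
  have L0: "0 \<le> L" using c R by (simp add: L_def)
  have L: "AE x in lebesgue. x \<in> ball x0 (2 * R) \<longrightarrow> norm (DB x $ j $ k) \<le> L"
    using DBR
  proof eventually_elim
    case (elim x)
    have "norm (DB x $ j $ k) \<le> norm (DB x)"
      by (rule order_trans[OF Finite_Cartesian_Product.norm_nth_le Finite_Cartesian_Product.norm_nth_le])
    then show ?case using elim by (auto simp: L_def)
  qed
  have mBR: "measure lebesgue (ball x0 R) = \<omega> * (kk * R\<^sup>2)" using R by (simp add: content_ball \<omega>_def Rn)
  have mD: "measure lebesgue D = M * (kk * R\<^sup>2)" using R Rn by (simp add: D_def M_def \<omega>_def content_ball power_mult_distrib)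
  have "0 < c2 * kk" using c kk by simp
  moreover have "c2 * kk < (LINT x|lebesgue. indicator (ball x0 R) x * \<bar>b x\<bar>)" using mass by (simp add: b_def kk_def)
  ultimately obtain e z where ez: "0 < e" "e < \<theta> * R" "z \<in> ball x0 R"
    and mol: "c2 * kk \<le> \<bar>mollify e b z\<bar> * measure lebesgue (ball x0 R)"
    using exists_mollify_large[OF b, of "\<theta> * R" "c2 * kk" x0 R] \<theta> R by auto
  have mol': "c4 / R\<^sup>2 \<le> \<bar>mollify e b z\<bar>"
  proof -
    have "kk * c2 \<le> kk * (\<bar>mollify e b z\<bar> * \<omega> * R\<^sup>2)" using mol by (simp add: mBR ac_simps)
    then have "c2 \<le> \<bar>mollify e b z\<bar> * \<omega> * R\<^sup>2" using kk by (simp only: mult_le_cancel_left_pos)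
    then show ?thesis using \<omega> R by (simp add: c4_def field_simps)
  qed
  define t where "t = \<theta> * R"
  have t: "0 < t" "t \<le> R / 2" using \<theta> R mult_right_mono[OF \<theta>(2), of R] by (auto simp: t_def)
  define \<phi> where "\<phi> = bump z t"
  have \<phi>T: "test_fun \<phi>" unfolding \<phi>_def by (rule test_fun_bump[OF t(1)])
  have \<phi>c: "continuous_on UNIV \<phi>" unfolding \<phi>_def by (rule continuous_bump)
  have \<phi>0: "0 \<le> \<phi> x" and \<phi>1: "\<phi> x \<le> 1" for x by (simp_all add: \<phi>_def bump_nonneg bump_le_1)
  have sub: "cball z t \<subseteq> ball x0 (3 / 2 * R)"
  proof
    fix x assume "x \<in> cball z t"
    then show "x \<in> ball x0 (3 / 2 * R)" using ez(3) t dist_triangle[of x0 x z] by auto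
  qed
  then have subD: "cball z t \<subseteq> D" unfolding D_def using R by (force dest: subsetD)
  have \<phi>_out: "\<phi> x = 0" if "x \<notin> cball z t" for x
    using that unfolding \<phi>_def by (intro bump_eq_0[OF t(1)]) auto
  have d\<phi>_out: "partial l \<phi> x = 0" if "x \<notin> cball z t" for l x
    by (rule partial_outside_support[OF \<phi>T \<phi>_out that])
  have d\<phi>: "\<bar>partial l \<phi> x\<bar> \<le> 4 / t" for l x unfolding \<phi>_def by (rule norm_bump_partial_le[OF t(1)])
  define \<psi> where "\<psi> x = \<phi> x * (cmod (u x))\<^sup>2" for x
  define \<Psi> where "\<Psi> = (LINT x|lebesgue. \<psi> x)"
  note parts = magnetic_field_by_parts(2-4)[OF a B u \<phi>T, where j = j and k = k]
  have \<Psi>0: "0 \<le> \<Psi>" unfolding \<Psi>_def \<psi>_def by (intro integral_nonneg_AE AE_I2) (simp add: \<phi>0)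
  \<comment> \<open>The radius \<open>\<theta> * R\<close> is so small that b varies on the ball around z by at most half of its mean
    size \<open>c4 / R\<^sup>2\<close> there.\<close>
  have sign: "c4 / (2 * R\<^sup>2) * \<Psi> \<le> \<bar>LINT x|lebesgue. \<psi> x * b x\<bar>"
  proof -
    have "\<bar>(LINT x|lebesgue. \<psi> x * b x) - mollify e b z * \<Psi>\<bar> \<le> 2 * L * t * \<Psi>"
      unfolding \<Psi>_def
    proof (rule weak_lipschitz_average[OF weak L L0 ez(1) _ sub])
      show "e \<le> t" using ez(2) by (simp add: t_def)
      show "3 / 2 * R < 2 * R" using R by simp
      show "continuous_on UNIV \<psi>" unfolding \<psi>_def by (intro continuous_intros \<phi>c test_fun_derivative(3)[OF u])
      show "0 \<le> \<psi> x" for x by (simp add: \<psi>_def \<phi>0)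
      show "\<psi> x = 0" if "x \<notin> cball z t" for x using \<phi>_out[OF that] by (simp add: \<psi>_def)
    qed
    moreover have "2 * L * t * \<Psi> \<le> c4 / (2 * R\<^sup>2) * \<Psi>"
    proof (rule mult_right_mono[OF _ \<Psi>0])
      have "2 * L * t = 2 * c1 * \<theta> / R\<^sup>2" using R by (simp add: L_def t_def power3_eq_cube power2_eq_square)
      also have "\<dots> \<le> 2 * c1 * (c4 / (4 * c1)) / R\<^sup>2"
        using \<theta>(3) c by (intro divide_right_mono mult_left_mono) auto
      also have "\<dots> = c4 / (2 * R\<^sup>2)" using c by simp
      finally show "2 * L * t \<le> c4 / (2 * R\<^sup>2)" .
    qed
    moreover have "c4 / R\<^sup>2 * \<Psi> \<le> \<bar>mollify e b z * \<Psi>\<bar>"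
      unfolding abs_mult using mol' \<Psi>0 by (intro mult_mono) auto
    moreover have "c4 / R\<^sup>2 * \<Psi> = c4 / (2 * R\<^sup>2) * \<Psi> + c4 / (2 * R\<^sup>2) * \<Psi>" by (simp add: field_simps)
    moreover have "p \<le> \<bar>X\<bar>" if "\<bar>X - m\<bar> \<le> t" "t \<le> p" "q \<le> \<bar>m\<bar>" "q = p + p" for p q t m X :: real
      using that by linarith
    ultimately show ?thesis by blast
  qed
  have int_u: "integrable lebesgue (\<lambda>x. indicator D x * (cmod (u x))\<^sup>2)"
    unfolding D_def using integrable_test_square[OF u loc_integrable_const[of 1]] by (intro set_integrable_ball) simp
  have int_N: "integrable lebesgue (\<lambda>x. indicator D x * (norm (mag_grad_classical a u x))\<^sup>2)"
    unfolding D_def by (intro set_integrable_ball integrable_mag_grad_classical u a)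
  have "\<bar>LINT x|lebesgue. \<psi> x * b x\<bar> \<le> (LINT x|lebesgue. Q * (indicator D x * (norm (mag_grad_classical a u x))\<^sup>2)
      + \<epsilon> / R\<^sup>2 * (indicator D x * (cmod (u x))\<^sup>2))"
    unfolding \<psi>_def b_def parts(2)
  proof (intro integral_abs_bound[THEN order_trans] integral_mono integrable_abs parts(1)
      Bochner_Integration.integrable_add integrable_mult_right int_u int_N)
    fix x
    let ?g = "norm (mag_grad_classical a u x)" and ?u = "cmod (u x)"
    let ?rhs = "2 * \<bar>\<phi> x\<bar> * ?g\<^sup>2 + (\<bar>partial j \<phi> x\<bar> + \<bar>partial k \<phi> x\<bar>) * (?u * ?g)"
    have "?rhs \<le> Q * (indicator D x * ?g\<^sup>2) + \<epsilon> / R\<^sup>2 * (indicator D x * ?u\<^sup>2)"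
    proof (cases "x \<in> cball z t")
      case True
      then have xD: "x \<in> D" using subD by blast
      have "2 * \<bar>\<phi> x\<bar> * ?g\<^sup>2 \<le> 2 * ?g\<^sup>2"
        using \<phi>0[of x] \<phi>1[of x] by (simp add: mult_left_le_one_le)
      moreover have "(\<bar>partial j \<phi> x\<bar> + \<bar>partial k \<phi> x\<bar>) * (?u * ?g) \<le> (4 / t + 4 / t) * (?u * ?g)"
        by (intro mult_right_mono add_mono d\<phi>) simp
      moreover have "(4 / t + 4 / t) * (?u * ?g) = 2 * (4 * ?g / \<theta>) * (?u / R)"
        using \<theta> R by (simp add: t_def field_simps)
      moreover have "2 * (4 * ?g / \<theta>) * (?u / R) \<le> (4 * ?g / \<theta>)\<^sup>2 / \<epsilon> + \<epsilon> * (?u / R)\<^sup>2"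
        by (rule young_eps[OF \<epsilon>])
      moreover have "(4 * ?g / \<theta>)\<^sup>2 / \<epsilon> = 16 / (\<theta>\<^sup>2 * \<epsilon>) * ?g\<^sup>2" "\<epsilon> * (?u / R)\<^sup>2 = \<epsilon> / R\<^sup>2 * ?u\<^sup>2"
        by (simp_all add: power_divide power_mult_distrib)
      moreover have "Q * ?g\<^sup>2 = 2 * ?g\<^sup>2 + 16 / (\<theta>\<^sup>2 * \<epsilon>) * ?g\<^sup>2" by (simp add: Q_def distrib_right)
      ultimately show ?thesis using xD by simp
    next
      case False
      have "0 \<le> Q" using \<epsilon> by (simp add: Q_def)
      then show ?thesis using \<phi>_out[OF False] d\<phi>_out[OF False] \<epsilon> by simp
    qed
    from order_trans[OF parts(3)[of x] this]
    show "\<bar>2 * \<phi> x * (Im (mag_grad_classical a u x $ j) * Re (mag_grad_classical a u x $ k) -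
          Re (mag_grad_classical a u x $ j) * Im (mag_grad_classical a u x $ k)) +
       partial j \<phi> x * (Im (u x) * Re (mag_grad_classical a u x $ k) - Re (u x) * Im (mag_grad_classical a u x $ k)) -
       partial k \<phi> x * (Im (u x) * Re (mag_grad_classical a u x $ j) - Re (u x) * Im (mag_grad_classical a u x $ j))\<bar>
      \<le> Q * (indicator D x * ?g\<^sup>2) + \<epsilon> / R\<^sup>2 * (indicator D x * ?u\<^sup>2)" .
  qed
  also have "\<dots> = Q * N + \<epsilon> / R\<^sup>2 * U"
    using int_u int_N by (simp add: U_def N_def set_lebesgue_integral_def)
  finally have "c4 / (2 * R\<^sup>2) * \<Psi> \<le> Q * N + \<epsilon> / R\<^sup>2 * U" using sign by linarith
  then have \<Psi>_le: "\<Psi> \<le> 2 / c4 * (R\<^sup>2 * Q * N + \<epsilon> * U)"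
    using c4 R by (simp add: field_simps)
  have \<phi>D: "(LINT x:D|lebesgue. \<phi> x) = (LINT x|lebesgue. \<phi> x)" "(LINT x:D|lebesgue. \<phi> x * (cmod (u x))\<^sup>2) = \<Psi>"
    unfolding set_lebesgue_integral_def \<Psi>_def \<psi>_def
    by (intro Bochner_Integration.integral_cong refl, use subD \<phi>_out in \<open>force simp: indicator_def\<close>)+
  have "\<kappa> * (kk * R\<^sup>2) \<le> (LINT x|lebesgue. \<phi> x)"
  proof -
    have "\<kappa> * (kk * R\<^sup>2) = (LINT x|lebesgue. indicator (ball z (t / 2)) x * exp (- (4 / 3)))"
      using t by (simp add: \<kappa>_def content_ball \<omega>_def[symmetric] t_def power_mult_distrib power_divide Rn[symmetric])
    also have "\<dots> \<le> (LINT x|lebesgue. \<phi> x)"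
      unfolding \<phi>_def
    proof (rule integral_mono)
      show "integrable lebesgue (\<lambda>x. indicator (ball z (t / 2)) x * exp (- (4 / 3)) :: real)"
        using lmeasurable_ball lmeasurable_iff_integrable by (intro integrable_mult_left) blast
      show "integrable lebesgue (bump z t)" by (rule integrable_bump[OF t(1)])
      show "indicator (ball z (t / 2)) x * exp (- (4 / 3)) \<le> bump z t x" for x
        using bump_lower[OF t(1), of z x] by (simp add: indicator_def bump_nonneg)
    qed
    finally show ?thesis .
  qed
  then have "\<kappa> * (kk * R\<^sup>2) * U \<le> (LINT x:D|lebesgue. \<phi> x) * U"
    unfolding \<phi>D using U0 by (rule mult_right_mono)
  also have "\<dots> \<le> 2 * 1 * (4 * (2 * R)\<^sup>2 * 2 ^ CARD('n)) * (M * (kk * R\<^sup>2)) * N + 2 * (M * (kk * R\<^sup>2)) * \<Psi>"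
    unfolding U_def N_def \<phi>D(2)[symmetric] mD[symmetric] unfolding D_def
    by (rule weighted_poincare[OF u a loc_integrable_continuous[OF \<phi>c]]) (use R \<phi>0 \<phi>1 in auto)
  finally have "(kk * R\<^sup>2) * (\<kappa> * U) \<le> (kk * R\<^sup>2) * (M * (32 * R\<^sup>2 * 2 ^ CARD('n)) * N + 2 * M * \<Psi>)"
    by (simp add: power_mult_distrib algebra_simps)
  moreover have "0 < kk * R\<^sup>2" using kk R by simp
  ultimately have "\<kappa> * U \<le> M * (32 * R\<^sup>2 * 2 ^ CARD('n)) * N + 2 * M * \<Psi>"
    by (simp only: mult_le_cancel_left_pos)
  also have "\<dots> \<le> M * (32 * R\<^sup>2 * 2 ^ CARD('n)) * N + 2 * M * (2 / c4 * (R\<^sup>2 * Q * N + \<epsilon> * U))"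
    using \<Psi>_le M by (intro add_left_mono mult_left_mono) auto
  also have "\<dots> = (M * 32 * 2 ^ CARD('n) + 4 * M * Q / c4) * R\<^sup>2 * N + \<kappa> / 2 * U"
  proof -
    \<comment> \<open>The choice of \<open>\<epsilon>\<close>: the term in U takes up half of the left hand side and is absorbed there.\<close>
    have eq1: "4 * M / c4 * \<epsilon> = \<kappa> / 2" using M c4 by (simp add: \<epsilon>_def)
    have "2 * M * (2 / c4 * (R\<^sup>2 * Q * N + \<epsilon> * U)) = 4 * M * Q / c4 * R\<^sup>2 * N + (4 * M / c4 * \<epsilon>) * U"
      using c4 by (simp add: field_simps)
    then have "2 * M * (2 / c4 * (R\<^sup>2 * Q * N + \<epsilon> * U)) = 4 * M * Q / c4 * R\<^sup>2 * N + \<kappa> / 2 * U"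
      unfolding eq1 .
    then show ?thesis by (simp add: algebra_simps)
  qed
  finally have "\<kappa> * U \<le> 2 * ((M * 32 * 2 ^ CARD('n) + 4 * M * Q / c4) * R\<^sup>2 * N)" by simp
  moreover have "y \<le> 2 / \<kappa> * x * s * v" if "\<kappa> * y \<le> 2 * (x * s * v)" for x y s v :: real
    using that \<kappa> by (simp add: field_simps)
  ultimately show ?thesis unfolding U_def N_def by blast
qed

lemma norm_matrix_le_sum: "norm (A :: real^'n^'n) \<le> (\<Sum>j\<in>UNIV. \<Sum>k\<in>UNIV. \<bar>A $ j $ k\<bar>)"
proof -
  have "norm A \<le> (\<Sum>j\<in>UNIV. norm (A $ j))" unfolding norm_vec_def by (rule L2_set_le_sum) simp
  also have "\<dots> \<le> (\<Sum>j\<in>UNIV. \<Sum>k\<in>UNIV. \<bar>A $ j $ k\<bar>)"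
    by (intro sum_mono norm_le_l1_cart)
  finally show ?thesis .
qed

text \<open>Since the modulus of B is at most the sum of the moduli of its entries, either V or one of the
  \<open>n\<^sup>2\<close> entries carries a fixed fraction of the mass, and one of the two preceding estimates applies.\<close>

lemma local_energy:
  assumes n: "3 \<le> CARD('n::finite)" and c: "0 < c1" "0 < c2"
  shows "\<exists>C>0. \<forall>(a :: real^'n \<Rightarrow> real^'n) (V :: real^'n \<Rightarrow> real) (B :: real^'n \<Rightarrow> real^'n^'n)
      (DB :: real^'n \<Rightarrow> real^'n^'n^'n) (u :: real^'n \<Rightarrow> complex) x0 R.
    test_fun u \<longrightarrow> loc_Lp 2 a \<longrightarrow> loc_integrable V \<longrightarrow> loc_integrable (\<lambda>x. V x + norm (B x)) \<longrightarrow>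
    has_magnetic_field a B \<longrightarrow> has_weak_gradient_field B DB \<longrightarrow> 0 < R \<longrightarrow>
    (AE x in lebesgue. x \<in> ball x0 (2 * R) \<longrightarrow> 0 \<le> V x \<and> V x \<le> c1 / R\<^sup>2 \<and> norm (DB x) \<le> c1 / R ^ 3) \<longrightarrow>
    c2 * R ^ (CARD('n) - 2) \<le> (LINT x:ball x0 R|lebesgue. V x + norm (B x)) \<longrightarrow>
    (LINT x:ball x0 (2 * R)|lebesgue. (cmod (u x))\<^sup>2) \<le> C * R\<^sup>2 *
      ((LINT x:ball x0 (2 * R)|lebesgue. (norm (mag_grad_classical a u x))\<^sup>2)
        + (LINT x:ball x0 (2 * R)|lebesgue. V x * (cmod (u x))\<^sup>2))"
proof -
  define nn where "nn = real CARD('n)"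
  have nn: "3 \<le> nn" using n by (simp add: nn_def)
  define cB where "cB = c2 / (4 * nn\<^sup>2)"
  have cB: "0 < cB" using c nn by (simp add: cB_def)
  define M where "M = unit_ball_vol (real CARD('n)) * 2 ^ CARD('n)"
  define CV where "CV = M / (c2 / 2) * (32 * c1 * 2 ^ CARD('n) + 2)"
  have M: "0 < M" by (simp add: M_def unit_ball_vol_pos)
  have CV: "0 < CV" using M c by (simp add: CV_def add_pos_pos)
  define \<omega> where "\<omega> = unit_ball_vol (real CARD('n))"
  define c4 where "c4 = cB / \<omega>"
  define \<theta> where "\<theta> = min (1 / 2) (c4 / (4 * c1))"
  define \<kappa> where "\<kappa> = exp (- (4 / 3)) * \<omega> * (\<theta> / 2) ^ CARD('n)"
  define \<epsilon> where "\<epsilon> = \<kappa> * c4 / (8 * (\<omega> * 2 ^ CARD('n)))"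
  define Q where "Q = 2 + 16 / (\<theta>\<^sup>2 * \<epsilon>)"
  define CB where "CB = 2 / \<kappa> * (\<omega> * 2 ^ CARD('n) * 32 * 2 ^ CARD('n) + 4 * (\<omega> * 2 ^ CARD('n)) * Q / c4)"
  have \<omega>: "0 < \<omega>" by (simp add: \<omega>_def unit_ball_vol_pos)
  have c4: "0 < c4" using cB \<omega> by (simp add: c4_def)
  have \<theta>: "0 < \<theta>" using c c4 by (simp add: \<theta>_def)
  have \<kappa>: "0 < \<kappa>" using \<omega> \<theta> by (simp add: \<kappa>_def)
  have \<epsilon>: "0 < \<epsilon>" using \<kappa> c4 \<omega> by (simp add: \<epsilon>_def)
  have Q: "0 < Q" using \<theta> \<epsilon> by (simp add: Q_def add_pos_pos)
  have CB: "0 < CB" using \<kappa> \<omega> Q c4 by (simp add: CB_def add_pos_pos)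
  show ?thesis
  proof (intro exI[of _ "CV + CB"] conjI allI impI)
    show "0 < CV + CB" using CV CB by simp
    fix a :: "real^'n \<Rightarrow> real^'n" and V :: "real^'n \<Rightarrow> real" and B :: "real^'n \<Rightarrow> real^'n^'n"
      and DB :: "real^'n \<Rightarrow> real^'n^'n^'n" and u :: "real^'n \<Rightarrow> complex" and x0 :: "real^'n" and R :: real
    assume u: "test_fun u" and a: "loc_Lp 2 a" and V: "loc_integrable V" and w: "loc_integrable (\<lambda>x. V x + norm (B x))"
      and B: "has_magnetic_field a B" and DB: "has_weak_gradient_field B DB" and R: "0 < R"
      and bnd: "AE x in lebesgue. x \<in> ball x0 (2 * R) \<longrightarrow> 0 \<le> V x \<and> V x \<le> c1 / R\<^sup>2 \<and> norm (DB x) \<le> c1 / R ^ 3"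
      and mass: "c2 * R ^ (CARD('n) - 2) \<le> (LINT x:ball x0 R|lebesgue. V x + norm (B x))"
    define D where "D = ball x0 (2 * R)"
    define N where "N = (LINT x:D|lebesgue. (norm (mag_grad_classical a u x))\<^sup>2)"
    define W where "W = (LINT x:D|lebesgue. V x * (cmod (u x))\<^sup>2)"
    define k where "k = R ^ (CARD('n) - 2)"
    have k: "0 < k" using R by (simp add: k_def)
    have bV: "AE x in lebesgue. x \<in> ball x0 (2 * R) \<longrightarrow> 0 \<le> V x \<and> V x \<le> c1 / R\<^sup>2"
      using bnd by eventually_elim blast
    have bDB: "AE x in lebesgue. x \<in> ball x0 (2 * R) \<longrightarrow> norm (DB x) \<le> c1 / R ^ 3"
      using bnd by eventually_elim blast
    have N0: "0 \<le> N" unfolding N_def set_lebesgue_integral_def by (intro integral_nonneg_AE) simp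
    have "AE x in lebesgue. 0 \<le> indicat_real D x *\<^sub>R (V x * (cmod (u x))\<^sup>2)"
      using bV by eventually_elim (simp add: indicator_def D_def)
    then have W0: "0 \<le> W" unfolding W_def set_lebesgue_integral_def by (rule integral_nonneg_AE)
    have iV: "integrable lebesgue (\<lambda>x. indicator (ball x0 r) x * V x)" for r
      using loc_integrable_subset_ball[OF V, of "ball x0 r" x0 r] by (simp add: set_integrable_def)
    have iw: "integrable lebesgue (\<lambda>x. indicator (ball x0 R) x * (V x + norm (B x)))"
      using loc_integrable_subset_ball[OF w, of "ball x0 R" x0 R] by (simp add: set_integrable_def)
    have ib: "integrable lebesgue (\<lambda>x. indicator (ball x0 R) x * \<bar>B x $ i $ l\<bar>)" for i l
    proof -
      have "loc_integrable (\<lambda>x. B x $ i $ l)" using B by (simp add: has_magnetic_field_def)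
      from integrable_abs[OF loc_integrable_subset_ball[OF this, of "ball x0 R" x0 R, unfolded set_integrable_def]]
      show ?thesis by (simp add: abs_mult)
    qed
    show "(LINT x:ball x0 (2 * R)|lebesgue. (cmod (u x))\<^sup>2) \<le> (CV + CB) * R\<^sup>2 *
      ((LINT x:ball x0 (2 * R)|lebesgue. (norm (mag_grad_classical a u x))\<^sup>2)
        + (LINT x:ball x0 (2 * R)|lebesgue. V x * (cmod (u x))\<^sup>2))"
      unfolding D_def[symmetric] N_def[symmetric] W_def[symmetric]
    proof (cases "c2 / 2 * k \<le> (LINT x|lebesgue. indicator (ball x0 R) x * V x)")
      case True
      have "(LINT x|lebesgue. indicator (ball x0 R) x * V x) \<le> (LINT x|lebesgue. indicator (ball x0 (2 * R)) x * V x)"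
      proof (rule integral_mono_AE[OF iV iV])
        show "AE x in lebesgue. indicat_real (ball x0 R) x * V x \<le> indicat_real (ball x0 (2 * R)) x * V x"
          using bV by eventually_elim (use R in \<open>auto simp: indicator_def\<close>)
      qed
      then have "c2 / 2 * R ^ (CARD('n) - 2) \<le> (LINT x:ball x0 (2 * R)|lebesgue. V x)"
        using True by (simp add: k_def set_lebesgue_integral_def)
      from local_energy_potential[OF u a V R _ c(1) _ bV this] n c
      have "(LINT x:D|lebesgue. (cmod (u x))\<^sup>2) \<le> CV * R\<^sup>2 * (N + W)"
        by (simp add: N_def W_def D_def CV_def M_def)
      also have "\<dots> \<le> (CV + CB) * R\<^sup>2 * (N + W)"
        using CB N0 W0 by (intro mult_right_mono) auto
      finally show "(LINT x:D|lebesgue. (cmod (u x))\<^sup>2) \<le> (CV + CB) * R\<^sup>2 * (N + W)" .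
    next
      case False
      have "\<exists>i l. cB * k < (LINT x|lebesgue. indicator (ball x0 R) x * \<bar>B x $ i $ l\<bar>)"
      proof (rule ccontr)
        assume neg: "\<not> ?thesis"
        have "c2 * k \<le> (LINT x|lebesgue. indicator (ball x0 R) x * (V x + norm (B x)))"
          using mass by (simp add: k_def set_lebesgue_integral_def)
        also have "\<dots> \<le> (LINT x|lebesgue. indicator (ball x0 R) x * V x
            + (\<Sum>i\<in>UNIV. \<Sum>l\<in>UNIV. indicator (ball x0 R) x * \<bar>B x $ i $ l\<bar>))"
        proof (rule integral_mono[OF iw])
          show "integrable lebesgue (\<lambda>x. indicator (ball x0 R) x * V x
            + (\<Sum>i\<in>UNIV. \<Sum>l\<in>UNIV. indicator (ball x0 R) x * \<bar>B x $ i $ l\<bar>))"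
            by (intro Bochner_Integration.integrable_add Bochner_Integration.integrable_sum iV ib)
          show "indicator (ball x0 R) x * (V x + norm (B x)) \<le> indicator (ball x0 R) x * V x
            + (\<Sum>i\<in>UNIV. \<Sum>l\<in>UNIV. indicator (ball x0 R) x * \<bar>B x $ i $ l\<bar>)" for x
            using norm_matrix_le_sum[of "B x"] by (simp add: indicator_def)
        qed
        also have "\<dots> = (LINT x|lebesgue. indicator (ball x0 R) x * V x)
            + (\<Sum>i\<in>UNIV. \<Sum>l\<in>UNIV. LINT x|lebesgue. indicator (ball x0 R) x * \<bar>B x $ i $ l\<bar>)"
        proof -
          have "(LINT x|lebesgue. f x + (\<Sum>i\<in>UNIV. \<Sum>l\<in>UNIV. G i l x))
              = (LINT x|lebesgue. f x) + (\<Sum>i\<in>UNIV. \<Sum>l\<in>UNIV. LINT x|lebesgue. G i l x)"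
            if "integrable lebesgue f" "\<And>i l. integrable lebesgue (G i l)"
            for f :: "real^'n \<Rightarrow> real" and G :: "'n \<Rightarrow> 'n \<Rightarrow> real^'n \<Rightarrow> real"
            using that by simp
          from this[OF iV ib] show ?thesis .
        qed
        also have "\<dots> \<le> c2 / 2 * k + (\<Sum>i\<in>(UNIV :: 'n set). \<Sum>l\<in>(UNIV :: 'n set). cB * k)"
          using False neg by (intro add_mono sum_mono) (auto simp: not_less)
        also have "(\<Sum>i\<in>(UNIV :: 'n set). \<Sum>l\<in>(UNIV :: 'n set). cB * k) = c2 / 4 * k"
          using nn by (simp add: cB_def nn_def power2_eq_square)
        finally have "c2 * k \<le> (3 / 4 * c2) * k" by (simp add: algebra_simps)
        then show False using c k by simp
      qed
      then obtain i l where "cB * R ^ (CARD('n) - 2) < (LINT x|lebesgue. indicator (ball x0 R) x * \<bar>B x $ i $ l\<bar>)"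
        unfolding k_def by blast
      from local_energy_field[OF u a B DB R _ c(1) cB bDB this] n
      have "(LINT x:D|lebesgue. (cmod (u x))\<^sup>2) \<le> CB * R\<^sup>2 * N"
        unfolding N_def D_def CB_def Q_def \<epsilon>_def \<kappa>_def \<theta>_def c4_def \<omega>_def by simp
      also have "\<dots> \<le> (CV + CB) * R\<^sup>2 * (N + W)"
        using CB CV N0 W0 by (intro mult_mono) auto
      finally show "(LINT x:D|lebesgue. (cmod (u x))\<^sup>2) \<le> (CV + CB) * R\<^sup>2 * (N + W)" .
    qed
  qed
qed

section \<open>From local to global\<close>

lemma emeasure_lebesgue_ball:
  "0 \<le> r \<Longrightarrow> emeasure lebesgue (ball (x :: real^'n) r) = ennreal (unit_ball_vol (real CARD('n)) * r ^ CARD('n))"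
proof -
  assume r: "0 \<le> r"
  have "emeasure lborel (ball x r) \<noteq> top" using emeasure_lborel_ball_finite[of x r] by auto
  from emeasure_eq_ennreal_measure[OF this] show ?thesis using r by (simp add: content_ball)
qed

text \<open>Local estimates on the balls of radius \<open>\<rho> x / 2\<close> are integrated over all centres against the
  density \<open>\<rho> x ^ - n\<close>. As \<open>\<rho>\<close> is 1-Lipschitz every point is counted with a total weight between two
  dimensional constants, which takes the place of the finite overlap of a covering.\<close>

lemma integrate_local_estimates:
  fixes F1 F2 :: "real^'n \<Rightarrow> ennreal" and \<rho> :: "real^'n \<Rightarrow> real"
  assumes [measurable]: "F1 \<in> borel_measurable lebesgue" "F2 \<in> borel_measurable lebesgue"
    and \<rho>0: "\<And>x. 0 < \<rho> x" and lip: "\<And>x y. \<rho> x \<le> \<rho> y + dist x y" and C: "0 \<le> C"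
    and loc: "\<And>x0. (\<integral>\<^sup>+x. F1 x * indicator (ball x0 (\<rho> x0 / 2)) x \<partial>lebesgue)
      \<le> ennreal C * (\<integral>\<^sup>+x. F2 x * indicator (ball x0 (\<rho> x0 / 2)) x \<partial>lebesgue)"
  shows "(\<integral>\<^sup>+x. F1 x \<partial>lebesgue) \<le> ennreal (C * 6 ^ CARD('n)) * (\<integral>\<^sup>+x. F2 x \<partial>lebesgue)"
proof -
  define n where "n = CARD('n)"
  define \<omega> where "\<omega> = unit_ball_vol (real n)"
  have \<omega>: "0 < \<omega>" by (simp add: \<omega>_def unit_ball_vol_pos)
  define wt where "wt x0 = ennreal (1 / \<rho> x0 ^ n)" for x0
  define S where "S x0 x = (indicator (ball x0 (\<rho> x0 / 2)) x :: ennreal)" for x0 x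
  have "\<bar>\<rho> x - \<rho> y\<bar> \<le> 1 * dist x y" for x y
    using lip[of x y] lip[of y x] by (simp add: dist_commute abs_le_iff)
  then have "1-lipschitz_on UNIV \<rho>" by (intro lipschitz_onI) (auto simp: dist_real_def)
  then have \<rho>c: "continuous_on UNIV \<rho>" by (rule lipschitz_on_continuous_on)
  have [measurable]: "\<rho> \<in> borel_measurable borel" "\<rho> \<in> borel_measurable lebesgue"
    using \<rho>c by (simp_all add: borel_measurable_continuous_onI continuous_imp_lebesgue_measurable)
  have [measurable]: "wt \<in> borel_measurable lebesgue" unfolding wt_def by measurable
  have "continuous_on UNIV (\<lambda>p :: (real^'n) \<times> (real^'n). \<rho> (fst p) / 2 - dist (fst p) (snd p))"
    by (intro continuous_intros continuous_on_compose2[OF \<rho>c]) auto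
  then have gm: "(\<lambda>p. \<rho> (fst p) / 2 - dist (fst p) (snd p)) \<in> borel_measurable borel"
    by (rule borel_measurable_continuous_onI)
  have "(\<lambda>p. indicator {0<..} (\<rho> (fst p) / 2 - dist (fst p) (snd p)) :: ennreal) \<in> borel_measurable borel"
    by (rule measurable_compose[OF gm]) measurable
  from measurable_lebesgue_pair[OF this]
  have S[measurable]: "(\<lambda>(x0, x). S x0 x) \<in> borel_measurable (lebesgue \<Otimes>\<^sub>M lebesgue)"
    by (simp add: S_def indicator_def split_def)
  have Sx[measurable]: "(\<lambda>x. S x0 x) \<in> borel_measurable lebesgue" for x0
    unfolding S_def by (intro borel_measurable_indicator) auto
  have Sx0[measurable]: "(\<lambda>x0. S x0 x) \<in> borel_measurable lebesgue" for x
  proof -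
    have "(\<lambda>x0. \<rho> x0 / 2 - dist x0 x) \<in> borel_measurable borel"
      by (intro borel_measurable_continuous_onI continuous_intros \<rho>c) auto
    from measurable_compose[OF this, of "indicator {0<..} :: real \<Rightarrow> ennreal"]
    have "(\<lambda>x0. S x0 x) \<in> borel_measurable borel" by (simp add: S_def indicator_def)
    then show ?thesis by (intro measurable_completion) simp
  qed
  define Nx where "Nx x = (\<integral>\<^sup>+x0. wt x0 * S x0 x \<partial>lebesgue)" for x
  have swap: "(\<integral>\<^sup>+x0. wt x0 * (\<integral>\<^sup>+x. F x * S x0 x \<partial>lebesgue) \<partial>lebesgue) = (\<integral>\<^sup>+x. F x * Nx x \<partial>lebesgue)"
    if [measurable]: "F \<in> borel_measurable lebesgue" for F :: "real^'n \<Rightarrow> ennreal"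
  proof -
    have "(\<integral>\<^sup>+x0. wt x0 * (\<integral>\<^sup>+x. F x * S x0 x \<partial>lebesgue) \<partial>lebesgue)
        = (\<integral>\<^sup>+x0. \<integral>\<^sup>+x. wt x0 * (F x * S x0 x) \<partial>lebesgue \<partial>lebesgue)"
      by (intro nn_integral_cong nn_integral_cmult[symmetric]) measurable
    also have "\<dots> = (\<integral>\<^sup>+x. \<integral>\<^sup>+x0. wt x0 * (F x * S x0 x) \<partial>lebesgue \<partial>lebesgue)"
      by (rule leb_pair.Fubini'[symmetric]) measurable
    also have "\<dots> = (\<integral>\<^sup>+x. \<integral>\<^sup>+x0. F x * (wt x0 * S x0 x) \<partial>lebesgue \<partial>lebesgue)"
      by (simp add: ac_simps)
    also have "\<dots> = (\<integral>\<^sup>+x. F x * Nx x \<partial>lebesgue)"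
      unfolding Nx_def by (intro nn_integral_cong nn_integral_cmult) measurable
    finally show ?thesis .
  qed
  define lo where "lo = \<omega> / 4 ^ n"
  define hi where "hi = \<omega> * (3 / 2) ^ n"
  have lo: "0 < lo" and hi: "0 < hi" using \<omega> by (auto simp: lo_def hi_def)
  have pow: "1 / b ^ n * (w * a ^ n) = w * (a / b) ^ n" for a b w :: real
    by (simp add: power_divide)
  have N_lo: "ennreal lo \<le> Nx x" for x
  proof -
    have "ennreal lo = ennreal (1 / (4 / 3 * \<rho> x) ^ n) * emeasure lebesgue (ball x (\<rho> x / 3))"
    proof -
      have "1 / (4 / 3 * \<rho> x) ^ n * (\<omega> * (\<rho> x / 3) ^ n) = \<omega> * ((\<rho> x / 3) / (4 / 3 * \<rho> x)) ^ n"
        by (rule pow)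
      also have "(\<rho> x / 3) / (4 / 3 * \<rho> x) = 1 / 4" using \<rho>0[of x] by simp
      finally have "lo = 1 / (4 / 3 * \<rho> x) ^ n * (\<omega> * (\<rho> x / 3) ^ n)" by (simp add: lo_def power_divide)
      then show ?thesis
        using \<rho>0[of x] by (subst emeasure_lebesgue_ball) (auto simp: ennreal_mult'[symmetric] \<omega>_def n_def)
    qed
    also have "\<dots> = (\<integral>\<^sup>+x0. ennreal (1 / (4 / 3 * \<rho> x) ^ n) * indicator (ball x (\<rho> x / 3)) x0 \<partial>lebesgue)"
      by (rule nn_integral_cmult_indicator[symmetric]) simp
    also have "\<dots> \<le> Nx x"
      unfolding Nx_def
    proof (intro nn_integral_mono)
      fix x0
      show "ennreal (1 / (4 / 3 * \<rho> x) ^ n) * indicator (ball x (\<rho> x / 3)) x0 \<le> wt x0 * S x0 x"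
      proof (cases "x0 \<in> ball x (\<rho> x / 3)")
        case True
        then have d: "dist x x0 < \<rho> x / 3" by simp
        then have "\<rho> x0 \<le> 4 / 3 * \<rho> x" "dist x0 x < \<rho> x0 / 2"
          using lip[of x0 x] lip[of x x0] by (auto simp: dist_commute)
        then show ?thesis using True \<rho>0[of x0]
          by (simp add: wt_def S_def ennreal_leI divide_left_mono power_mono)
      qed simp
    qed
    finally show ?thesis .
  qed
  have N_hi: "Nx x \<le> ennreal hi" for x
  proof -
    have "Nx x \<le> (\<integral>\<^sup>+x0. ennreal (1 / (2 / 3 * \<rho> x) ^ n) * indicator (ball x (\<rho> x)) x0 \<partial>lebesgue)"
      unfolding Nx_def
    proof (intro nn_integral_mono)
      fix x0
      show "wt x0 * S x0 x \<le> ennreal (1 / (2 / 3 * \<rho> x) ^ n) * indicator (ball x (\<rho> x)) x0"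
      proof (cases "x \<in> ball x0 (\<rho> x0 / 2)")
        case True
        then have d: "dist x0 x < \<rho> x0 / 2" by simp
        then have "2 / 3 * \<rho> x \<le> \<rho> x0" "dist x x0 < \<rho> x"
          using lip[of x0 x] lip[of x x0] by (auto simp: dist_commute)
        then show ?thesis using True \<rho>0[of x]
          by (simp add: wt_def S_def ennreal_leI divide_left_mono power_mono)
      qed (simp add: S_def)
    qed
    also have "\<dots> = ennreal (1 / (2 / 3 * \<rho> x) ^ n) * emeasure lebesgue (ball x (\<rho> x))"
      by (rule nn_integral_cmult_indicator) simp
    also have "\<dots> = ennreal hi"
    proof -
      have "1 / (2 / 3 * \<rho> x) ^ n * (\<omega> * \<rho> x ^ n) = \<omega> * (\<rho> x / (2 / 3 * \<rho> x)) ^ n"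
        by (rule pow)
      also have "\<rho> x / (2 / 3 * \<rho> x) = 3 / 2" using \<rho>0[of x] by simp
      finally have "hi = 1 / (2 / 3 * \<rho> x) ^ n * (\<omega> * \<rho> x ^ n)" by (simp add: hi_def)
      then show ?thesis
        using \<rho>0[of x] by (subst emeasure_lebesgue_ball) (auto simp: ennreal_mult'[symmetric] \<omega>_def n_def)
    qed
    finally show ?thesis .
  qed
  have Nm[measurable]: "Nx \<in> borel_measurable lebesgue"
    unfolding Nx_def by measurable
  have "ennreal lo * (\<integral>\<^sup>+x. F1 x \<partial>lebesgue) = (\<integral>\<^sup>+x. F1 x * ennreal lo \<partial>lebesgue)"
    by (subst mult.commute, rule nn_integral_multc[symmetric]) simp
  also have "\<dots> \<le> (\<integral>\<^sup>+x. F1 x * Nx x \<partial>lebesgue)"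
    by (intro nn_integral_mono mult_left_mono N_lo) simp
  also have "\<dots> = (\<integral>\<^sup>+x0. wt x0 * (\<integral>\<^sup>+x. F1 x * S x0 x \<partial>lebesgue) \<partial>lebesgue)"
    by (rule swap[symmetric]) simp
  also have "\<dots> \<le> (\<integral>\<^sup>+x0. wt x0 * (ennreal C * (\<integral>\<^sup>+x. F2 x * S x0 x \<partial>lebesgue)) \<partial>lebesgue)"
    unfolding S_def by (intro nn_integral_mono mult_left_mono loc) simp
  also have "\<dots> = (\<integral>\<^sup>+x0. ennreal C * (wt x0 * (\<integral>\<^sup>+x. F2 x * S x0 x \<partial>lebesgue)) \<partial>lebesgue)"
    by (simp add: mult.left_commute)
  also have "\<dots> = ennreal C * (\<integral>\<^sup>+x0. wt x0 * (\<integral>\<^sup>+x. F2 x * S x0 x \<partial>lebesgue) \<partial>lebesgue)"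
    by (rule nn_integral_cmult) measurable
  also have "(\<integral>\<^sup>+x0. wt x0 * (\<integral>\<^sup>+x. F2 x * S x0 x \<partial>lebesgue) \<partial>lebesgue) = (\<integral>\<^sup>+x. F2 x * Nx x \<partial>lebesgue)"
    by (rule swap) simp
  also have "\<dots> \<le> (\<integral>\<^sup>+x. F2 x * ennreal hi \<partial>lebesgue)"
    by (intro nn_integral_mono mult_left_mono N_hi) simp
  also have "\<dots> = (\<integral>\<^sup>+x. F2 x \<partial>lebesgue) * ennreal hi" by (simp add: nn_integral_multc)
  finally have le: "ennreal lo * (\<integral>\<^sup>+x. F1 x \<partial>lebesgue) \<le> ennreal C * ((\<integral>\<^sup>+x. F2 x \<partial>lebesgue) * ennreal hi)"
    by (simp add: mult_left_mono)
  have "(\<integral>\<^sup>+x. F1 x \<partial>lebesgue) = ennreal (1 / lo) * (ennreal lo * (\<integral>\<^sup>+x. F1 x \<partial>lebesgue))"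
    using lo by (simp add: mult.assoc[symmetric] ennreal_mult'[symmetric])
  also have "\<dots> \<le> ennreal (1 / lo) * (ennreal C * ((\<integral>\<^sup>+x. F2 x \<partial>lebesgue) * ennreal hi))"
    by (intro mult_left_mono le) simp
  also have "\<dots> = ennreal (1 / lo * C * hi) * (\<integral>\<^sup>+x. F2 x \<partial>lebesgue)"
  proof -
    have "ennreal (1 / lo * C * hi) = ennreal (1 / lo) * ennreal C * ennreal hi"
      using lo hi C by (simp only: ennreal_mult[symmetric] zero_le_divide_1_iff less_imp_le mult_nonneg_nonneg)
    then show ?thesis by (simp only: ac_simps)
  qed
  also have "1 / lo * C * hi = C * 6 ^ n"
  proof -
    have "1 / lo * C * hi = C * (4 ^ n * (3 / 2) ^ n)" using \<omega> by (simp add: lo_def hi_def)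
    also have "4 ^ n * (3 / 2) ^ n = (6 :: real) ^ n" by (simp flip: power_mult_distrib)
    finally show ?thesis .
  qed
  finally show ?thesis by (simp add: n_def)
qed

text \<open>On the ball of radius \<open>\<rho>(x0) / 2\<close> the function \<open>\<rho>\<close> is comparable to its value at the centre because
  it is 1-Lipschitz. The bounds for V and for the gradient of B in terms of \<open>\<rho>\<close> therefore become the
  scale invariant hypotheses of the local estimate with R = \<open>\<rho>(x0) / 4\<close>.\<close>

lemma global_energy_test:
  assumes n: "3 \<le> CARD('n::finite)" and c: "0 \<le> c" "0 \<le> c'" "0 < \<kappa>"
  shows "\<exists>C>0. \<forall>(a :: real^'n \<Rightarrow> real^'n) (V :: real^'n \<Rightarrow> real) (B :: real^'n \<Rightarrow> real^'n^'n)
      (DB :: real^'n \<Rightarrow> real^'n^'n^'n) (u :: real^'n \<Rightarrow> complex) \<rho>.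
    test_fun u \<longrightarrow> loc_Lp 2 a \<longrightarrow> loc_integrable V \<longrightarrow> loc_integrable (\<lambda>x. V x + norm (B x)) \<longrightarrow>
    has_magnetic_field a B \<longrightarrow> has_weak_gradient_field B DB \<longrightarrow>
    (\<forall>x. 0 < \<rho> x) \<longrightarrow> (\<forall>x y. \<rho> x \<le> \<rho> y + dist x y) \<longrightarrow>
    (\<forall>x. \<kappa> * \<rho> x ^ (CARD('n) - 2) \<le> (LINT y:ball x (\<rho> x / 4)|lebesgue. V y + norm (B y))) \<longrightarrow>
    (AE x in lebesgue. 0 \<le> V x \<and> V x \<le> c / (\<rho> x)\<^sup>2) \<longrightarrow> (AE x in lebesgue. norm (DB x) \<le> c' / (\<rho> x) ^ 3) \<longrightarrow>
    (\<integral>\<^sup>+x. ennreal ((cmod (u x))\<^sup>2 / (\<rho> x)\<^sup>2) \<partial>lebesgue)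
      \<le> ennreal C * (\<integral>\<^sup>+x. ennreal ((norm (mag_grad_classical a u x))\<^sup>2 + V x * (cmod (u x))\<^sup>2) \<partial>lebesgue)"
proof -
  define c1 where "c1 = c + c' + 1"
  have c1: "0 < c1" "c \<le> c1" "c' \<le> c1" using c by (auto simp: c1_def)
  obtain C0 where C0: "0 < C0" and local: "\<forall>(a :: real^'n \<Rightarrow> real^'n) (V :: real^'n \<Rightarrow> real) (B :: real^'n \<Rightarrow> real^'n^'n)
      (DB :: real^'n \<Rightarrow> real^'n^'n^'n) (u :: real^'n \<Rightarrow> complex) x0 R.
    test_fun u \<longrightarrow> loc_Lp 2 a \<longrightarrow> loc_integrable V \<longrightarrow> loc_integrable (\<lambda>x. V x + norm (B x)) \<longrightarrow>
    has_magnetic_field a B \<longrightarrow> has_weak_gradient_field B DB \<longrightarrow> 0 < R \<longrightarrow>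
    (AE x in lebesgue. x \<in> ball x0 (2 * R) \<longrightarrow> 0 \<le> V x \<and> V x \<le> c1 / R\<^sup>2 \<and> norm (DB x) \<le> c1 / R ^ 3) \<longrightarrow>
    \<kappa> * R ^ (CARD('n) - 2) \<le> (LINT x:ball x0 R|lebesgue. V x + norm (B x)) \<longrightarrow>
    (LINT x:ball x0 (2 * R)|lebesgue. (cmod (u x))\<^sup>2) \<le> C0 * R\<^sup>2 *
      ((LINT x:ball x0 (2 * R)|lebesgue. (norm (mag_grad_classical a u x))\<^sup>2)
        + (LINT x:ball x0 (2 * R)|lebesgue. V x * (cmod (u x))\<^sup>2))"
    using local_energy[OF n c1(1) c(3)] by (elim exE conjE) (rule that)
  show ?thesis
  proof (intro exI[of _ "C0 * 6 ^ CARD('n)"] conjI allI impI)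
    show "0 < C0 * 6 ^ CARD('n)" using C0 by simp
    fix a :: "real^'n \<Rightarrow> real^'n" and V :: "real^'n \<Rightarrow> real" and B :: "real^'n \<Rightarrow> real^'n^'n"
      and DB :: "real^'n \<Rightarrow> real^'n^'n^'n" and u :: "real^'n \<Rightarrow> complex" and \<rho> :: "real^'n \<Rightarrow> real"
    assume u: "test_fun u" and a: "loc_Lp 2 a" and V: "loc_integrable V" and w: "loc_integrable (\<lambda>x. V x + norm (B x))"
      and B: "has_magnetic_field a B" and DB: "has_weak_gradient_field B DB"
      and \<rho>0: "\<forall>x. 0 < \<rho> x" and lip: "\<forall>x y. \<rho> x \<le> \<rho> y + dist x y"
      and mass: "\<forall>x. \<kappa> * \<rho> x ^ (CARD('n) - 2) \<le> (LINT y:ball x (\<rho> x / 4)|lebesgue. V y + norm (B y))"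
      and VB: "AE x in lebesgue. 0 \<le> V x \<and> V x \<le> c / (\<rho> x)\<^sup>2" and DBB: "AE x in lebesgue. norm (DB x) \<le> c' / (\<rho> x) ^ 3"
    define E where "E = (\<lambda>x. (norm (mag_grad_classical a u x))\<^sup>2 + V x * (cmod (u x))\<^sup>2)"
    have iN: "integrable lebesgue (\<lambda>x. (norm (mag_grad_classical a u x))\<^sup>2)" by (rule integrable_mag_grad_classical[OF u a])
    have iW: "integrable lebesgue (\<lambda>x. V x * (cmod (u x))\<^sup>2)" by (rule integrable_test_square[OF u V])
    have iE: "integrable lebesgue E" unfolding E_def by (intro Bochner_Integration.integrable_add iN iW)
    have iu: "integrable lebesgue (\<lambda>x. (cmod (u x))\<^sup>2)"
      using integrable_test_square[OF u loc_integrable_const[of 1]] by simp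
    have "continuous_on UNIV \<rho>"
    proof -
      have "\<bar>\<rho> x - \<rho> y\<bar> \<le> 1 * dist x y" for x y
        using lip[rule_format, of x y] lip[rule_format, of y x] by (simp add: dist_commute abs_le_iff)
      then have "1-lipschitz_on UNIV \<rho>" by (intro lipschitz_onI) (auto simp: dist_real_def)
      then show ?thesis by (rule lipschitz_on_continuous_on)
    qed
    then have [measurable]: "\<rho> \<in> borel_measurable lebesgue" by (rule continuous_imp_lebesgue_measurable)
    have um[measurable]: "(\<lambda>x. (cmod (u x))\<^sup>2) \<in> borel_measurable lebesgue" "E \<in> borel_measurable lebesgue"
      using iu iE by auto
    have "(\<integral>\<^sup>+x. ennreal ((cmod (u x))\<^sup>2 / (\<rho> x)\<^sup>2) \<partial>lebesgue) \<le> ennreal (C0 * 6 ^ CARD('n)) * (\<integral>\<^sup>+x. ennreal (E x) \<partial>lebesgue)"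
    proof (rule integrate_local_estimates[where \<rho> = \<rho>])
      show "(\<lambda>x. ennreal ((cmod (u x))\<^sup>2 / (\<rho> x)\<^sup>2)) \<in> borel_measurable lebesgue" "(\<lambda>x. ennreal (E x)) \<in> borel_measurable lebesgue"
        by measurable
      show "0 \<le> C0" using C0 by simp
      fix x y show "0 < \<rho> x" "\<rho> x \<le> \<rho> y + dist x y" using \<rho>0 lip by auto
    next
      fix x0
      define R where "R = \<rho> x0 / 4"
      define D where "D = ball x0 (2 * R)"
      have R: "0 < R" using \<rho>0 by (simp add: R_def)
      have [measurable]: "D \<in> sets lebesgue" by (simp add: D_def)
      have \<rho>D: "2 * R \<le> \<rho> x" if "x \<in> D" for x
        using that lip[rule_format, of x0 x] by (simp add: D_def R_def)
      have bnd: "AE x in lebesgue. x \<in> ball x0 (2 * R) \<longrightarrow> 0 \<le> V x \<and> V x \<le> c1 / R\<^sup>2 \<and> norm (DB x) \<le> c1 / R ^ 3"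
        using VB DBB
      proof eventually_elim
        case (elim x)
        show ?case
        proof
          assume "x \<in> ball x0 (2 * R)"
          then have le: "R \<le> \<rho> x" using \<rho>D[of x] R by (simp add: D_def)
          have "c / (\<rho> x)\<^sup>2 \<le> c1 / R\<^sup>2" "c' / (\<rho> x) ^ 3 \<le> c1 / R ^ 3"
            using le R c1 c by (auto intro!: frac_le power_mono)
          then show "0 \<le> V x \<and> V x \<le> c1 / R\<^sup>2 \<and> norm (DB x) \<le> c1 / R ^ 3" using elim by linarith
        qed
      qed
      have "\<kappa> * R ^ (CARD('n) - 2) \<le> \<kappa> * \<rho> x0 ^ (CARD('n) - 2)"
        using c R \<rho>0[rule_format, of x0] by (intro mult_left_mono power_mono) (auto simp: R_def)
      also have "\<dots> \<le> (LINT x:ball x0 R|lebesgue. V x + norm (B x))" using mass by (simp add: R_def)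
      finally have mR: "\<kappa> * R ^ (CARD('n) - 2) \<le> (LINT x:ball x0 R|lebesgue. V x + norm (B x))" .
      have iuD: "integrable lebesgue (\<lambda>x. indicator D x * (cmod (u x))\<^sup>2)" unfolding D_def by (rule set_integrable_ball[OF iu])
      have iED: "integrable lebesgue (\<lambda>x. indicator D x * E x)" unfolding D_def by (rule set_integrable_ball[OF iE])
      have E_split: "(LINT x:D|lebesgue. (norm (mag_grad_classical a u x))\<^sup>2) + (LINT x:D|lebesgue. V x * (cmod (u x))\<^sup>2)
          = (LINT x:D|lebesgue. E x)"
        unfolding set_lebesgue_integral_def E_def real_scaleR_def distrib_left D_def
        by (rule Bochner_Integration.integral_add[symmetric, OF set_integrable_ball[OF iN] set_integrable_ball[OF iW]])
      have le: "(LINT x:D|lebesgue. (cmod (u x))\<^sup>2) \<le> C0 * R\<^sup>2 * (LINT x:D|lebesgue. E x)"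
        using local[rule_format, OF u a V w B DB R bnd mR] unfolding D_def[symmetric] E_split .
      have E0: "AE x in lebesgue. x \<in> D \<longrightarrow> 0 \<le> E x"
        using VB by eventually_elim (simp add: E_def)
      have "(\<integral>\<^sup>+x. ennreal ((cmod (u x))\<^sup>2 / (\<rho> x)\<^sup>2) * indicator D x \<partial>lebesgue)
          \<le> (\<integral>\<^sup>+x. ennreal (1 / R\<^sup>2) * (ennreal ((cmod (u x))\<^sup>2) * indicator D x) \<partial>lebesgue)"
      proof (intro nn_integral_mono)
        fix x
        show "ennreal ((cmod (u x))\<^sup>2 / (\<rho> x)\<^sup>2) * indicator D x \<le> ennreal (1 / R\<^sup>2) * (ennreal ((cmod (u x))\<^sup>2) * indicator D x)"
        proof (cases "x \<in> D")
          case True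
          then have "R \<le> \<rho> x" using \<rho>D[of x] R by simp
          then have "(cmod (u x))\<^sup>2 / (\<rho> x)\<^sup>2 \<le> (cmod (u x))\<^sup>2 / R\<^sup>2"
            using R by (intro divide_left_mono power_mono mult_pos_pos) auto
          then show ?thesis using True by (simp add: ennreal_mult'[symmetric] ennreal_leI)
        qed simp
      qed
      also have "\<dots> = ennreal (1 / R\<^sup>2) * (\<integral>\<^sup>+x. ennreal ((cmod (u x))\<^sup>2) * indicator D x \<partial>lebesgue)"
        by (rule nn_integral_cmult) measurable
      also have "(\<integral>\<^sup>+x. ennreal ((cmod (u x))\<^sup>2) * indicator D x \<partial>lebesgue) = ennreal (LINT x:D|lebesgue. (cmod (u x))\<^sup>2)"
        by (rule nn_integral_ball_eq[OF iuD]) simp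
      also have "ennreal (1 / R\<^sup>2) * \<dots> \<le> ennreal (1 / R\<^sup>2) * ennreal (C0 * R\<^sup>2 * (LINT x:D|lebesgue. E x))"
        by (intro mult_left_mono ennreal_leI le) simp
      also have "\<dots> = ennreal (C0 * (LINT x:D|lebesgue. E x))"
        using R by (subst ennreal_mult'[symmetric]) auto
      also have "\<dots> = ennreal C0 * (\<integral>\<^sup>+x. ennreal (E x) * indicator D x \<partial>lebesgue)"
        unfolding nn_integral_ball_eq[OF iED E0] using C0 by (simp add: ennreal_mult')
      finally show "(\<integral>\<^sup>+x. ennreal ((cmod (u x))\<^sup>2 / (\<rho> x)\<^sup>2) * indicator (ball x0 (\<rho> x0 / 2)) x \<partial>lebesgue)
          \<le> ennreal C0 * (\<integral>\<^sup>+x. ennreal (E x) * indicator (ball x0 (\<rho> x0 / 2)) x \<partial>lebesgue)"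
        by (simp add: D_def R_def)
    qed
    then show "(\<integral>\<^sup>+x. ennreal ((cmod (u x))\<^sup>2 / (\<rho> x)\<^sup>2) \<partial>lebesgue)
      \<le> ennreal (C0 * 6 ^ CARD('n)) * (\<integral>\<^sup>+x. ennreal ((norm (mag_grad_classical a u x))\<^sup>2 + V x * (cmod (u x))\<^sup>2) \<partial>lebesgue)"
      by (simp add: E_def)
  qed
qed

section \<open>Passage to the completion\<close>

lemma borel_measurable_vecI:
  fixes f :: "'a \<Rightarrow> 'b::euclidean_space ^ 'n"
  assumes "\<And>j. (\<lambda>x. f x $ j) \<in> borel_measurable M"
  shows "f \<in> borel_measurable M"
proof (subst borel_measurable_euclidean_space, intro ballI)
  fix i :: "'b ^ 'n" assume "i \<in> Basis"
  then obtain j b where i: "i = axis j b" by (auto simp: Basis_vec_def)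
  have "(\<lambda>x. f x $ j \<bullet> b) \<in> borel_measurable M" using assms by measurable
  then show "(\<lambda>x. f x \<bullet> i) \<in> borel_measurable M" by (simp add: i inner_axis)
qed

lemma borel_measurable_vecD:
  fixes f :: "'a \<Rightarrow> 'b::euclidean_space ^ 'n"
  assumes "f \<in> borel_measurable M" shows "(\<lambda>x. f x $ j) \<in> borel_measurable M"
  by (rule borel_measurable_continuous_on[OF linear_continuous_on[OF bounded_linear_vec_nth] assms])

lemma borel_measurable_mag_grad_classical:
  fixes a :: "real^'n \<Rightarrow> real^'n"
  assumes u: "test_fun u" and a: "loc_Lp 2 a"
  shows "mag_grad_classical a u \<in> borel_measurable lebesgue"
proof (rule borel_measurable_vecI)
  fix j
  have [measurable]: "(\<lambda>x. a x $ j) \<in> borel_measurable lebesgue"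
    by (rule loc_integrable_measurable[OF loc_L2_component(1)[OF a]])
  have [measurable]: "u \<in> borel_measurable lebesgue" "partial j u \<in> borel_measurable lebesgue"
    by (intro continuous_imp_lebesgue_measurable test_fun_derivative(3)[OF u] continuous_partial[OF u])+
  show "(\<lambda>x. mag_grad_classical a u x $ j) \<in> borel_measurable lebesgue"
    unfolding mag_grad_classical_def by simp
qed

lemma cmod_sesq_le:
  "cmod (sesq M \<xi> \<xi>) \<le> (real CARD('n))\<^sup>2 * (norm (M :: complex^'n^'n) * (norm \<xi>)\<^sup>2)"
proof -
  have "cmod (sesq M \<xi> \<xi>) \<le> (\<Sum>i\<in>UNIV. \<Sum>j\<in>UNIV. cmod (M $ i $ j * \<xi> $ j * cnj (\<xi> $ i)))"
    unfolding sesq_def by (intro order_trans[OF norm_sum] sum_mono norm_sum)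
  also have "\<dots> \<le> (\<Sum>i\<in>(UNIV :: 'n set). \<Sum>j\<in>(UNIV :: 'n set). norm M * (norm \<xi>)\<^sup>2)"
  proof (intro sum_mono)
    fix i j
    have "cmod (M $ i $ j) \<le> norm M"
      by (rule order_trans[OF Finite_Cartesian_Product.norm_nth_le Finite_Cartesian_Product.norm_nth_le])
    moreover have "cmod (\<xi> $ l) \<le> norm \<xi>" for l by (rule Finite_Cartesian_Product.norm_nth_le)
    ultimately have "cmod (M $ i $ j) * (cmod (\<xi> $ j) * cmod (\<xi> $ i)) \<le> norm M * (norm \<xi> * norm \<xi>)"
      by (intro mult_mono) auto
    then show "cmod (M $ i $ j * \<xi> $ j * cnj (\<xi> $ i)) \<le> norm M * (norm \<xi>)\<^sup>2"
      by (simp add: norm_mult power2_eq_square mult.assoc)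
  qed
  also have "\<dots> = (real CARD('n))\<^sup>2 * (norm M * (norm \<xi>)\<^sup>2)" by (simp add: power2_eq_square)
  finally show ?thesis .
qed

text \<open>Ellipticity lets the energy dominate the squared magnetic gradient and the potential term;
  the bound on A makes the Bochner integral in the energy a genuine one.\<close>

lemma energy_lower_bound:
  fixes A :: "real^'n \<Rightarrow> complex^'n^'n" and V :: "real^'n \<Rightarrow> real" and u :: "real^'n \<Rightarrow> complex" and g :: "real^'n \<Rightarrow> complex^'n"
  assumes A: "elliptic lam Lam A" and V: "V \<in> borel_measurable lebesgue" "AE x in lebesgue. 0 \<le> V x"
    and u: "u \<in> borel_measurable lebesgue" and g: "g \<in> borel_measurable lebesgue"
    and fin: "(\<integral>\<^sup>+x. ennreal ((norm (g x))\<^sup>2 + V x * (cmod (u x))\<^sup>2) \<partial>lebesgue) < \<infinity>"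
  shows "ennreal (min lam 1) * (\<integral>\<^sup>+x. ennreal ((norm (g x))\<^sup>2 + V x * (cmod (u x))\<^sup>2) \<partial>lebesgue) \<le> ennreal (energy A V u g)"
    and "0 \<le> energy A V u g"
proof -
  note [measurable] = V(1) u g
  have Am[measurable]: "A \<in> borel_measurable lebesgue" and lam: "0 < lam"
    and el: "AE x in lebesgue. \<forall>\<xi>. lam * (norm \<xi>)\<^sup>2 \<le> Re (sesq (A x) \<xi> \<xi>)" and bd: "AE x in lebesgue. norm (A x) \<le> Lam"
    using A by (auto simp: elliptic_def)
  define n2 where "n2 = (real CARD('n))\<^sup>2"
  have n2: "0 \<le> n2" by (simp add: n2_def)
  define E where "E x = (norm (g x))\<^sup>2 + V x * (cmod (u x))\<^sup>2" for x
  define e where "e x = Re (sesq (A x) (g x) (g x)) + V x * (cmod (u x))\<^sup>2" for x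
  have [measurable]: "(\<lambda>x. A x $ i $ j) \<in> borel_measurable lebesgue" "(\<lambda>x. g x $ j) \<in> borel_measurable lebesgue" for i j
    using borel_measurable_vecD[OF borel_measurable_vecD[OF Am, of i], of j] borel_measurable_vecD[OF g, of j] by auto
  have [measurable]: "cnj \<in> borel_measurable borel"
    by (intro borel_measurable_continuous_onI continuous_intros)
  have em[measurable]: "e \<in> borel_measurable lebesgue"
    unfolding e_def sesq_def by measurable
  have Em[measurable]: "E \<in> borel_measurable lebesgue" unfolding E_def by measurable
  have E0: "AE x in lebesgue. 0 \<le> E x" using V(2) by eventually_elim (simp add: E_def)
  have iE: "integrable lebesgue E"
  proof (rule integrableI_bounded[OF Em])
    have "(\<integral>\<^sup>+x. ennreal (norm (E x)) \<partial>lebesgue) = (\<integral>\<^sup>+x. ennreal (E x) \<partial>lebesgue)"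
      by (rule nn_integral_cong_AE) (use E0 in eventually_elim, simp)
    then show "(\<integral>\<^sup>+x. ennreal (norm (E x)) \<partial>lebesgue) < \<infinity>" using fin by (simp add: E_def)
  qed
  have lower: "AE x in lebesgue. min lam 1 * E x \<le> e x"
    using el V(2)
  proof eventually_elim
    case (elim x)
    have "min lam 1 * (norm (g x))\<^sup>2 \<le> lam * (norm (g x))\<^sup>2" by (intro mult_right_mono) auto
    moreover have "min lam 1 * (V x * (cmod (u x))\<^sup>2) \<le> 1 * (V x * (cmod (u x))\<^sup>2)" using elim by (intro mult_right_mono) auto
    moreover have "lam * (norm (g x))\<^sup>2 \<le> Re (sesq (A x) (g x) (g x))" using elim by blast
    ultimately show ?case by (simp add: E_def e_def distrib_left)
  qed
  have e0: "AE x in lebesgue. 0 \<le> e x"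
    using lower E0
  proof eventually_elim
    case (elim x)
    have "0 \<le> min lam 1 * E x" using lam elim by (intro mult_nonneg_nonneg) auto
    then show ?case using elim by linarith
  qed
  have ie: "integrable lebesgue e"
  proof (rule Bochner_Integration.integrable_bound[OF integrable_mult_right[OF iE, of "n2 * \<bar>Lam\<bar> + 1"] em])
    show "AE x in lebesgue. norm (e x) \<le> norm ((n2 * \<bar>Lam\<bar> + 1) * E x)"
      using bd V(2) E0
    proof eventually_elim
      case (elim x)
      have "\<bar>Re (sesq (A x) (g x) (g x))\<bar> \<le> n2 * (norm (A x) * (norm (g x))\<^sup>2)"
        unfolding n2_def by (rule order_trans[OF abs_Re_le_cmod cmod_sesq_le])
      also have "\<dots> \<le> n2 * (\<bar>Lam\<bar> * (norm (g x))\<^sup>2)"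
        using elim n2 by (intro mult_left_mono mult_right_mono) auto
      finally have 1: "\<bar>Re (sesq (A x) (g x) (g x))\<bar> \<le> n2 * \<bar>Lam\<bar> * (norm (g x))\<^sup>2" by simp
      have 2: "0 \<le> V x * (cmod (u x))\<^sup>2" "0 \<le> (norm (g x))\<^sup>2" using elim by auto
      have 3: "0 \<le> n2 * \<bar>Lam\<bar> * (V x * (cmod (u x))\<^sup>2)"
        by (rule mult_nonneg_nonneg[OF _ 2(1)]) (use n2 in simp)
      have "\<bar>e x\<bar> \<le> n2 * \<bar>Lam\<bar> * (norm (g x))\<^sup>2 + V x * (cmod (u x))\<^sup>2" using 1 2 by (simp add: e_def)
      also have "\<dots> \<le> (n2 * \<bar>Lam\<bar> + 1) * E x" using 2 3 by (simp add: E_def algebra_simps)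
      finally show ?case using abs_ge_self[of "(n2 * \<bar>Lam\<bar> + 1) * E x"] by simp
    qed
  qed
  have en: "energy A V u g = (LINT x|lebesgue. e x)" by (simp add: energy_def e_def)
  show "0 \<le> energy A V u g" unfolding en by (rule integral_nonneg_AE[OF e0])
  have "ennreal (min lam 1) * (\<integral>\<^sup>+x. ennreal (E x) \<partial>lebesgue) = (\<integral>\<^sup>+x. ennreal (min lam 1) * ennreal (E x) \<partial>lebesgue)"
    by (rule nn_integral_cmult[symmetric]) measurable
  also have "\<dots> \<le> (\<integral>\<^sup>+x. ennreal (e x) \<partial>lebesgue)"
  proof (rule nn_integral_mono_AE, use lower in eventually_elim)
    case (elim x)
    then show ?case using lam by (simp add: ennreal_mult'[symmetric] ennreal_leI)
  qed
  also have "\<dots> = ennreal (energy A V u g)" unfolding en by (rule nn_integral_eq_integral[OF ie e0])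
  finally show "ennreal (min lam 1) * (\<integral>\<^sup>+x. ennreal ((norm (g x))\<^sup>2 + V x * (cmod (u x))\<^sup>2) \<partial>lebesgue) \<le> ennreal (energy A V u g)"
    by (simp add: E_def)
qed

lemma nn_integral_fatou_le:
  assumes [measurable]: "\<And>l. f l \<in> borel_measurable M" and lim: "AE x in M. (\<lambda>l. f l x) \<longlonglongrightarrow> g x"
    and le: "\<forall>\<^sub>F l in sequentially. (\<integral>\<^sup>+x. f l x \<partial>M) \<le> c"
  shows "(\<integral>\<^sup>+x. g x \<partial>M) \<le> (c :: ennreal)"
proof -
  have "(\<integral>\<^sup>+x. g x \<partial>M) = (\<integral>\<^sup>+x. liminf (\<lambda>l. f l x) \<partial>M)"
    by (rule nn_integral_cong_AE) (use lim in eventually_elim, simp add: lim_imp_Liminf)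
  also have "\<dots> \<le> liminf (\<lambda>l. \<integral>\<^sup>+x. f l x \<partial>M)" by (rule nn_integral_liminf) simp
  also have "\<dots> \<le> liminf (\<lambda>l. c)" by (rule Liminf_mono[OF le])
  finally show ?thesis by (simp add: Liminf_const)
qed

text \<open>The series of the functions \<open>2 ^ i * f i\<close> has finite integral, so it is finite almost everywhere and
  bounds each of its terms.\<close>

lemma AE_bounded_if_geometric:
  fixes f :: "nat \<Rightarrow> 'a \<Rightarrow> real"
  assumes [measurable]: "\<And>i. f i \<in> borel_measurable M"
    and le: "\<And>i. (\<integral>\<^sup>+x. ennreal (f i x) \<partial>M) \<le> ennreal ((1 / 4) ^ i)" and f0: "AE x in M. \<forall>i. 0 \<le> f i x"
  shows "AE x in M. \<exists>S. \<forall>i. f i x \<le> S * (1 / 2) ^ i"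
proof -
  have "(\<integral>\<^sup>+x. (\<Sum>i. ennreal (2 ^ i * f i x)) \<partial>M) = (\<Sum>i. \<integral>\<^sup>+x. ennreal (2 ^ i * f i x) \<partial>M)"
    by (rule nn_integral_suminf) measurable
  also have "\<dots> \<le> (\<Sum>i. ennreal ((1 / 2) ^ i))"
  proof (rule suminf_le)
    fix i
    have "(\<integral>\<^sup>+x. ennreal (2 ^ i * f i x) \<partial>M) = ennreal (2 ^ i) * (\<integral>\<^sup>+x. ennreal (f i x) \<partial>M)"
      by (subst nn_integral_cmult[symmetric]) (auto simp: ennreal_mult')
    also have "\<dots> \<le> ennreal (2 ^ i) * ennreal ((1 / 4) ^ i)" by (rule mult_left_mono[OF le]) simp
    also have "\<dots> = ennreal ((1 / 2) ^ i)"
      by (subst ennreal_mult'[symmetric]) (auto simp flip: power_mult_distrib)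
    finally show "(\<integral>\<^sup>+x. ennreal (2 ^ i * f i x) \<partial>M) \<le> ennreal ((1 / 2) ^ i)" .
  qed auto
  also have "\<dots> = ennreal (\<Sum>i. (1 / 2) ^ i)"
    by (rule suminf_ennreal2) (auto intro: summable_geometric)
  finally have "(\<integral>\<^sup>+x. (\<Sum>i. ennreal (2 ^ i * f i x)) \<partial>M) < \<infinity>"
    by (rule le_less_trans) simp
  then have neq: "(\<integral>\<^sup>+x. (\<Sum>i. ennreal (2 ^ i * f i x)) \<partial>M) \<noteq> \<infinity>"
    by (rule less_imp_neq)
  have meas: "(\<lambda>x. \<Sum>i. ennreal (2 ^ i * f i x)) \<in> borel_measurable M" by measurable
  have "AE x in M. (\<Sum>i. ennreal (2 ^ i * f i x)) \<noteq> \<infinity>"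
    by (rule nn_integral_PInf_AE[OF meas neq])
  then show ?thesis
    using f0
  proof eventually_elim
    case (elim x)
    obtain T where T: "T = (\<Sum>i. ennreal (2 ^ i * f i x))" by simp
    have "T \<noteq> \<infinity>" using elim(1) unfolding T .
    then obtain S where "T = ennreal S" "0 \<le> S" by (cases T) auto
    then have S: "(\<Sum>i. ennreal (2 ^ i * f i x)) = ennreal S" "0 \<le> S" unfolding T by blast+
    have "f i x \<le> S * (1 / 2) ^ i" for i
    proof -
      have "ennreal (2 ^ i * f i x) \<le> (\<Sum>i. ennreal (2 ^ i * f i x))"
        using sum_le_suminf[of "\<lambda>i. ennreal (2 ^ i * f i x)" "{i}"] by simp
      then have "2 ^ i * f i x \<le> S" using S by (simp add: ennreal_le_iff)
      then show ?thesis by (simp add: power_one_over field_simps)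
    qed
    then show ?case by blast
  qed
qed

lemma convergent_if_geometric_increments:
  fixes f :: "nat \<Rightarrow> 'b::banach"
  assumes "\<And>i. (norm (f (Suc i) - f i))\<^sup>2 \<le> S * (1 / 2) ^ i"
  shows "convergent f"
proof -
  have le: "norm (f (Suc i) - f i) \<le> sqrt S * sqrt (1 / 2) ^ i" for i
    using real_le_rsqrt[OF assms[of i]] by (simp only: real_sqrt_mult real_sqrt_power)
  have sg: "summable (\<lambda>i. sqrt S * sqrt (1 / 2) ^ i)"
    by (intro summable_mult summable_geometric) simp
  have "summable (\<lambda>i. f (Suc i) - f i)"
    by (rule summable_comparison_test'[OF sg le])
  then have "(\<lambda>n. \<Sum>i<n. f (Suc i) - f i) \<longlonglongrightarrow> (\<Sum>i. f (Suc i) - f i)" by (rule summable_LIMSEQ)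
  then have "(\<lambda>n. f n - f 0 + f 0) \<longlonglongrightarrow> (\<Sum>i. f (Suc i) - f i) + f 0"
    by (intro tendsto_add tendsto_const) (simp add: sum_lessThan_telescope)
  then show ?thesis by (auto intro: convergentI)
qed

lemma mag_grad_classical_diff:
  assumes "test_fun \<phi>" "test_fun \<psi>"
  shows "test_fun (\<lambda>x. \<phi> x - \<psi> x)"
    and "mag_grad_classical a (\<lambda>x. \<phi> x - \<psi> x) x = mag_grad_classical a \<phi> x - mag_grad_classical a \<psi> x"
proof -
  obtain R1 where R1: "\<And>x. x \<notin> cball 0 R1 \<Longrightarrow> \<phi> x = 0" using test_fun_support[OF assms(1)] by blast
  obtain R2 where R2: "\<And>x. x \<notin> cball 0 R2 \<Longrightarrow> \<psi> x = 0" using test_fun_support[OF assms(2)] by blast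
  have "{x. \<phi> x - \<psi> x \<noteq> 0} \<subseteq> cball 0 R1 \<union> cball 0 R2" using R1 R2 by force
  moreover have "bounded (cball 0 R1 \<union> cball (0 :: real^'n) R2)" by simp
  ultimately have "bounded {x. \<phi> x - \<psi> x \<noteq> 0}" by (rule bounded_subset[rotated])
  then show "test_fun (\<lambda>x. \<phi> x - \<psi> x)"
    using assms cont_diff_diff unfolding test_fun_def compact_closure by blast
  have "partial j (\<lambda>x. \<phi> x - \<psi> x) x = partial j \<phi> x - partial j \<psi> x" for j
    using partial_eq[OF has_derivative_diff[OF test_fun_derivative(1)[OF assms(1)] test_fun_derivative(1)[OF assms(2)]]]
    by (simp add: partial_def)
  then show "mag_grad_classical a (\<lambda>x. \<phi> x - \<psi> x) x = mag_grad_classical a \<phi> x - mag_grad_classical a \<psi> x"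
    by (simp add: mag_grad_classical_def vec_eq_iff algebra_simps)
qed

text \<open>A subsequence along which the increments decay geometrically converges almost everywhere, both
  for the functions and for their magnetic gradients; Fatou's lemma turns the Cauchy property into
  a rate of convergence to the limits.\<close>

lemma completion_limit:
  fixes A :: "real^'n \<Rightarrow> complex^'n^'n" and V :: "real^'n \<Rightarrow> real" and a :: "real^'n \<Rightarrow> real^'n" and u :: "real^'n \<Rightarrow> complex"
  assumes A: "elliptic lam Lam A" and V: "loc_integrable V" "AE x in lebesgue. 0 \<le> V x" and a: "loc_Lp 2 a"
    and n: "3 \<le> CARD('n)" and u: "u \<in> hom_energy_space A a V"
  defines "q \<equiv> 2 * real CARD('n) / (real CARD('n) - 2)"
  obtains g \<psi> where "\<And>k. test_fun (\<psi> k)" "g \<in> borel_measurable lebesgue" "AE x in lebesgue. (\<lambda>k. \<psi> k x) \<longlonglongrightarrow> u x"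
    "\<And>k. (\<integral>\<^sup>+x. ennreal ((norm (mag_grad_classical a (\<psi> k) x - g x))\<^sup>2 + V x * (cmod (\<psi> k x - u x))\<^sup>2) \<partial>lebesgue) \<le> ennreal ((1 / 4) ^ k)"
    "\<And>k. (\<integral>\<^sup>+x. ennreal (cmod (\<psi> k x - u x) powr q) \<partial>lebesgue) \<le> ennreal ((1 / 4) ^ k)"
proof -
  have q: "0 < q" using n by (simp add: q_def)
  have um[measurable]: "u \<in> borel_measurable lebesgue" using u by (simp add: hom_energy_space_def Let_def)
  obtain \<phi> where \<phi>: "\<And>k. test_fun (\<phi> k)"
    and cau: "\<And>e. 0 < e \<Longrightarrow> \<exists>N. \<forall>k\<ge>N. \<forall>l\<ge>N. test_norm A a V (\<lambda>x. \<phi> k x - \<phi> l x) < e"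
    and Lq: "(\<lambda>k. \<integral>\<^sup>+x. ennreal (cmod (\<phi> k x - u x) powr q) \<partial>lebesgue) \<longlonglongrightarrow> 0"
    using u unfolding hom_energy_space_def Let_def q_def by blast
  note Vm[measurable] = loc_integrable_measurable[OF V(1)]
  have lam: "0 < lam" using A by (simp add: elliptic_def)
  define D where "D k = mag_grad_classical a (\<phi> k)" for k
  have Dm[measurable]: "D k \<in> borel_measurable lebesgue" for k
    unfolding D_def by (rule borel_measurable_mag_grad_classical[OF \<phi> a])
  have \<phi>m[measurable]: "\<phi> k \<in> borel_measurable lebesgue" for k
    by (rule continuous_imp_lebesgue_measurable[OF test_fun_derivative(3)[OF \<phi>]])
  define h where "h k l x = (norm (D k x - D l x))\<^sup>2 + V x * (cmod (\<phi> k x - \<phi> l x))\<^sup>2" for k l x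
  have hm[measurable]: "h k l \<in> borel_measurable lebesgue" for k l unfolding h_def by measurable
  have d: "\<exists>N. \<forall>k\<ge>N. \<forall>l\<ge>N. (\<integral>\<^sup>+x. ennreal (h k l x) \<partial>lebesgue) \<le> ennreal \<epsilon>" if \<epsilon>: "0 < \<epsilon>" for \<epsilon>
  proof -
    have m0: "0 < min lam 1" using lam by simp
    define e where "e = sqrt (min lam 1 * \<epsilon>)"
    have e: "0 < e" "e\<^sup>2 = min lam 1 * \<epsilon>" using m0 \<epsilon> by (auto simp: e_def)
    obtain N where N: "\<And>k l. N \<le> k \<Longrightarrow> N \<le> l \<Longrightarrow> test_norm A a V (\<lambda>x. \<phi> k x - \<phi> l x) < e"
      using cau[OF e(1)] by blast
    have "(\<integral>\<^sup>+x. ennreal (h k l x) \<partial>lebesgue) \<le> ennreal \<epsilon>" if kl: "N \<le> k" "N \<le> l" for k l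
    proof -
      define v where "v = (\<lambda>x. \<phi> k x - \<phi> l x)"
      have vT: "test_fun v" unfolding v_def by (rule mag_grad_classical_diff(1)[OF \<phi> \<phi>])
      have h_eq: "h k l x = (norm (mag_grad_classical a v x))\<^sup>2 + V x * (cmod (v x))\<^sup>2" for x
        unfolding v_def mag_grad_classical_diff(2)[OF \<phi> \<phi>] h_def D_def ..
      have ih: "integrable lebesgue (h k l)"
        unfolding h_eq[abs_def]
        by (intro Bochner_Integration.integrable_add integrable_mag_grad_classical vT a integrable_test_square V)
      have h0: "AE x in lebesgue. 0 \<le> h k l x" using V(2) by eventually_elim (simp add: h_def)
      have fin: "(\<integral>\<^sup>+x. ennreal (h k l x) \<partial>lebesgue) < \<infinity>"
        unfolding nn_integral_eq_integral[OF ih h0] by simp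
      have vm: "v \<in> borel_measurable lebesgue" unfolding v_def by measurable
      note en = energy_lower_bound[OF A Vm V(2) vm borel_measurable_mag_grad_classical[OF vT a] fin[unfolded h_eq]]
      have "energy A V v (mag_grad_classical a v) = (test_norm A a V v)\<^sup>2"
        unfolding test_norm_def using en(2) by simp
      also have "\<dots> \<le> e\<^sup>2"
        using N[OF kl] en(2) unfolding v_def[symmetric] by (intro power_mono) (auto simp: test_norm_def)
      finally have "ennreal (min lam 1) * (\<integral>\<^sup>+x. ennreal (h k l x) \<partial>lebesgue) \<le> ennreal (min lam 1 * \<epsilon>)"
        unfolding h_eq e(2) using en(1) by (meson ennreal_leI order_trans)
      then have "ennreal (1 / min lam 1) * (ennreal (min lam 1) * (\<integral>\<^sup>+x. ennreal (h k l x) \<partial>lebesgue))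
          \<le> ennreal (1 / min lam 1) * ennreal (min lam 1 * \<epsilon>)" by (rule mult_left_mono) simp
      moreover have "ennreal (1 / min lam 1) * ennreal (min lam 1) = 1"
        using m0 by (subst ennreal_mult'[symmetric]) auto
      moreover have "ennreal (1 / min lam 1) * ennreal (min lam 1 * \<epsilon>) = ennreal \<epsilon>"
        using m0 by (subst ennreal_mult'[symmetric]) auto
      ultimately show ?thesis by (simp add: mult.assoc[symmetric])
    qed
    then show ?thesis by blast
  qed
  have ex: "\<exists>N. (\<forall>k\<ge>N. \<forall>l\<ge>N. (\<integral>\<^sup>+x. ennreal (h k l x) \<partial>lebesgue) \<le> ennreal ((1 / 4) ^ i)) \<and>
      (\<forall>k\<ge>N. (\<integral>\<^sup>+x. ennreal (cmod (\<phi> k x - u x) powr q) \<partial>lebesgue) \<le> ennreal ((1 / 4) ^ i))" for i :: nat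
  proof -
    have pos: "0 < (1 / 4 :: real) ^ i" by simp
    obtain N1 where N1: "\<forall>k\<ge>N1. \<forall>l\<ge>N1. (\<integral>\<^sup>+x. ennreal (h k l x) \<partial>lebesgue) \<le> ennreal ((1 / 4) ^ i)" using d[OF pos] by blast
    have "\<forall>\<^sub>F k in sequentially. (\<integral>\<^sup>+x. ennreal (cmod (\<phi> k x - u x) powr q) \<partial>lebesgue) < ennreal ((1 / 4) ^ i)"
      by (rule order_tendstoD(2)[OF Lq]) simp
    then obtain N2 where N2: "\<forall>k\<ge>N2. (\<integral>\<^sup>+x. ennreal (cmod (\<phi> k x - u x) powr q) \<partial>lebesgue) < ennreal ((1 / 4) ^ i)"
      by (auto simp: eventually_sequentially)
    show ?thesis using N1 N2 by (intro exI[of _ "max N1 N2"] conjI allI impI) (auto intro: less_imp_le)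
  qed
  then have "\<forall>i. \<exists>N. (\<forall>k\<ge>N. \<forall>l\<ge>N. (\<integral>\<^sup>+x. ennreal (h k l x) \<partial>lebesgue) \<le> ennreal ((1 / 4) ^ i)) \<and>
      (\<forall>k\<ge>N. (\<integral>\<^sup>+x. ennreal (cmod (\<phi> k x - u x) powr q) \<partial>lebesgue) \<le> ennreal ((1 / 4) ^ i))" by (rule allI)
  then obtain r where rr: "\<forall>i. (\<forall>k\<ge>r i. \<forall>l\<ge>r i. (\<integral>\<^sup>+x. ennreal (h k l x) \<partial>lebesgue) \<le> ennreal ((1 / 4) ^ i)) \<and>
      (\<forall>k\<ge>r i. (\<integral>\<^sup>+x. ennreal (cmod (\<phi> k x - u x) powr q) \<partial>lebesgue) \<le> ennreal ((1 / 4) ^ i))"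
    by (elim choice[THEN exE])
  have r1: "(\<integral>\<^sup>+x. ennreal (h k l x) \<partial>lebesgue) \<le> ennreal ((1 / 4) ^ i)" if "r i \<le> k" "r i \<le> l" for i k l
    using rr that by blast
  have r2: "(\<integral>\<^sup>+x. ennreal (cmod (\<phi> k x - u x) powr q) \<partial>lebesgue) \<le> ennreal ((1 / 4) ^ i)" if "r i \<le> k" for i k
    using rr that by blast
  define s where "s i = sum r {..i}" for i :: nat
  have rs: "r i \<le> s j" if "i \<le> j" for i j
    unfolding s_def using that by (intro member_le_sum) auto
  have hs: "(\<integral>\<^sup>+x. ennreal (h (s j) (s l) x) \<partial>lebesgue) \<le> ennreal ((1 / 4) ^ i)" if "i \<le> j" "i \<le> l" for i j l
    by (rule r1[OF rs[OF that(1)] rs[OF that(2)]])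
  have qs: "(\<integral>\<^sup>+x. ennreal (cmod (\<phi> (s i) x - u x) powr q) \<partial>lebesgue) \<le> ennreal ((1 / 4) ^ i)" for i
    by (rule r2[OF rs]) simp
  have "AE x in lebesgue. \<exists>S. \<forall>i. cmod (\<phi> (s i) x - u x) powr q \<le> S * (1 / 2) ^ i"
    by (rule AE_bounded_if_geometric[OF _ qs]) auto
  then have conv_u: "AE x in lebesgue. (\<lambda>i. \<phi> (s i) x) \<longlonglongrightarrow> u x"
  proof eventually_elim
    case (elim x)
    then obtain S where S: "\<And>i. cmod (\<phi> (s i) x - u x) powr q \<le> S * (1 / 2) ^ i" by blast
    have S0: "0 \<le> S" using order_trans[OF powr_ge_zero S[of 0]] by simp
    have le: "norm (\<phi> (s i) x - u x) \<le> (S * (1 / 2) ^ i) powr (1 / q)" for i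
    proof -
      have "(cmod (\<phi> (s i) x - u x) powr q) powr (1 / q) \<le> (S * (1 / 2) ^ i) powr (1 / q)"
        using S q by (intro powr_mono2) auto
      then show ?thesis using q by (simp add: powr_powr)
    qed
    have "(\<lambda>i. S * (1 / 2) ^ i) \<longlonglongrightarrow> 0" by (intro tendsto_mult_right_zero LIMSEQ_power_zero) simp
    then have "(\<lambda>i. (S * (1 / 2) ^ i) powr (1 / q)) \<longlonglongrightarrow> 0 powr (1 / q)"
      by (rule tendsto_powr2[OF _ tendsto_const]) (use q S0 in simp_all)
    then have lim: "(\<lambda>i. (S * (1 / 2) ^ i) powr (1 / q)) \<longlonglongrightarrow> 0" by simp
    have "(\<lambda>i. \<phi> (s i) x - u x) \<longlonglongrightarrow> 0"
      by (rule Lim_null_comparison[OF always_eventually[OF allI[OF le]] lim])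
    then show ?case by (simp add: LIM_zero_iff)
  qed
  have incr: "(\<integral>\<^sup>+x. ennreal (h (s (Suc i)) (s i) x) \<partial>lebesgue) \<le> ennreal ((1 / 4) ^ i)" for i by (rule hs) auto
  have "AE x in lebesgue. \<forall>i. 0 \<le> h (s (Suc i)) (s i) x" using V(2) by eventually_elim (simp add: h_def)
  from AE_bounded_if_geometric[OF _ incr this]
  have "AE x in lebesgue. \<exists>S. \<forall>i. h (s (Suc i)) (s i) x \<le> S * (1 / 2) ^ i" by simp
  then have conv_D: "AE x in lebesgue. convergent (\<lambda>i. D (s i) x)"
    using V(2)
  proof eventually_elim
    case (elim x)
    then obtain S where S: "\<And>i. h (s (Suc i)) (s i) x \<le> S * (1 / 2) ^ i" by blast
    show ?case
    proof (rule convergent_if_geometric_increments)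
      fix i
      have "(norm (D (s (Suc i)) x - D (s i) x))\<^sup>2 \<le> h (s (Suc i)) (s i) x" using elim by (simp add: h_def)
      then show "(norm (D (s (Suc i)) x - D (s i) x))\<^sup>2 \<le> S * (1 / 2) ^ i" using S[of i] by linarith
    qed
  qed
  define g where "g x = lim (\<lambda>i. D (s i) x)" for x
  have gm: "g \<in> borel_measurable lebesgue" unfolding g_def by (rule borel_measurable_lim_metric) simp
  have fatou: "(\<integral>\<^sup>+x. ennreal ((norm (D (s k) x - g x))\<^sup>2 + V x * (cmod (\<phi> (s k) x - u x))\<^sup>2) \<partial>lebesgue) \<le> ennreal ((1 / 4) ^ k)" for k
  proof (rule nn_integral_fatou_le)
    show "(\<lambda>x. ennreal (h (s k) (s l) x)) \<in> borel_measurable lebesgue" for l by measurable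
    show "AE x in lebesgue. (\<lambda>l. ennreal (h (s k) (s l) x)) \<longlonglongrightarrow>
        ennreal ((norm (D (s k) x - g x))\<^sup>2 + V x * (cmod (\<phi> (s k) x - u x))\<^sup>2)"
      using conv_D conv_u
    proof eventually_elim
      case (elim x)
      then have "(\<lambda>i. D (s i) x) \<longlonglongrightarrow> g x" by (simp add: g_def convergent_LIMSEQ_iff)
      then show ?case unfolding h_def using elim(2) by (intro tendsto_intros tendsto_ennrealI)
    qed
    show "\<forall>\<^sub>F l in sequentially. (\<integral>\<^sup>+x. ennreal (h (s k) (s l) x) \<partial>lebesgue) \<le> ennreal ((1 / 4) ^ k)"
      by (rule eventually_sequentiallyI[of k]) (rule hs, auto)
  qed
  show thesis
  proof (rule that[of "\<lambda>k. \<phi> (s k)" g])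
    fix k
    show "test_fun (\<phi> (s k))" by (rule \<phi>)
    show "(\<integral>\<^sup>+x. ennreal ((norm (mag_grad_classical a (\<phi> (s k)) x - g x))\<^sup>2 + V x * (cmod (\<phi> (s k) x - u x))\<^sup>2) \<partial>lebesgue) \<le> ennreal ((1 / 4) ^ k)"
      using fatou[of k] by (simp add: D_def)
  qed (rule gm, rule conv_u, rule qs)
qed

lemma loc_integrable_bound:
  fixes h :: "real^'n \<Rightarrow> 'b::{banach, second_countable_topology}" and b :: "real^'n \<Rightarrow> real"
  assumes b: "loc_integrable b" and h: "h \<in> borel_measurable lebesgue" and le: "\<And>x. norm (h x) \<le> b x"
  shows "loc_integrable h"
proof (rule loc_integrableI[OF h])
  fix R
  show "integrable lebesgue (\<lambda>x. indicator (cball 0 R) x *\<^sub>R h x)"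
  proof (rule Bochner_Integration.integrable_bound[OF loc_integrable_cball[OF b, of 0 R]])
    show "(\<lambda>x. indicat_real (cball 0 R) x *\<^sub>R h x) \<in> borel_measurable lebesgue"
      by (intro borel_measurable_scaleR h borel_measurable_indicator) auto
    show "AE x in lebesgue. norm (indicat_real (cball 0 R) x *\<^sub>R h x) \<le> norm (indicat_real (cball 0 R) x *\<^sub>R b x)"
    proof (intro AE_I2)
      fix x
      have "norm (h x) \<le> \<bar>b x\<bar>" using le[of x] by linarith
      then show "norm (indicat_real (cball 0 R) x *\<^sub>R h x) \<le> norm (indicat_real (cball 0 R) x *\<^sub>R b x)"
        by (simp add: indicator_def)
    qed
  qed
qed

lemma loc_integrable_add:
  fixes f g :: "real^'n \<Rightarrow> 'b::{banach, second_countable_topology}"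
  assumes "loc_integrable f" "loc_integrable g" shows "loc_integrable (\<lambda>x. f x + g x)"
proof (rule loc_integrableI)
  show "(\<lambda>x. f x + g x) \<in> borel_measurable lebesgue"
    by (intro borel_measurable_add loc_integrable_measurable assms)
  show "integrable lebesgue (\<lambda>x. indicator (cball 0 R) x *\<^sub>R (f x + g x))" for R
    unfolding scaleR_add_right by (intro Bochner_Integration.integrable_add loc_integrable_cball assms)
qed

lemma integrable_imp_loc_integrable:
  fixes f :: "real^'n \<Rightarrow> 'b::{banach, second_countable_topology}"
  assumes "integrable lebesgue f" shows "loc_integrable f"
proof (rule loc_integrableI)
  show "f \<in> borel_measurable lebesgue" using assms by auto
  show "integrable lebesgue (\<lambda>x. indicator (cball 0 R) x *\<^sub>R f x)" for R
    by (rule integrable_mult_indicator[OF _ assms]) simp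
qed

lemma le_if_double_le: "2 * x * y \<le> z \<Longrightarrow> 0 \<le> x * y \<Longrightarrow> x * y \<le> z" for x y z :: real
  by linarith

lemma half_quotient_mult: "d / (2 * k) * k = d / 2" if "0 < k" for d k :: real
  using that by simp

text \<open>The weighted inequality between means, with a parameter \<open>\<eta>\<close> that is chosen at the end, replaces the
  Cauchy-Schwarz inequality for the pairing of h with the difference of f k and F.\<close>

lemma integral_pairing_tendsto:
  fixes h :: "'a \<Rightarrow> real" and f :: "nat \<Rightarrow> 'a \<Rightarrow> complex"
  assumes [measurable]: "h \<in> borel_measurable M" "\<And>k. f k \<in> borel_measurable M" "F \<in> borel_measurable M" "K \<in> sets M"
    and h2: "integrable M (\<lambda>x. (h x)\<^sup>2)" and supp: "\<And>x. x \<notin> K \<Longrightarrow> h x = 0"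
    and conv: "\<And>\<epsilon>. 0 < \<epsilon> \<Longrightarrow> \<exists>k0. \<forall>k\<ge>k0. (\<integral>\<^sup>+x. ennreal ((cmod (f k x - F x))\<^sup>2) * indicator K x \<partial>M) \<le> ennreal \<epsilon>"
    and int: "\<And>k. integrable M (\<lambda>x. h x *\<^sub>R f k x)"
  shows "integrable M (\<lambda>x. h x *\<^sub>R F x)" and "(\<lambda>k. LINT x|M. h x *\<^sub>R f k x) \<longlonglongrightarrow> (LINT x|M. h x *\<^sub>R F x)"
proof -
  define H where "H = (LINT x|M. (h x)\<^sup>2)"
  have H0: "0 \<le> H" unfolding H_def by (intro integral_nonneg_AE) simp
  have bound: "(\<integral>\<^sup>+x. ennreal (norm (h x *\<^sub>R (f k x - F x))) \<partial>M) \<le> ennreal (\<eta> * H + \<epsilon> / \<eta>)"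
    if \<eta>: "0 < \<eta>" and \<epsilon>: "0 \<le> \<epsilon>" and k: "(\<integral>\<^sup>+x. ennreal ((cmod (f k x - F x))\<^sup>2) * indicator K x \<partial>M) \<le> ennreal \<epsilon>" for \<eta> \<epsilon> k
  proof -
    have "(\<integral>\<^sup>+x. ennreal (norm (h x *\<^sub>R (f k x - F x))) \<partial>M)
        \<le> (\<integral>\<^sup>+x. ennreal (\<eta> * (h x)\<^sup>2) + ennreal (1 / \<eta>) * (ennreal ((cmod (f k x - F x))\<^sup>2) * indicator K x) \<partial>M)"
    proof (intro nn_integral_mono)
      fix x
      show "ennreal (norm (h x *\<^sub>R (f k x - F x))) \<le> ennreal (\<eta> * (h x)\<^sup>2) + ennreal (1 / \<eta>) * (ennreal ((cmod (f k x - F x))\<^sup>2) * indicator K x)"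
      proof (cases "x \<in> K")
        case True
        have "2 * cmod (f k x - F x) * \<bar>h x\<bar> \<le> (cmod (f k x - F x))\<^sup>2 / \<eta> + \<eta> * \<bar>h x\<bar>\<^sup>2"
          by (rule young_eps[OF \<eta>])
        then have "cmod (f k x - F x) * \<bar>h x\<bar> \<le> (cmod (f k x - F x))\<^sup>2 / \<eta> + \<eta> * \<bar>h x\<bar>\<^sup>2"
          by (rule le_if_double_le) simp
        then have "norm (h x *\<^sub>R (f k x - F x)) \<le> \<eta> * (h x)\<^sup>2 + 1 / \<eta> * (cmod (f k x - F x))\<^sup>2"
          by (simp add: mult.commute add.commute)
        then have "ennreal (norm (h x *\<^sub>R (f k x - F x))) \<le> ennreal (\<eta> * (h x)\<^sup>2 + 1 / \<eta> * (cmod (f k x - F x))\<^sup>2)"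
          by (rule ennreal_leI)
        also have "\<dots> = ennreal (\<eta> * (h x)\<^sup>2) + ennreal (1 / \<eta> * (cmod (f k x - F x))\<^sup>2)"
          using \<eta> by (intro ennreal_plus) auto
        also have "ennreal (1 / \<eta> * (cmod (f k x - F x))\<^sup>2) = ennreal (1 / \<eta>) * ennreal ((cmod (f k x - F x))\<^sup>2)"
          using \<eta> by (intro ennreal_mult) auto
        finally show ?thesis using True by simp
      qed (simp add: supp)
    qed
    also have "\<dots> = (\<integral>\<^sup>+x. ennreal (\<eta> * (h x)\<^sup>2) \<partial>M) + (\<integral>\<^sup>+x. ennreal (1 / \<eta>) * (ennreal ((cmod (f k x - F x))\<^sup>2) * indicator K x) \<partial>M)"
      by (rule nn_integral_add) measurable
    also have "(\<integral>\<^sup>+x. ennreal (\<eta> * (h x)\<^sup>2) \<partial>M) = ennreal (\<eta> * H)"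
      unfolding H_def using \<eta> h2
      by (subst nn_integral_eq_integral) auto
    also have "(\<integral>\<^sup>+x. ennreal (1 / \<eta>) * (ennreal ((cmod (f k x - F x))\<^sup>2) * indicator K x) \<partial>M)
        = ennreal (1 / \<eta>) * (\<integral>\<^sup>+x. ennreal ((cmod (f k x - F x))\<^sup>2) * indicator K x \<partial>M)"
      by (rule nn_integral_cmult) measurable
    also have "ennreal (\<eta> * H) + \<dots> \<le> ennreal (\<eta> * H) + ennreal (1 / \<eta>) * ennreal \<epsilon>"
      by (intro add_left_mono mult_left_mono k) simp
    also have "ennreal (1 / \<eta>) * ennreal \<epsilon> = ennreal (\<epsilon> / \<eta>)"
      using \<eta> \<epsilon> by (subst ennreal_mult[symmetric]) auto
    also have "ennreal (\<eta> * H) + ennreal (\<epsilon> / \<eta>) = ennreal (\<eta> * H + \<epsilon> / \<eta>)"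
      using \<eta> H0 \<epsilon> by (intro ennreal_plus[symmetric]) auto
    finally show ?thesis .
  qed
  obtain k0 where k0: "(\<integral>\<^sup>+x. ennreal ((cmod (f k0 x - F x))\<^sup>2) * indicator K x \<partial>M) \<le> ennreal 1"
    using conv[of 1] by auto
  have idiff: "integrable M (\<lambda>x. h x *\<^sub>R (f k0 x - F x))"
  proof (rule integrableI_bounded)
    show "(\<integral>\<^sup>+x. ennreal (norm (h x *\<^sub>R (f k0 x - F x))) \<partial>M) < \<infinity>"
      using bound[of 1 1 k0] k0 by (simp add: le_less_trans[OF _ ennreal_less_top])
  qed measurable
  have "integrable M (\<lambda>x. h x *\<^sub>R f k0 x - h x *\<^sub>R (f k0 x - F x))"
    by (rule Bochner_Integration.integrable_diff[OF int idiff])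
  then show iF: "integrable M (\<lambda>x. h x *\<^sub>R F x)" by (simp add: scaleR_diff_right)
  show "(\<lambda>k. LINT x|M. h x *\<^sub>R f k x) \<longlonglongrightarrow> (LINT x|M. h x *\<^sub>R F x)"
  proof (rule LIMSEQ_I)
    fix \<delta> :: real assume \<delta>: "0 < \<delta>"
    define \<eta> where "\<eta> = \<delta> / (2 * (H + 1))"
    have H1: "0 < H + 1" using H0 by simp
    have \<eta>: "0 < \<eta>" using \<delta> H1 by (simp add: \<eta>_def)
    have \<eta>H: "\<eta> * H < \<delta> / 2"
    proof -
      have "\<eta> * H < \<eta> * (H + 1)" using \<eta> by simp
      also have "\<dots> = \<delta> / 2" unfolding \<eta>_def by (rule half_quotient_mult[OF H1])
      finally show ?thesis .
    qed
    have "0 < \<eta> * \<delta> / 2" using \<eta> \<delta> by simp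
    from conv[OF this] obtain k1 where k1: "\<And>k. k1 \<le> k \<Longrightarrow>
      (\<integral>\<^sup>+x. ennreal ((cmod (f k x - F x))\<^sup>2) * indicator K x \<partial>M) \<le> ennreal (\<eta> * \<delta> / 2)" by blast
    have "norm ((LINT x|M. h x *\<^sub>R f k x) - (LINT x|M. h x *\<^sub>R F x)) < \<delta>" if k: "k1 \<le> k" for k
    proof -
      have idk: "integrable M (\<lambda>x. h x *\<^sub>R (f k x - F x))"
        unfolding scaleR_diff_right by (rule Bochner_Integration.integrable_diff[OF int iF])
      have "(LINT x|M. h x *\<^sub>R f k x) - (LINT x|M. h x *\<^sub>R F x) = (LINT x|M. h x *\<^sub>R (f k x - F x))"
        unfolding scaleR_diff_right by (rule Bochner_Integration.integral_diff[OF int iF, symmetric])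
      then have "ennreal (norm ((LINT x|M. h x *\<^sub>R f k x) - (LINT x|M. h x *\<^sub>R F x)))
          \<le> (\<integral>\<^sup>+x. ennreal (norm (h x *\<^sub>R (f k x - F x))) \<partial>M)"
        using integral_norm_bound_ennreal[OF idk] by simp
      also have "\<dots> \<le> ennreal (\<eta> * H + (\<eta> * \<delta> / 2) / \<eta>)"
        by (rule bound[OF \<eta> _ k1[OF k]]) (use \<eta> \<delta> in simp)
      finally have "norm ((LINT x|M. h x *\<^sub>R f k x) - (LINT x|M. h x *\<^sub>R F x)) \<le> \<eta> * H + (\<eta> * \<delta> / 2) / \<eta>"
        using \<eta> H0 \<delta> by (subst (asm) ennreal_le_iff) auto
      also have "(\<eta> * \<delta> / 2) / \<eta> = \<delta> / 2" using \<eta> by simp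
      finally show ?thesis using \<eta>H by linarith
    qed
    then show "\<exists>k0. \<forall>k\<ge>k0. norm ((LINT x|M. h x *\<^sub>R f k x) - (LINT x|M. h x *\<^sub>R F x)) < \<delta>" by blast
  qed
qed

lemma test_by_parts:
  fixes \<phi> p :: "real^'n \<Rightarrow> real"
  assumes \<phi>: "test_fun \<phi>" and p: "test_fun p"
  shows "(LINT x|lebesgue. \<phi> x * partial j p x) = - (LINT x|lebesgue. partial j \<phi> x * p x)"
proof -
  obtain R where R: "\<And>x. x \<notin> cball 0 R \<Longrightarrow> \<phi> x = 0" using test_fun_support[OF \<phi>] by blast
  have d: "((\<lambda>x. \<phi> x * p x) has_derivative
      (\<lambda>v. \<phi> x * frechet_derivative p (at x) v + frechet_derivative \<phi> (at x) v * p x)) (at x)" for x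
    by (rule has_derivative_mult[OF test_fun_derivative(1)[OF \<phi>] test_fun_derivative(1)[OF p]])
  have c1: "continuous_on UNIV (\<lambda>x. \<phi> x * partial j p x)" and c2: "continuous_on UNIV (\<lambda>x. partial j \<phi> x * p x)"
    by (intro continuous_on_mult continuous_partial test_fun_derivative(3) \<phi> p)+
  have c: "continuous_on UNIV (\<lambda>x. \<phi> x * partial j p x + partial j \<phi> x * p x)" by (rule continuous_on_add[OF c1 c2])
  have "(LINT x|lebesgue. \<phi> x * frechet_derivative p (at x) (axis j 1) + frechet_derivative \<phi> (at x) (axis j 1) * p x) = 0"
    by (rule integral_derivative_eq_0[OF d, of _ R])
      (use c R in \<open>simp_all add: partial_def\<close>)
  then have "(LINT x|lebesgue. \<phi> x * partial j p x + partial j \<phi> x * p x) = 0" by (simp add: partial_def)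
  moreover have "integrable lebesgue (\<lambda>x. \<phi> x * partial j p x)"
    by (rule integrable_compact_support[OF c1, of 0 R]) (use R in simp)
  moreover have "integrable lebesgue (\<lambda>x. partial j \<phi> x * p x)"
  proof (rule integrable_compact_support[OF c2, of 0 R])
    show "partial j \<phi> x * p x = 0" if "x \<notin> cball 0 R" for x using partial_outside_support[OF \<phi> R that] by simp
  qed
  ultimately show ?thesis by simp
qed

lemma test_by_parts_complex:
  fixes \<phi> :: "real^'n \<Rightarrow> real" and v :: "real^'n \<Rightarrow> complex"
  assumes \<phi>: "test_fun \<phi>" and v: "test_fun v"
  shows "(LINT x|lebesgue. \<phi> x *\<^sub>R partial j v x) = - (LINT x|lebesgue. partial j \<phi> x *\<^sub>R v x)"
proof -
  obtain R where R: "\<And>x. x \<notin> cball 0 R \<Longrightarrow> \<phi> x = 0" using test_fun_support[OF \<phi>] by blast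
  have i1: "integrable lebesgue (\<lambda>x. \<phi> x *\<^sub>R partial j v x)"
    by (rule integrable_compact_support_mult[OF loc_integrable_continuous[OF continuous_partial[OF v]] test_fun_derivative(3)[OF \<phi>] R])
  have i2: "integrable lebesgue (\<lambda>x. partial j \<phi> x *\<^sub>R v x)"
    by (rule integrable_compact_support_mult[OF loc_integrable_continuous[OF test_fun_derivative(3)[OF v]] continuous_partial[OF \<phi>]
        partial_outside_support[OF \<phi> R]])
  have key: "T (LINT x|lebesgue. \<phi> x *\<^sub>R partial j v x) = T (- (LINT x|lebesgue. partial j \<phi> x *\<^sub>R v x))"
    if T: "bounded_linear T" for T :: "complex \<Rightarrow> real"
  proof -
    have pT: "partial j (\<lambda>x. T (v x)) x = T (partial j v x)" for x
      using partial_eq[OF bounded_linear.has_derivative[OF T test_fun_derivative(1)[OF v]]] by (simp add: partial_def)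
    have "T (LINT x|lebesgue. \<phi> x *\<^sub>R partial j v x) = (LINT x|lebesgue. \<phi> x * partial j (\<lambda>x. T (v x)) x)"
      by (subst integral_bounded_linear[OF T i1, symmetric]) (simp add: pT linear_simps(5)[OF T])
    also have "\<dots> = - (LINT x|lebesgue. partial j \<phi> x * T (v x))" by (rule test_by_parts[OF \<phi> test_fun_linear[OF T v]])
    also have "(LINT x|lebesgue. partial j \<phi> x * T (v x)) = T (LINT x|lebesgue. partial j \<phi> x *\<^sub>R v x)"
      by (subst integral_bounded_linear[OF T i2, symmetric]) (simp add: linear_simps(5)[OF T])
    finally show ?thesis by (simp add: linear_simps(4)[OF T])
  qed
  show ?thesis by (rule complex_eqI) (rule key, rule bounded_linear_Re, rule key, rule bounded_linear_Im)
qed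

text \<open>Integrated over a set of finite measure, this makes convergence in the q-th mean imply
  convergence in mean square.\<close>

lemma square_le_truncation:
  assumes "2 \<le> q" "0 < t" shows "(cmod z)\<^sup>2 \<le> t + t powr (1 - q / 2) * cmod z powr q"
proof -
  have "((cmod z)\<^sup>2) powr (q / 2) = cmod z powr q"
  proof (cases "z = 0")
    case False
    then have eq: "(cmod z)\<^sup>2 = cmod z powr 2" by simp
    show ?thesis unfolding eq powr_powr by simp
  qed (use assms in simp)
  then show ?thesis using young_truncation[of "(cmod z)\<^sup>2" t "q / 2"] assms by simp
qed

text \<open>Each approximant satisfies the weak identity that defines its magnetic gradient. The
  multipliers \<open>\<phi>\<close>, \<open>\<phi> * a $ j\<close> and \<open>partial j \<phi>\<close> in its three terms are square integrable with compact
  support, so local convergence in mean square carries the identity to the limit.\<close>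

lemma has_mag_grad_limit:
  fixes a :: "real^'n \<Rightarrow> real^'n" and u :: "real^'n \<Rightarrow> complex" and g :: "real^'n \<Rightarrow> complex^'n"
  assumes a: "loc_Lp 2 a" and q: "2 \<le> q" and V: "AE x in lebesgue. 0 \<le> V x"
    and um: "u \<in> borel_measurable lebesgue" and gm: "g \<in> borel_measurable lebesgue"
    and uq: "(\<integral>\<^sup>+x. ennreal (cmod (u x) powr q) \<partial>lebesgue) < \<infinity>"
    and g2: "(\<integral>\<^sup>+x. ennreal ((norm (g x))\<^sup>2) \<partial>lebesgue) < \<infinity>"
    and \<psi>: "\<And>k. test_fun (\<psi> k)"
    and conv: "\<And>k. (\<integral>\<^sup>+x. ennreal ((norm (mag_grad_classical a (\<psi> k) x - g x))\<^sup>2 + V x * (cmod (\<psi> k x - u x))\<^sup>2) \<partial>lebesgue) \<le> ennreal ((1 / 4) ^ k)"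
    and convq: "\<And>k. (\<integral>\<^sup>+x. ennreal (cmod (\<psi> k x - u x) powr q) \<partial>lebesgue) \<le> ennreal ((1 / 4) ^ k)"
  shows "has_mag_grad a u g"
  unfolding has_mag_grad_def
proof (intro allI conjI)
  fix j
  have small: "\<exists>k0. \<forall>k\<ge>k0. (1 / 4 :: real) ^ k \<le> \<epsilon>" if "0 < \<epsilon>" for \<epsilon>
  proof -
    obtain k0 where k0: "(1 / 4 :: real) ^ k0 < \<epsilon>" using real_arch_pow_inv[of \<epsilon> "1 / 4"] \<open>0 < \<epsilon>\<close> by auto
    have "(1 / 4 :: real) ^ k \<le> \<epsilon>" if "k0 \<le> k" for k
    proof -
      have "(1 / 4 :: real) ^ k \<le> (1 / 4) ^ k0" using that by (intro power_decreasing) auto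
      then show ?thesis using k0 by linarith
    qed
    then show ?thesis by blast
  qed
  note [measurable] = um gm
  have ajl: "loc_integrable (\<lambda>x. a x $ j)" and a2l: "loc_integrable (\<lambda>x. (norm (a x))\<^sup>2)" by (rule loc_L2_component[OF a])+
  have ajm[measurable]: "(\<lambda>x. a x $ j) \<in> borel_measurable lebesgue" by (rule loc_integrable_measurable[OF ajl])
  have gjm[measurable]: "(\<lambda>x. g x $ j) \<in> borel_measurable lebesgue" by (rule borel_measurable_vecD[OF gm])
  have \<psi>m[measurable]: "\<psi> k \<in> borel_measurable lebesgue" for k
    by (rule continuous_imp_lebesgue_measurable[OF test_fun_derivative(3)[OF \<psi>]])
  have Dm[measurable]: "(\<lambda>x. mag_grad_classical a (\<psi> k) x $ j) \<in> borel_measurable lebesgue" for k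
    by (rule borel_measurable_vecD[OF borel_measurable_mag_grad_classical[OF \<psi> a]])
  have "integrable lebesgue (\<lambda>x. cmod (u x) powr q)"
    by (rule integrableI_bounded) (use uq in auto)
  then have uql: "loc_integrable (\<lambda>x. cmod (u x) powr q)" by (rule integrable_imp_loc_integrable)
  have "integrable lebesgue (\<lambda>x. (norm (g x))\<^sup>2)"
    by (rule integrableI_bounded) (use g2 in auto)
  then have g2l: "loc_integrable (\<lambda>x. (norm (g x))\<^sup>2)" by (rule integrable_imp_loc_integrable)
  have u2: "(cmod (u x))\<^sup>2 \<le> 1 + cmod (u x) powr q" for x
    using square_le_truncation[OF q, of 1 "u x"] by simp
  have le_sq: "t \<le> 1 + t\<^sup>2" if "0 \<le> t" for t :: real
    using zero_le_power2[of "t - 1"] that by (simp add: power2_eq_square algebra_simps)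
  have u2l: "loc_integrable (\<lambda>x. (cmod (u x))\<^sup>2)"
  proof (rule loc_integrable_bound[OF loc_integrable_add[OF loc_integrable_const[of 1] uql]])
    show "norm ((cmod (u x))\<^sup>2) \<le> 1 + cmod (u x) powr q" for x using u2[of x] by simp
  qed measurable
  have ul: "loc_integrable u"
    by (rule loc_integrable_bound[OF loc_integrable_add[OF loc_integrable_const[of 1] u2l] um]) (simp add: le_sq)
  have gl: "loc_integrable (\<lambda>x. g x $ j)"
  proof (rule loc_integrable_bound[OF loc_integrable_add[OF loc_integrable_const[of 1] g2l] gjm])
    fix x
    have "cmod (g x $ j) \<le> norm (g x)" by (rule Finite_Cartesian_Product.norm_nth_le)
    also have "\<dots> \<le> 1 + (norm (g x))\<^sup>2" by (rule le_sq) simp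
    finally show "norm (g x $ j) \<le> 1 + (norm (g x))\<^sup>2" .
  qed
  have aul: "loc_integrable (\<lambda>x. of_real (a x $ j) * u x)"
  proof (rule loc_integrable_bound[OF loc_integrable_add[OF a2l u2l]])
    fix x
    have "\<bar>a x $ j\<bar> * cmod (u x) \<le> norm (a x) * cmod (u x)" by (intro mult_right_mono component_le_norm_cart) simp
    also have "\<dots> \<le> (norm (a x))\<^sup>2 + (cmod (u x))\<^sup>2"
      by (rule le_if_double_le) (use zero_le_power2[of "norm (a x) - cmod (u x)"] in \<open>simp_all add: power2_diff\<close>)
    finally show "norm (of_real (a x $ j) * u x) \<le> (norm (a x))\<^sup>2 + (cmod (u x))\<^sup>2" by (simp add: norm_mult)
  qed measurable
  show "loc_integrable (\<lambda>x. of_real (a x $ j) * u x)" by (rule aul)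
  have Gl: "loc_integrable (\<lambda>x. g x $ j + \<i> * of_real (a x $ j) * u x)"
  proof -
    have "loc_integrable (\<lambda>x. \<i> * (of_real (a x $ j) * u x))"
    proof (rule loc_integrableI)
      show "(\<lambda>x. \<i> * (of_real (a x $ j) * u x)) \<in> borel_measurable lebesgue" by measurable
      show "integrable lebesgue (\<lambda>x. indicator (cball 0 R) x *\<^sub>R (\<i> * (of_real (a x $ j) * u x)))" for R
        using integrable_mult_right[OF loc_integrable_cball[OF aul, of 0 R], of \<i>] by simp
    qed
    from loc_integrable_add[OF gl this] show ?thesis by (simp add: mult.assoc)
  qed
  show "has_weak_partial j u (\<lambda>x. g x $ j + \<i> * of_real (a x $ j) * u x)"
    unfolding has_weak_partial_def
  proof (intro conjI allI impI ul Gl)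
    fix \<phi> :: "real^'n \<Rightarrow> real" assume \<phi>: "test_fun \<phi>"
    obtain R where R: "\<And>x. x \<notin> cball 0 R \<Longrightarrow> \<phi> x = 0" using test_fun_support[OF \<phi>] by blast
    define K where "K = cball (0 :: real^'n) R"
    have [measurable]: "K \<in> sets lebesgue" by (simp add: K_def)
    have \<phi>c: "continuous_on UNIV \<phi>" and d\<phi>c: "continuous_on UNIV (partial j \<phi>)"
      by (rule test_fun_derivative(3)[OF \<phi>], rule continuous_partial[OF \<phi>])
    have [measurable]: "\<phi> \<in> borel_measurable lebesgue" "partial j \<phi> \<in> borel_measurable lebesgue"
      by (intro continuous_imp_lebesgue_measurable \<phi>c d\<phi>c)+
    have dR: "partial j \<phi> x = 0" if "x \<notin> cball 0 R" for x by (rule partial_outside_support[OF \<phi> R that])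
    have cD: "\<exists>k0. \<forall>k\<ge>k0. (\<integral>\<^sup>+x. ennreal ((cmod (mag_grad_classical a (\<psi> k) x $ j - g x $ j))\<^sup>2) * indicator K x \<partial>lebesgue) \<le> ennreal \<epsilon>"
      if \<epsilon>: "0 < \<epsilon>" for \<epsilon>
    proof -
      obtain k0 where k0: "\<And>k. k0 \<le> k \<Longrightarrow> (1 / 4 :: real) ^ k \<le> \<epsilon>" using small[OF \<epsilon>] by blast
      have "(\<integral>\<^sup>+x. ennreal ((cmod (mag_grad_classical a (\<psi> k) x $ j - g x $ j))\<^sup>2) * indicator K x \<partial>lebesgue) \<le> ennreal ((1 / 4) ^ k)" for k
      proof (rule order_trans[OF nn_integral_mono_AE conv[of k]], use V in eventually_elim)
        case (elim x)
        have "cmod ((mag_grad_classical a (\<psi> k) x - g x) $ j) \<le> norm (mag_grad_classical a (\<psi> k) x - g x)"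
          by (rule Finite_Cartesian_Product.norm_nth_le)
        then have "(cmod (mag_grad_classical a (\<psi> k) x $ j - g x $ j))\<^sup>2 \<le> (norm (mag_grad_classical a (\<psi> k) x - g x))\<^sup>2"
          by (intro power_mono) auto
        then have "(cmod (mag_grad_classical a (\<psi> k) x $ j - g x $ j))\<^sup>2
            \<le> (norm (mag_grad_classical a (\<psi> k) x - g x))\<^sup>2 + V x * (cmod (\<psi> k x - u x))\<^sup>2"
          using elim by (simp add: add_increasing2)
        then show ?case by (auto simp: indicator_def intro: ennreal_leI)
      qed
      then show ?thesis using k0 by (meson ennreal_leI order_trans)
    qed
    have cu: "\<exists>k0. \<forall>k\<ge>k0. (\<integral>\<^sup>+x. ennreal ((cmod (\<psi> k x - u x))\<^sup>2) * indicator K x \<partial>lebesgue) \<le> ennreal \<epsilon>"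
      if \<epsilon>: "0 < \<epsilon>" for \<epsilon>
    proof -
      define m where "m = measure lebesgue K"
      have m: "0 \<le> m" by (simp add: m_def)
      have em: "emeasure lebesgue K = ennreal m"
        unfolding m_def K_def using lmeasurable_cball emeasure_eq_measure2 by blast
      define t where "t = \<epsilon> / (2 * (m + 1))"
      have t: "0 < t" using \<epsilon> m by (simp add: t_def)
      have tm: "t * m \<le> \<epsilon> / 2"
      proof -
        have "t * m \<le> t * (m + 1)" using t by simp
        also have "\<dots> = \<epsilon> / 2" unfolding t_def by (rule half_quotient_mult) (use m in simp)
        finally show ?thesis .
      qed
      define B where "B = t powr (1 - q / 2)"
      have B: "0 < B" using t by (simp add: B_def)
      have "0 < \<epsilon> / (2 * B)" using \<epsilon> B by simp
      then obtain k0 where k0: "\<And>k. k0 \<le> k \<Longrightarrow> (1 / 4 :: real) ^ k \<le> \<epsilon> / (2 * B)" using small by blast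
      have "(\<integral>\<^sup>+x. ennreal ((cmod (\<psi> k x - u x))\<^sup>2) * indicator K x \<partial>lebesgue) \<le> ennreal \<epsilon>" if k: "k0 \<le> k" for k
      proof -
        have "(\<integral>\<^sup>+x. ennreal ((cmod (\<psi> k x - u x))\<^sup>2) * indicator K x \<partial>lebesgue)
            \<le> (\<integral>\<^sup>+x. ennreal t * indicator K x + ennreal B * ennreal (cmod (\<psi> k x - u x) powr q) \<partial>lebesgue)"
        proof (intro nn_integral_mono)
          fix x
          have "ennreal ((cmod (\<psi> k x - u x))\<^sup>2) \<le> ennreal (t + B * cmod (\<psi> k x - u x) powr q)"
            unfolding B_def by (intro ennreal_leI square_le_truncation q t)
          also have "\<dots> = ennreal t + ennreal B * ennreal (cmod (\<psi> k x - u x) powr q)"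
            using t B by (simp add: ennreal_mult)
          finally show "ennreal ((cmod (\<psi> k x - u x))\<^sup>2) * indicator K x
              \<le> ennreal t * indicator K x + ennreal B * ennreal (cmod (\<psi> k x - u x) powr q)"
            by (auto simp: indicator_def)
        qed
        also have "\<dots> = (\<integral>\<^sup>+x. ennreal t * indicator K x \<partial>lebesgue) + (\<integral>\<^sup>+x. ennreal B * ennreal (cmod (\<psi> k x - u x) powr q) \<partial>lebesgue)"
          by (rule nn_integral_add) measurable
        also have "(\<integral>\<^sup>+x. ennreal t * indicator K x \<partial>lebesgue) = ennreal (t * m)"
          using t m by (subst nn_integral_cmult_indicator) (auto simp: em ennreal_mult)
        also have "(\<integral>\<^sup>+x. ennreal B * ennreal (cmod (\<psi> k x - u x) powr q) \<partial>lebesgue)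
            = ennreal B * (\<integral>\<^sup>+x. ennreal (cmod (\<psi> k x - u x) powr q) \<partial>lebesgue)"
          by (rule nn_integral_cmult) measurable
        also have "\<dots> \<le> ennreal B * ennreal (\<epsilon> / (2 * B))"
          by (intro mult_left_mono order_trans[OF convq ennreal_leI] k0 k) simp
        also have "\<dots> = ennreal (\<epsilon> / 2)" using B \<epsilon> by (subst ennreal_mult[symmetric]) auto
        also have "ennreal (t * m) + ennreal (\<epsilon> / 2) = ennreal (t * m + \<epsilon> / 2)"
          using t m \<epsilon> by (intro ennreal_plus[symmetric]) auto
        also have "\<dots> \<le> ennreal \<epsilon>" using tm by (intro ennreal_leI) simp
        finally show ?thesis by (simp add: add_left_mono)
      qed
      then show ?thesis by blast
    qed
    have \<phi>2: "integrable lebesgue (\<lambda>x. (\<phi> x)\<^sup>2)"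
      by (rule integrable_compact_support[of _ 0 R]) (auto intro!: continuous_intros \<phi>c simp: R)
    have d\<phi>2: "integrable lebesgue (\<lambda>x. (partial j \<phi> x)\<^sup>2)"
      by (rule integrable_compact_support[of _ 0 R]) (auto intro!: continuous_intros d\<phi>c simp: dR)
    have \<phi>a2: "integrable lebesgue (\<lambda>x. (\<phi> x * a x $ j)\<^sup>2)"
    proof (rule Bochner_Integration.integrable_bound)
      show "integrable lebesgue (\<lambda>x. (\<phi> x)\<^sup>2 *\<^sub>R (norm (a x))\<^sup>2)"
        by (rule integrable_compact_support_mult[OF a2l, of _ 0 R]) (auto intro!: continuous_intros \<phi>c simp: R)
      show "AE x in lebesgue. norm ((\<phi> x * a x $ j)\<^sup>2) \<le> norm ((\<phi> x)\<^sup>2 *\<^sub>R (norm (a x))\<^sup>2)"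
        unfolding power_mult_distrib
        by (intro AE_I2) (simp add: mult_left_mono abs_le_square_iff[symmetric] component_le_norm_cart)
    qed measurable
    have \<psi>l: "loc_integrable (\<psi> k)" for k by (rule loc_integrable_continuous[OF test_fun_derivative(3)[OF \<psi>]])
    have i_u: "integrable lebesgue (\<lambda>x. partial j \<phi> x *\<^sub>R \<psi> k x)" for k
      by (rule integrable_compact_support_mult[OF \<psi>l d\<phi>c dR])
    have i_p: "integrable lebesgue (\<lambda>x. \<phi> x *\<^sub>R partial j (\<psi> k) x)" for k
      by (rule integrable_compact_support_mult[OF loc_integrable_continuous[OF continuous_partial[OF \<psi>]] \<phi>c R])
    have i_a: "integrable lebesgue (\<lambda>x. (\<phi> x * a x $ j) *\<^sub>R \<psi> k x)" for k
    proof -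
      obtain R' where R': "\<And>x. x \<notin> cball 0 R' \<Longrightarrow> \<psi> k x = 0" using test_fun_support[OF \<psi>[of k]] by blast
      obtain M where M: "0 < M" "\<And>x. norm (\<psi> k x) \<le> M"
        using bounded_of_compact_support[OF test_fun_derivative(3)[OF \<psi>[of k]] R'] by blast
      have i: "integrable lebesgue (\<lambda>x. M * (\<phi> x *\<^sub>R a x $ j))"
        using integrable_compact_support_mult[OF ajl \<phi>c R] by (rule integrable_mult_right)
      show ?thesis
      proof (rule Bochner_Integration.integrable_bound[OF i])
        show "AE x in lebesgue. norm ((\<phi> x * a x $ j) *\<^sub>R \<psi> k x) \<le> norm (M * (\<phi> x *\<^sub>R a x $ j))"
        proof (intro AE_I2)
          fix x
          have "\<bar>\<phi> x * a x $ j\<bar> * norm (\<psi> k x) \<le> \<bar>\<phi> x * a x $ j\<bar> * M" by (intro mult_left_mono M) simp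
          then show "norm ((\<phi> x * a x $ j) *\<^sub>R \<psi> k x) \<le> norm (M * (\<phi> x *\<^sub>R a x $ j))"
            using M(1) by (simp add: abs_mult mult.commute)
        qed
      qed measurable
    qed
    have D_eq: "\<phi> x *\<^sub>R (mag_grad_classical a (\<psi> k) x $ j) = \<phi> x *\<^sub>R partial j (\<psi> k) x - \<i> * ((\<phi> x * a x $ j) *\<^sub>R \<psi> k x)" for k x
      by (simp add: mag_grad_classical_def scaleR_conv_of_real algebra_simps)
    have i_D: "integrable lebesgue (\<lambda>x. \<phi> x *\<^sub>R (mag_grad_classical a (\<psi> k) x $ j))" for k
      unfolding D_eq by (intro Bochner_Integration.integrable_diff i_p integrable_mult_right i_a)
    note l1 = integral_pairing_tendsto[of \<phi> lebesgue "\<lambda>k x. mag_grad_classical a (\<psi> k) x $ j" "\<lambda>x. g x $ j" K, OF _ Dm gjm _ \<phi>2 _ cD i_D]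
    have L1: "integrable lebesgue (\<lambda>x. \<phi> x *\<^sub>R g x $ j)"
      "(\<lambda>k. LINT x|lebesgue. \<phi> x *\<^sub>R mag_grad_classical a (\<psi> k) x $ j) \<longlonglongrightarrow> (LINT x|lebesgue. \<phi> x *\<^sub>R g x $ j)"
      by (rule l1; use R in \<open>simp add: K_def\<close>)+
    note l2 = integral_pairing_tendsto[of "\<lambda>x. \<phi> x * a x $ j" lebesgue \<psi> u K, OF _ \<psi>m um _ \<phi>a2 _ cu i_a]
    have L2: "integrable lebesgue (\<lambda>x. (\<phi> x * a x $ j) *\<^sub>R u x)"
      "(\<lambda>k. LINT x|lebesgue. (\<phi> x * a x $ j) *\<^sub>R \<psi> k x) \<longlonglongrightarrow> (LINT x|lebesgue. (\<phi> x * a x $ j) *\<^sub>R u x)"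
      by (rule l2; use R in \<open>simp add: K_def\<close>)+
    note l3 = integral_pairing_tendsto[of "partial j \<phi>" lebesgue \<psi> u K, OF _ \<psi>m um _ d\<phi>2 _ cu i_u]
    have L3: "(\<lambda>k. LINT x|lebesgue. partial j \<phi> x *\<^sub>R \<psi> k x) \<longlonglongrightarrow> (LINT x|lebesgue. partial j \<phi> x *\<^sub>R u x)"
      by (rule l3(2)) (use dR in \<open>simp_all add: K_def\<close>)
    have "(LINT x|lebesgue. \<phi> x *\<^sub>R mag_grad_classical a (\<psi> k) x $ j) + \<i> * (LINT x|lebesgue. (\<phi> x * a x $ j) *\<^sub>R \<psi> k x)
        = - (LINT x|lebesgue. partial j \<phi> x *\<^sub>R \<psi> k x)" for k
    proof -
      have "(LINT x|lebesgue. \<phi> x *\<^sub>R mag_grad_classical a (\<psi> k) x $ j)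
          = (LINT x|lebesgue. \<phi> x *\<^sub>R partial j (\<psi> k) x) - (LINT x|lebesgue. \<i> * ((\<phi> x * a x $ j) *\<^sub>R \<psi> k x))"
        unfolding D_eq by (rule Bochner_Integration.integral_diff[OF i_p integrable_mult_right[OF i_a]])
      also have "(LINT x|lebesgue. \<i> * ((\<phi> x * a x $ j) *\<^sub>R \<psi> k x)) = \<i> * (LINT x|lebesgue. (\<phi> x * a x $ j) *\<^sub>R \<psi> k x)"
        by (rule integral_mult_right_zero)
      finally show ?thesis using test_by_parts_complex[OF \<phi> \<psi>[of k], of j] by simp
    qed
    then have "(\<lambda>k. - (LINT x|lebesgue. partial j \<phi> x *\<^sub>R \<psi> k x)) \<longlonglongrightarrow>
        (LINT x|lebesgue. \<phi> x *\<^sub>R g x $ j) + \<i> * (LINT x|lebesgue. (\<phi> x * a x $ j) *\<^sub>R u x)"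
      using tendsto_add[OF L1(2) tendsto_mult_left[OF L2(2), of \<i>]] by simp
    then have "(LINT x|lebesgue. \<phi> x *\<^sub>R g x $ j) + \<i> * (LINT x|lebesgue. (\<phi> x * a x $ j) *\<^sub>R u x)
        = - (LINT x|lebesgue. partial j \<phi> x *\<^sub>R u x)"
      by (rule LIMSEQ_unique[OF _ tendsto_minus[OF L3]])
    moreover have "(LINT x|lebesgue. \<phi> x *\<^sub>R (g x $ j + \<i> * of_real (a x $ j) * u x))
        = (LINT x|lebesgue. \<phi> x *\<^sub>R g x $ j) + \<i> * (LINT x|lebesgue. (\<phi> x * a x $ j) *\<^sub>R u x)"
    proof -
      have "\<phi> x *\<^sub>R (g x $ j + \<i> * of_real (a x $ j) * u x) = \<phi> x *\<^sub>R g x $ j + \<i> * ((\<phi> x * a x $ j) *\<^sub>R u x)" for x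
        by (simp add: scaleR_conv_of_real algebra_simps)
      then have "(LINT x|lebesgue. \<phi> x *\<^sub>R (g x $ j + \<i> * of_real (a x $ j) * u x))
          = (LINT x|lebesgue. \<phi> x *\<^sub>R g x $ j) + (LINT x|lebesgue. \<i> * ((\<phi> x * a x $ j) *\<^sub>R u x))"
        using Bochner_Integration.integral_add[OF L1(1) integrable_mult_right[OF L2(1), of \<i>]] by simp
      then show ?thesis by (simp only: integral_mult_right_zero)
    qed
    ultimately show "(LINT x|lebesgue. \<phi> x *\<^sub>R (g x $ j + \<i> * of_real (a x $ j) * u x)) = - (LINT x|lebesgue. partial j \<phi> x *\<^sub>R u x)"
      by simp
  qed
qed

lemma loc_integrable_test_AE_eq_0:
  fixes f :: "real^'n \<Rightarrow> complex"
  assumes f: "loc_integrable f" and zero: "\<And>\<phi> :: real^'n \<Rightarrow> real. test_fun \<phi> \<Longrightarrow> (LINT x|lebesgue. \<phi> x *\<^sub>R f x) = 0"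
  shows "AE x in lebesgue. f x = 0"
proof -
  have key: "AE x in lebesgue. T (f x) = 0" if T: "bounded_linear T" for T :: "complex \<Rightarrow> real"
  proof (rule AE_eq_0_if_test_integrals_eq_0)
    have Tm: "T \<in> borel_measurable borel"
      by (intro borel_measurable_continuous_onI linear_continuous_on T)
    show "loc_integrable (\<lambda>x. T (f x))"
    proof (rule loc_integrableI)
      show "(\<lambda>x. T (f x)) \<in> borel_measurable lebesgue"
        by (rule measurable_compose[OF loc_integrable_measurable[OF f] Tm])
      show "integrable lebesgue (\<lambda>x. indicator (cball 0 R) x *\<^sub>R T (f x))" for R
        using integrable_bounded_linear[OF T loc_integrable_cball[OF f, of 0 R]] by (simp add: linear_simps(5)[OF T])
    qed
    fix \<phi> :: "real^'n \<Rightarrow> real" assume \<phi>: "test_fun \<phi>"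
    obtain R where R: "\<And>x. x \<notin> cball 0 R \<Longrightarrow> \<phi> x = 0" using test_fun_support[OF \<phi>] by blast
    have i: "integrable lebesgue (\<lambda>x. \<phi> x *\<^sub>R f x)"
      by (rule integrable_compact_support_mult[OF f test_fun_derivative(3)[OF \<phi>] R])
    have "(LINT x|lebesgue. \<phi> x * T (f x)) = T (LINT x|lebesgue. \<phi> x *\<^sub>R f x)"
      by (subst integral_bounded_linear[OF T i, symmetric]) (simp add: linear_simps(5)[OF T])
    then show "(LINT x|lebesgue. \<phi> x * T (f x)) = 0" using zero[OF \<phi>] by (simp add: linear_simps(3)[OF T])
  qed
  show ?thesis using key[OF bounded_linear_Re] key[OF bounded_linear_Im]
    by eventually_elim (simp add: complex_eq_iff)
qed

lemma loc_integrable_cmult: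
  fixes f :: "real^'n \<Rightarrow> complex"
  assumes "loc_integrable f" shows "loc_integrable (\<lambda>x. k * f x)"
proof (rule loc_integrableI)
  show "(\<lambda>x. k * f x) \<in> borel_measurable lebesgue"
    using loc_integrable_measurable[OF assms] by measurable
  show "integrable lebesgue (\<lambda>x. indicator (cball 0 R) x *\<^sub>R (k * f x))" for R
    using integrable_mult_right[OF loc_integrable_cball[OF assms, of 0 R], of k] by simp
qed

lemma has_mag_grad_loc_integrable:
  assumes "has_mag_grad a u g" shows "loc_integrable (\<lambda>x. g x $ j)"
proof -
  have G: "loc_integrable (\<lambda>x. g x $ j + \<i> * of_real (a x $ j) * u x)" and au: "loc_integrable (\<lambda>x. of_real (a x $ j) * u x)"
    using assms unfolding has_mag_grad_def has_weak_partial_def by blast+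
  have "loc_integrable (\<lambda>x. (g x $ j + \<i> * of_real (a x $ j) * u x) + - \<i> * (of_real (a x $ j) * u x))"
    by (rule loc_integrable_add[OF G loc_integrable_cmult[OF au]])
  then show ?thesis by (simp add: mult.assoc)
qed

lemma has_mag_grad_measurable:
  assumes "has_mag_grad a u g" shows "g \<in> borel_measurable lebesgue"
  by (rule borel_measurable_vecI, rule loc_integrable_measurable, rule has_mag_grad_loc_integrable[OF assms])

text \<open>Identifies the magnetic gradient obtained by choice with the limit of the classical ones.\<close>

lemma has_mag_grad_unique:
  fixes a :: "real^'n \<Rightarrow> real^'n"
  assumes g: "has_mag_grad a u g" and g': "has_mag_grad a u g'"
  shows "AE x in lebesgue. g x = g' x"
proof -
  have "AE x in lebesgue. g x $ j = g' x $ j" for j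
  proof -
    define G where "G x = g x $ j + \<i> * of_real (a x $ j) * u x" for x
    define G' where "G' x = g' x $ j + \<i> * of_real (a x $ j) * u x" for x
    have w: "has_weak_partial j u G" "has_weak_partial j u G'"
      using g g' unfolding has_mag_grad_def G_def[abs_def] G'_def[abs_def] by blast+
    then have l: "loc_integrable G" "loc_integrable G'" by (auto simp: has_weak_partial_def)
    have d: "loc_integrable (\<lambda>x. G x - G' x)"
      using loc_integrable_add[OF l(1) loc_integrable_cmult[OF l(2), of "-1"]] by simp
    have "AE x in lebesgue. G x - G' x = 0"
    proof (rule loc_integrable_test_AE_eq_0[OF d])
      fix \<phi> :: "real^'n \<Rightarrow> real" assume \<phi>: "test_fun \<phi>"
      obtain R where R: "\<And>x. x \<notin> cball 0 R \<Longrightarrow> \<phi> x = 0" using test_fun_support[OF \<phi>] by blast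
      have i: "integrable lebesgue (\<lambda>x. \<phi> x *\<^sub>R F x)" if "loc_integrable F" for F :: "real^'n \<Rightarrow> complex"
        by (rule integrable_compact_support_mult[OF that test_fun_derivative(3)[OF \<phi>] R])
      have "(LINT x|lebesgue. \<phi> x *\<^sub>R G x) = (LINT x|lebesgue. \<phi> x *\<^sub>R G' x)"
        using w \<phi> by (simp add: has_weak_partial_def)
      then show "(LINT x|lebesgue. \<phi> x *\<^sub>R (G x - G' x)) = 0"
        unfolding scaleR_diff_right Bochner_Integration.integral_diff[OF i[OF l(1)] i[OF l(2)]] by simp
    qed
    then show ?thesis by eventually_elim (simp add: G_def G'_def)
  qed
  then have "AE x in lebesgue. \<forall>j. g x $ j = g' x $ j" by (simp add: AE_all_countable)
  then show ?thesis by eventually_elim (simp add: vec_eq_iff)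
qed

text \<open>The energy of each approximant exceeds twice the energy of the limit by an amount that tends
  to zero, so an inequality with a measurable weight passes from test functions to the energy space
  by Fatou's lemma.\<close>

lemma energy_space_inequality:
  fixes A :: "real^'n \<Rightarrow> complex^'n^'n" and V h :: "real^'n \<Rightarrow> real" and a :: "real^'n \<Rightarrow> real^'n" and u :: "real^'n \<Rightarrow> complex"
  assumes A: "elliptic lam Lam A" and V: "loc_integrable V" "AE x in lebesgue. 0 \<le> V x" and a: "loc_Lp 2 a"
    and n: "3 \<le> CARD('n)" and u: "u \<in> hom_energy_space A a V" and h: "h \<in> borel_measurable lebesgue" and C: "0 \<le> C"
    and le: "\<And>\<psi>. test_fun \<psi> \<Longrightarrow> (\<integral>\<^sup>+x. ennreal ((cmod (\<psi> x))\<^sup>2 * h x) \<partial>lebesgue)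
      \<le> ennreal C * (\<integral>\<^sup>+x. ennreal ((norm (mag_grad_classical a \<psi> x))\<^sup>2 + V x * (cmod (\<psi> x))\<^sup>2) \<partial>lebesgue)"
  shows "(\<integral>\<^sup>+x. ennreal ((cmod (u x))\<^sup>2 * h x) \<partial>lebesgue) \<le> ennreal (2 * C / min lam 1 * energy A V u (mag_grad a u))"
proof -
  define q where "q = 2 * real CARD('n) / (real CARD('n) - 2)"
  have q: "2 \<le> q" using n by (simp add: q_def field_simps)
  have um[measurable]: "u \<in> borel_measurable lebesgue" and uq: "(\<integral>\<^sup>+x. ennreal (cmod (u x) powr q) \<partial>lebesgue) < \<infinity>"
    using u unfolding q_def by (auto simp: hom_energy_space_def Let_def)
  note [measurable] = h
  note Vm[measurable] = loc_integrable_measurable[OF V(1)]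
  have lam: "0 < min lam 1" using A by (simp add: elliptic_def)
  obtain g \<psi> where \<psi>: "\<And>k. test_fun (\<psi> k)" and gm[measurable]: "g \<in> borel_measurable lebesgue"
    and ae: "AE x in lebesgue. (\<lambda>k. \<psi> k x) \<longlonglongrightarrow> u x"
    and conv: "\<And>k. (\<integral>\<^sup>+x. ennreal ((norm (mag_grad_classical a (\<psi> k) x - g x))\<^sup>2 + V x * (cmod (\<psi> k x - u x))\<^sup>2) \<partial>lebesgue) \<le> ennreal ((1 / 4) ^ k)"
    and convq: "\<And>k. (\<integral>\<^sup>+x. ennreal (cmod (\<psi> k x - u x) powr q) \<partial>lebesgue) \<le> ennreal ((1 / 4) ^ k)"
  proof (rule completion_limit[OF A V a n u, folded q_def], goal_cases)
    case (1 g \<psi>)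
    show ?case by (rule 1(1)[OF 1(2-)])
  qed
  have \<psi>m[measurable]: "\<psi> k \<in> borel_measurable lebesgue" for k
    by (rule continuous_imp_lebesgue_measurable[OF test_fun_derivative(3)[OF \<psi>]])
  define D where "D k = mag_grad_classical a (\<psi> k)" for k
  have Dm[measurable]: "D k \<in> borel_measurable lebesgue" for k
    unfolding D_def by (rule borel_measurable_mag_grad_classical[OF \<psi> a])
  define E where "E = (\<integral>\<^sup>+x. ennreal ((norm (g x))\<^sup>2 + V x * (cmod (u x))\<^sup>2) \<partial>lebesgue)"
  define Ek where "Ek k = (\<integral>\<^sup>+x. ennreal ((norm (D k x))\<^sup>2 + V x * (cmod (\<psi> k x))\<^sup>2) \<partial>lebesgue)" for k
  have sq: "(norm y)\<^sup>2 \<le> 2 * (norm z)\<^sup>2 + 2 * (norm (y - z))\<^sup>2" for y z :: "'c::real_normed_vector"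
  proof -
    have "norm y \<le> norm z + norm (y - z)" using norm_triangle_ineq[of z "y - z"] by simp
    then have "(norm y)\<^sup>2 \<le> (norm z + norm (y - z))\<^sup>2" by (intro power_mono) auto
    also have "\<dots> \<le> 2 * (norm z)\<^sup>2 + 2 * (norm (y - z))\<^sup>2"
      using zero_le_power2[of "norm z - norm (y - z)"] by (simp add: power2_sum power2_diff)
    finally show ?thesis .
  qed
  have triangle: "(\<integral>\<^sup>+x. ennreal ((norm (G1 x))\<^sup>2 + V x * (cmod (u1 x))\<^sup>2) \<partial>lebesgue)
      \<le> 2 * (\<integral>\<^sup>+x. ennreal ((norm (G2 x))\<^sup>2 + V x * (cmod (u2 x))\<^sup>2) \<partial>lebesgue)
        + 2 * (\<integral>\<^sup>+x. ennreal ((norm (G1 x - G2 x))\<^sup>2 + V x * (cmod (u1 x - u2 x))\<^sup>2) \<partial>lebesgue)"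
    if [measurable]: "G1 \<in> borel_measurable lebesgue" "G2 \<in> borel_measurable lebesgue"
      "u1 \<in> borel_measurable lebesgue" "u2 \<in> borel_measurable lebesgue"
    for G1 G2 :: "real^'n \<Rightarrow> complex^'n" and u1 u2 :: "real^'n \<Rightarrow> complex"
  proof -
    have "(\<integral>\<^sup>+x. ennreal ((norm (G1 x))\<^sup>2 + V x * (cmod (u1 x))\<^sup>2) \<partial>lebesgue)
      \<le> (\<integral>\<^sup>+x. 2 * ennreal ((norm (G2 x))\<^sup>2 + V x * (cmod (u2 x))\<^sup>2)
        + 2 * ennreal ((norm (G1 x - G2 x))\<^sup>2 + V x * (cmod (u1 x - u2 x))\<^sup>2) \<partial>lebesgue)"
    proof (rule nn_integral_mono_AE, use V(2) in eventually_elim)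
      case (elim x)
      define P where "P = (norm (G2 x))\<^sup>2 + V x * (cmod (u2 x))\<^sup>2"
      define Q where "Q = (norm (G1 x - G2 x))\<^sup>2 + V x * (cmod (u1 x - u2 x))\<^sup>2"
      have PQ: "0 \<le> P" "0 \<le> Q" using elim by (auto simp: P_def Q_def)
      have "V x * (cmod (u1 x))\<^sup>2 \<le> V x * (2 * (cmod (u2 x))\<^sup>2 + 2 * (cmod (u1 x - u2 x))\<^sup>2)"
        by (intro mult_left_mono sq elim)
      then have "(norm (G1 x))\<^sup>2 + V x * (cmod (u1 x))\<^sup>2 \<le> 2 * P + 2 * Q"
        using sq[of "G1 x" "G2 x"] by (simp add: P_def Q_def algebra_simps)
      then have "ennreal ((norm (G1 x))\<^sup>2 + V x * (cmod (u1 x))\<^sup>2) \<le> ennreal (2 * P + 2 * Q)" by (rule ennreal_leI)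
      also have "\<dots> = 2 * ennreal P + 2 * ennreal Q"
        using PQ by (simp add: ennreal_mult)
      finally show ?case by (simp only: P_def Q_def)
    qed
    then show ?thesis by (simp add: nn_integral_add nn_integral_cmult)
  qed
  have Ek_le: "Ek k \<le> 2 * E + 2 * ennreal ((1 / 4) ^ k)" for k
  proof -
    have "Ek k \<le> 2 * E + 2 * (\<integral>\<^sup>+x. ennreal ((norm (D k x - g x))\<^sup>2 + V x * (cmod (\<psi> k x - u x))\<^sup>2) \<partial>lebesgue)"
      unfolding Ek_def E_def by (rule triangle[OF Dm gm \<psi>m um])
    also have "\<dots> \<le> 2 * E + 2 * ennreal ((1 / 4) ^ k)"
      using conv[of k] unfolding D_def[symmetric] by (intro add_left_mono mult_left_mono) auto
    finally show ?thesis .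
  qed
  have Efin: "E < \<infinity>"
  proof -
    have "Ek 0 < \<infinity>"
    proof -
      have i: "integrable lebesgue (\<lambda>x. (norm (D 0 x))\<^sup>2 + V x * (cmod (\<psi> 0 x))\<^sup>2)"
        unfolding D_def by (intro Bochner_Integration.integrable_add integrable_mag_grad_classical integrable_test_square \<psi> a V)
      have "AE x in lebesgue. 0 \<le> (norm (D 0 x))\<^sup>2 + V x * (cmod (\<psi> 0 x))\<^sup>2"
        using V(2) by eventually_elim simp
      from nn_integral_eq_integral[OF i this] show ?thesis unfolding Ek_def by simp
    qed
    moreover have "E \<le> 2 * Ek 0 + 2 * (\<integral>\<^sup>+x. ennreal ((norm (g x - D 0 x))\<^sup>2 + V x * (cmod (u x - \<psi> 0 x))\<^sup>2) \<partial>lebesgue)"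
      unfolding Ek_def E_def by (rule triangle[OF gm Dm um \<psi>m])
    moreover have "(\<integral>\<^sup>+x. ennreal ((norm (g x - D 0 x))\<^sup>2 + V x * (cmod (u x - \<psi> 0 x))\<^sup>2) \<partial>lebesgue) \<le> 1"
      using conv[of 0] unfolding D_def[symmetric] by (simp add: norm_minus_commute)
    ultimately show ?thesis
      by (smt (verit, ccfv_threshold) add_left_mono ennreal_add_less_top ennreal_mult_less_top infinity_ennreal_def le_less_trans
          mult_left_mono ennreal_numeral_less_top mult_2 ennreal_one_less_top zero_le)
  qed
  have g2: "(\<integral>\<^sup>+x. ennreal ((norm (g x))\<^sup>2) \<partial>lebesgue) < \<infinity>"
  proof (rule le_less_trans[OF _ Efin])
    show "(\<integral>\<^sup>+x. ennreal ((norm (g x))\<^sup>2) \<partial>lebesgue) \<le> E"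
      unfolding E_def by (rule nn_integral_mono_AE, use V(2) in eventually_elim) (simp add: ennreal_leI)
  qed
  have grad: "has_mag_grad a u g"
    by (rule has_mag_grad_limit[OF a q V(2) um gm uq g2 \<psi> conv convq])
  have mg: "has_mag_grad a u (mag_grad a u)" unfolding mag_grad_def by (rule someI[of "has_mag_grad a u", OF grad])
  have mg_eq: "AE x in lebesgue. mag_grad a u x = g x" by (rule has_mag_grad_unique[OF mg grad])
  have E_eq: "(\<integral>\<^sup>+x. ennreal ((norm (mag_grad a u x))\<^sup>2 + V x * (cmod (u x))\<^sup>2) \<partial>lebesgue) = E"
    unfolding E_def by (rule nn_integral_cong_AE) (use mg_eq in eventually_elim, simp)
  note low = energy_lower_bound[OF A Vm V(2) um has_mag_grad_measurable[OF mg], unfolded E_eq, OF Efin]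
  have bound: "(\<integral>\<^sup>+x. ennreal ((cmod (u x))\<^sup>2 * h x) \<partial>lebesgue) \<le> ennreal C * (2 * E + 2 * ennreal ((1 / 4) ^ k))" for k
  proof (rule nn_integral_fatou_le)
    show "(\<lambda>x. ennreal ((cmod (\<psi> l x))\<^sup>2 * h x)) \<in> borel_measurable lebesgue" for l by measurable
    show "AE x in lebesgue. (\<lambda>l. ennreal ((cmod (\<psi> l x))\<^sup>2 * h x)) \<longlonglongrightarrow> ennreal ((cmod (u x))\<^sup>2 * h x)"
      using ae by eventually_elim (intro tendsto_intros tendsto_ennrealI)
    have "(\<integral>\<^sup>+x. ennreal ((cmod (\<psi> l x))\<^sup>2 * h x) \<partial>lebesgue) \<le> ennreal C * (2 * E + 2 * ennreal ((1 / 4) ^ k))" if l: "k \<le> l" for l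
    proof -
      have "ennreal ((1 / 4) ^ l) \<le> ennreal ((1 / 4) ^ k)" using l by (intro ennreal_leI power_decreasing) auto
      then have "Ek l \<le> 2 * E + 2 * ennreal ((1 / 4) ^ k)"
        by (intro order_trans[OF Ek_le] add_left_mono mult_left_mono) auto
      then show ?thesis using le[OF \<psi>[of l]] unfolding D_def[symmetric] Ek_def[symmetric]
        by (meson mult_left_mono order_trans zero_le)
    qed
    then show "\<forall>\<^sub>F l in sequentially. (\<integral>\<^sup>+x. ennreal ((cmod (\<psi> l x))\<^sup>2 * h x) \<partial>lebesgue) \<le> ennreal C * (2 * E + 2 * ennreal ((1 / 4) ^ k))"
      by (rule eventually_sequentiallyI)
  qed
  define e where "e = enn2real E"
  have e: "E = ennreal e" "0 \<le> e" using Efin by (auto simp: e_def)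
  have lim: "(\<lambda>k. ennreal (C * (2 * e + 2 * (1 / 4) ^ k))) \<longlonglongrightarrow> ennreal (C * (2 * e + 2 * 0))"
    by (intro tendsto_ennrealI tendsto_mult tendsto_add tendsto_const LIMSEQ_power_zero) simp
  have bd: "(\<integral>\<^sup>+x. ennreal ((cmod (u x))\<^sup>2 * h x) \<partial>lebesgue) \<le> ennreal (C * (2 * e + 2 * (1 / 4) ^ k))" for k
    using bound[of k] e C by (simp add: ennreal_mult')
  have "(\<integral>\<^sup>+x. ennreal ((cmod (u x))\<^sup>2 * h x) \<partial>lebesgue) \<le> ennreal (C * (2 * e + 2 * 0))"
    by (rule LIMSEQ_le_const[OF lim]) (use bd in blast)
  also have "\<dots> \<le> ennreal (2 * C / min lam 1 * energy A V u (mag_grad a u))"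
  proof (rule ennreal_leI)
    have "ennreal (min lam 1 * e) \<le> ennreal (energy A V u (mag_grad a u))"
      using low(1) lam e by (simp add: ennreal_mult')
    then have "min lam 1 * e \<le> energy A V u (mag_grad a u)" using low(2) by (simp add: ennreal_le_iff)
    then have "2 * C / min lam 1 * (min lam 1 * e) \<le> 2 * C / min lam 1 * energy A V u (mag_grad a u)"
      using C lam by (intro mult_left_mono) auto
    moreover have "2 * C / min lam 1 * (min lam 1 * e) = C * (2 * e + 2 * 0)"
      using lam by (simp only: times_divide_eq_left) (simp add: min_def)
    ultimately show "C * (2 * e + 2 * 0) \<le> 2 * C / min lam 1 * energy A V u (mag_grad a u)" by simp
  qed
  finally show ?thesis .
qed

theorem corollary3p30:
  fixes lam c c' K :: real
  assumes "3 \<le> CARD('n::finite)" and "0 < lam" and "0 \<le> c" and "0 \<le> c'"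
  shows "\<exists>C>0. \<forall>(a :: real ^ 'n \<Rightarrow> real ^ 'n) (A :: real ^ 'n \<Rightarrow> complex ^ 'n ^ 'n)
           (V :: real ^ 'n \<Rightarrow> real) (B :: real ^ 'n \<Rightarrow> real ^ 'n ^ 'n)
           (DB :: real ^ 'n \<Rightarrow> real ^ 'n ^ 'n ^ 'n) (Lam :: real) w.
     w = (\<lambda>x. V x + norm (B x)) \<and>
     loc_Lp 2 a \<and>
     elliptic lam Lam A \<and>
     loc_integrable V \<and>
     has_magnetic_field a B \<and>
     has_weak_gradient_field B DB \<and>
     w \<in> RH (real CARD('n) / 2) \<and>
     RH_norm (real CARD('n) / 2) w = ennreal K \<and>
     (AE x in lebesgue. 0 \<le> V x \<and> ennreal (V x) \<le> ennreal c * (m_aux w x)\<^sup>2) \<and>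
     (AE x in lebesgue. ennreal (norm (DB x)) \<le> ennreal c' * (m_aux w x) ^ 3)
     \<longrightarrow> (\<forall>u \<in> hom_energy_space A a V.
           (\<integral>\<^sup>+x. (m_aux w x)\<^sup>2 * ennreal ((cmod (u x))\<^sup>2) \<partial>lebesgue)
             \<le> ennreal (C * energy A V u (mag_grad a u)))"
proof -
  note n = assms(1)
  obtain \<kappa> where \<kappa>: "0 < \<kappa>" and crit: "\<And>w :: real^'n \<Rightarrow> real. w \<in> RH (real CARD('n) / 2) \<Longrightarrow>
      RH_norm (real CARD('n) / 2) w = ennreal K \<Longrightarrow> (\<forall>x. m_aux w x = 0) \<or>
      (\<exists>\<rho>. (\<forall>x. 0 < \<rho> x) \<and> (\<forall>x y. \<rho> x \<le> \<rho> y + dist x y) \<and> (\<forall>x. m_aux w x \<le> ennreal (1 / \<rho> x)) \<and>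
        (\<forall>x. \<kappa> * \<rho> x ^ (CARD('n) - 2) \<le> (LINT y:ball x (\<rho> x / 4)|lebesgue. w y)))"
    using exists_critical_radius[OF n, of K] by blast
  obtain C where C: "0 < C" and test: "\<forall>(a :: real^'n \<Rightarrow> real^'n) (V :: real^'n \<Rightarrow> real) (B :: real^'n \<Rightarrow> real^'n^'n)
      (DB :: real^'n \<Rightarrow> real^'n^'n^'n) (u :: real^'n \<Rightarrow> complex) \<rho>.
    test_fun u \<longrightarrow> loc_Lp 2 a \<longrightarrow> loc_integrable V \<longrightarrow> loc_integrable (\<lambda>x. V x + norm (B x)) \<longrightarrow>
    has_magnetic_field a B \<longrightarrow> has_weak_gradient_field B DB \<longrightarrow>
    (\<forall>x. 0 < \<rho> x) \<longrightarrow> (\<forall>x y. \<rho> x \<le> \<rho> y + dist x y) \<longrightarrow>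
    (\<forall>x. \<kappa> * \<rho> x ^ (CARD('n) - 2) \<le> (LINT y:ball x (\<rho> x / 4)|lebesgue. V y + norm (B y))) \<longrightarrow>
    (AE x in lebesgue. 0 \<le> V x \<and> V x \<le> c / (\<rho> x)\<^sup>2) \<longrightarrow> (AE x in lebesgue. norm (DB x) \<le> c' / (\<rho> x) ^ 3) \<longrightarrow>
    (\<integral>\<^sup>+x. ennreal ((cmod (u x))\<^sup>2 / (\<rho> x)\<^sup>2) \<partial>lebesgue)
      \<le> ennreal C * (\<integral>\<^sup>+x. ennreal ((norm (mag_grad_classical a u x))\<^sup>2 + V x * (cmod (u x))\<^sup>2) \<partial>lebesgue)"
    using global_energy_test[OF n assms(3,4) \<kappa>] by blast
  show ?thesis
  proof (intro exI[of _ "2 * C / min lam 1"] conjI allI impI ballI)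
    show "0 < 2 * C / min lam 1" using C assms(2) by simp
    fix a :: "real^'n \<Rightarrow> real^'n" and A :: "real^'n \<Rightarrow> complex^'n^'n" and V :: "real^'n \<Rightarrow> real"
      and B :: "real^'n \<Rightarrow> real^'n^'n" and DB :: "real^'n \<Rightarrow> real^'n^'n^'n" and Lam :: real and w u
    assume "w = (\<lambda>x. V x + norm (B x)) \<and> loc_Lp 2 a \<and> elliptic lam Lam A \<and> loc_integrable V \<and>
      has_magnetic_field a B \<and> has_weak_gradient_field B DB \<and> w \<in> RH (real CARD('n) / 2) \<and>
      RH_norm (real CARD('n) / 2) w = ennreal K \<and>
      (AE x in lebesgue. 0 \<le> V x \<and> ennreal (V x) \<le> ennreal c * (m_aux w x)\<^sup>2) \<and>
      (AE x in lebesgue. ennreal (norm (DB x)) \<le> ennreal c' * (m_aux w x) ^ 3)"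
    then have w: "w = (\<lambda>x. V x + norm (B x))" and a: "loc_Lp 2 a" and A: "elliptic lam Lam A" and V: "loc_integrable V"
      and B: "has_magnetic_field a B" and DB: "has_weak_gradient_field B DB" and wRH: "w \<in> RH (real CARD('n) / 2)"
      and K: "RH_norm (real CARD('n) / 2) w = ennreal K"
      and Vm: "AE x in lebesgue. 0 \<le> V x \<and> ennreal (V x) \<le> ennreal c * (m_aux w x)\<^sup>2"
      and DBm: "AE x in lebesgue. ennreal (norm (DB x)) \<le> ennreal c' * (m_aux w x) ^ 3"
      by blast+
    assume u: "u \<in> hom_energy_space A a V"
    have V0: "AE x in lebesgue. 0 \<le> V x" using Vm by eventually_elim blast
    show "(\<integral>\<^sup>+x. (m_aux w x)\<^sup>2 * ennreal ((cmod (u x))\<^sup>2) \<partial>lebesgue)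
      \<le> ennreal (2 * C / min lam 1 * energy A V u (mag_grad a u))"
      using crit[OF wRH K]
    proof
      \<comment> \<open>The degenerate alternative, in which the left hand side vanishes.\<close>
      assume "\<forall>x. m_aux w x = 0"
      then show ?thesis by simp
    next
      assume "\<exists>\<rho>. (\<forall>x. 0 < \<rho> x) \<and> (\<forall>x y. \<rho> x \<le> \<rho> y + dist x y) \<and> (\<forall>x. m_aux w x \<le> ennreal (1 / \<rho> x)) \<and>
        (\<forall>x. \<kappa> * \<rho> x ^ (CARD('n) - 2) \<le> (LINT y:ball x (\<rho> x / 4)|lebesgue. w y))"
      then obtain \<rho> where \<rho>: "\<forall>x. 0 < \<rho> x" and lip: "\<forall>x y. \<rho> x \<le> \<rho> y + dist x y"
        and m: "\<And>x. m_aux w x \<le> ennreal (1 / \<rho> x)"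
        and mass: "\<forall>x. \<kappa> * \<rho> x ^ (CARD('n) - 2) \<le> (LINT y:ball x (\<rho> x / 4)|lebesgue. V y + norm (B y))"
        unfolding w by blast
      have pos: "0 < \<rho> x" for x using \<rho> by blast
      have m_power: "(m_aux w x) ^ k \<le> ennreal (1 / \<rho> x ^ k)" for x k
        using power_mono[OF m, of x k] pos[of x] by (simp add: ennreal_power power_one_over)
      have bound: "t \<le> d / \<rho> x ^ k" if "ennreal t \<le> ennreal d * (m_aux w x) ^ k" "0 \<le> d" for t d x k
      proof -
        have "ennreal t \<le> ennreal d * ennreal (1 / \<rho> x ^ k)"
          using that(1) mult_left_mono[OF m_power, of "ennreal d" x k] by (rule order_trans) simp
        also have "\<dots> = ennreal (d / \<rho> x ^ k)" using that(2) pos[of x] by (subst ennreal_mult[symmetric]) auto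
        finally show ?thesis using that(2) pos[of x] by (subst (asm) ennreal_le_iff) auto
      qed
      have V\<rho>: "AE x in lebesgue. 0 \<le> V x \<and> V x \<le> c / (\<rho> x)\<^sup>2"
        using Vm by eventually_elim (use bound assms(3) in blast)
      have DB\<rho>: "AE x in lebesgue. norm (DB x) \<le> c' / (\<rho> x) ^ 3"
        using DBm by eventually_elim (use bound assms(4) in blast)
      have wl: "loc_integrable (\<lambda>x. V x + norm (B x))"
        using wRH loc_Lp_imp_loc_integrable[of "real CARD('n) / 2" w] n unfolding w RH_def by simp
      have \<rho>c: "continuous_on UNIV \<rho>"
      proof (rule continuous_on_iff[THEN iffD2], intro ballI allI impI)
        fix x and e :: real assume e: "0 < e"
        have "dist (\<rho> y) (\<rho> x) < e" if "dist y x < e" for y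
          using lip[rule_format, of x y] lip[rule_format, of y x] that by (simp add: dist_real_def dist_commute abs_less_iff)
        then show "\<exists>d>0. \<forall>y\<in>UNIV. dist y x < d \<longrightarrow> dist (\<rho> y) (\<rho> x) < e" using e by blast
      qed
      have "continuous_on UNIV (\<lambda>x. 1 / (\<rho> x)\<^sup>2)"
        using pos by (intro continuous_intros \<rho>c) (simp add: less_imp_neq[THEN not_sym])
      then have hm: "(\<lambda>x. 1 / (\<rho> x)\<^sup>2) \<in> borel_measurable lebesgue" by (rule continuous_imp_lebesgue_measurable)
      have "(\<integral>\<^sup>+x. (m_aux w x)\<^sup>2 * ennreal ((cmod (u x))\<^sup>2) \<partial>lebesgue)
          \<le> (\<integral>\<^sup>+x. ennreal ((cmod (u x))\<^sup>2 * (1 / (\<rho> x)\<^sup>2)) \<partial>lebesgue)"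
      proof (rule nn_integral_mono)
        fix x
        have "(m_aux w x)\<^sup>2 * ennreal ((cmod (u x))\<^sup>2) \<le> ennreal (1 / (\<rho> x)\<^sup>2) * ennreal ((cmod (u x))\<^sup>2)"
          by (intro mult_right_mono m_power) simp
        also have "\<dots> = ennreal ((cmod (u x))\<^sup>2 * (1 / (\<rho> x)\<^sup>2))"
          by (subst ennreal_mult[symmetric]) (auto simp: mult.commute)
        finally show "(m_aux w x)\<^sup>2 * ennreal ((cmod (u x))\<^sup>2) \<le> ennreal ((cmod (u x))\<^sup>2 * (1 / (\<rho> x)\<^sup>2))" .
      qed
      also have "\<dots> \<le> ennreal (2 * C / min lam 1 * energy A V u (mag_grad a u))"
      proof (rule energy_space_inequality[OF A V V0 a n u hm less_imp_le[OF C]])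
        fix \<psi> :: "real^'n \<Rightarrow> complex" assume \<psi>: "test_fun \<psi>"
        show "(\<integral>\<^sup>+x. ennreal ((cmod (\<psi> x))\<^sup>2 * (1 / (\<rho> x)\<^sup>2)) \<partial>lebesgue)
          \<le> ennreal C * (\<integral>\<^sup>+x. ennreal ((norm (mag_grad_classical a \<psi> x))\<^sup>2 + V x * (cmod (\<psi> x))\<^sup>2) \<partial>lebesgue)"
          using test[rule_format, OF \<psi> a V wl B DB pos lip[rule_format] mass[rule_format] V\<rho> DB\<rho>] by simp
      qed
      finally show ?thesis .
    qed
  qed
qed

end
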